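(* Let $p\in(1,\infty)$ and let $m$ be a positive integer. Let $E\subset\mathbb{R}$ be a closed set containing at least $m+1$ points. A function $f:E\to\mathbb{R}$ can be extended to a function $F\in L^m_p(\mathbb{R})$ if and only if the quantity $$\mathcal{L}_{m,p}(f:E)=\sup_{\{x_0,\dots,x_n\}\subset E}\left(\sum_{i=0}^{n-m}(x_{i+m}-x_i)\,|\Delta^mf[x_i,\dots,x_{i+m}]|^p\right)^{1/p}$$ is finite. Here the supremum is taken over all finite strictly increasing sequences $\{x_0,\dots,x_n\}\subset E$ with $n\ge m$. Furthermore, $$\|f\|_{L^m_p(\mathbb{R})|_E}\sim\mathcal{L}_{m,p}(f:E),$$ with constants in this equivalence depending only on $m$ (i.e. each side is at most $C$ times the other, with $C\ge1$ depending only on $m$).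
   Context: $L^m_p(\mathbb{R})$ is the homogeneous Sobolev space of functions $F:\mathbb{R}\to\mathbb{R}$ such that $F^{(m-1)}$ exists and is (locally) absolutely continuous and $F^{(m)}\in L_p(\mathbb{R})$, seminormed by $\|F\|_{L^m_p(\mathbb{R})}=\|F^{(m)}\|_{L_p(\mathbb{R})}$. The trace seminorm is $\|f\|_{L^m_p(\mathbb{R})|_E}=\inf\{\|F\|_{L^m_p(\mathbb{R})}:F\in L^m_p(\mathbb{R}),\,F|_E=f\}$ (equal to $+\infty$ if there is no such $F$). For an $(m+1)$-point set $S=\{x_0,\dots,x_m\}\subset\mathbb{R}$, the divided difference $\Delta^mf[S]=\Delta^mf[x_0,\dots,x_m]$ is the coefficient of $x^m$ in the Lagrange polynomial of degree at most $m$ which agrees with $f$ on $S$. *)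

theory Defs
  imports "HOL-Analysis.Analysis" "HOL-Computational_Algebra.Polynomial"
begin

text \<open>Absolute continuity of a function (the library's \<open>absolutely_continuous\<close> is about measures).
  The members of a division are finitely many compact intervals (possibly degenerate) with pairwise
  disjoint interiors; for such an interval \<open>K\<close>, \<open>Inf K\<close> and \<open>Sup K\<close> are its end points.\<close>

definition abs_continuous_on :: "real set \<Rightarrow> (real \<Rightarrow> real) \<Rightarrow> bool" where
  "abs_continuous_on S g \<longleftrightarrow>
     (\<forall>\<epsilon>>0. \<exists>\<delta>>0. \<forall>\<D>. \<D> division_of \<Union>\<D> \<and> \<Union>\<D> \<subseteq> S \<and> (\<Sum>K\<in>\<D>. Sup K - Inf K) < \<delta>
        \<longrightarrow> (\<Sum>K\<in>\<D>. \<bar>g (Sup K) - g (Inf K)\<bar>) < \<epsilon>)"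

definition locally_abs_continuous :: "(real \<Rightarrow> real) \<Rightarrow> bool" where
  "locally_abs_continuous g \<longleftrightarrow> (\<forall>a b. abs_continuous_on {a..b} g)"

definition Lp_function :: "real \<Rightarrow> (real \<Rightarrow> real) \<Rightarrow> bool" where
  "Lp_function p g \<longleftrightarrow>
     g \<in> borel_measurable lebesgue \<and> integrable lebesgue (\<lambda>x. \<bar>g x\<bar> powr p)"

definition Lp_norm :: "real \<Rightarrow> (real \<Rightarrow> real) \<Rightarrow> real" where
  "Lp_norm p g = (LINT x|lebesgue. \<bar>g x\<bar> powr p) powr (1 / p)"

text \<open>Homogeneous Sobolev space, for \<open>m \<ge> 1\<close>. The derivative of order \<open>m - 1\<close> exists everywhere. As it
  is locally absolutely continuous, the derivative of order \<open>m\<close> exists almost everywhere; on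
  the remaining null set \<open>deriv\<close> has an unspecified value, which affects neither membership
  in \<open>L\<^sub>p\<close> nor the norm.\<close>

definition homogeneous_Sobolev :: "nat \<Rightarrow> real \<Rightarrow> (real \<Rightarrow> real) set" where
  "homogeneous_Sobolev m p =
     {F. (\<forall>k<m - 1. \<forall>x. (deriv ^^ k) F field_differentiable at x) \<and>
         locally_abs_continuous ((deriv ^^ (m - 1)) F) \<and>
         Lp_function p ((deriv ^^ m) F)}"

definition Sobolev_seminorm :: "nat \<Rightarrow> real \<Rightarrow> (real \<Rightarrow> real) \<Rightarrow> real" where
  "Sobolev_seminorm m p F = Lp_norm p ((deriv ^^ m) F)"

text \<open>A function \<open>E \<rightarrow> \<real>\<close> is represented by any total function; its values outside
  \<open>E\<close> are never used.\<close>

definition Sobolev_extensions ::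
    "nat \<Rightarrow> real \<Rightarrow> real set \<Rightarrow> (real \<Rightarrow> real) \<Rightarrow> (real \<Rightarrow> real) set" where
  "Sobolev_extensions m p E f = {F \<in> homogeneous_Sobolev m p. \<forall>x\<in>E. F x = f x}"

text \<open>The infimum over the empty set is \<open>\<infinity>\<close> in \<^typ>\<open>ennreal\<close>.\<close>

definition trace_seminorm :: "nat \<Rightarrow> real \<Rightarrow> real set \<Rightarrow> (real \<Rightarrow> real) \<Rightarrow> ennreal" where
  "trace_seminorm m p E f = (INF F\<in>Sobolev_extensions m p E f. ennreal (Sobolev_seminorm m p F))"

definition Lagrange_poly :: "nat \<Rightarrow> (real \<Rightarrow> real) \<Rightarrow> real set \<Rightarrow> real poly" where
  "Lagrange_poly m f S = (THE P. degree P \<le> m \<and> (\<forall>x\<in>S. poly P x = f x))"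

definition divided_difference :: "nat \<Rightarrow> (real \<Rightarrow> real) \<Rightarrow> real set \<Rightarrow> real" where
  "divided_difference m f S = coeff (Lagrange_poly m f S) m"

lemma Lagrange_poly_ex1:
  fixes f :: "real \<Rightarrow> real"
  assumes "card S = Suc m"
  shows "\<exists>!P. degree P \<le> m \<and> (\<forall>x\<in>S. poly P x = f x)"
proof -
  have fin: "finite S"
    by (rule card_ge_0_finite) (simp add: assms)
  define Q where "Q y = (\<Prod>z\<in>S - {y}. [:- z, 1:])" for y :: real
  define P where "P = (\<Sum>y\<in>S. smult (f y / poly (Q y) y) (Q y))"
  have degQ: "degree (Q y) \<le> m" if "y \<in> S" for y
  proof -
    have "degree (Q y) \<le> (\<Sum>z\<in>S - {y}. degree [:- z, 1:])"
      unfolding Q_def by (rule order_trans[OF degree_prod_sum_le]) (use fin in auto)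
    then show ?thesis
      using that assms fin by simp
  qed
  have degP: "degree P \<le> m"
    unfolding P_def
    by (rule degree_sum_le) (use fin degQ in \<open>auto intro: order_trans[OF degree_smult_le]\<close>)
  have "poly P x = f x" if "x \<in> S" for x
  proof -
    have "poly P x = (\<Sum>y\<in>S. if y = x then f x else 0)"
      unfolding P_def poly_sum
    proof (rule sum.cong)
      fix y assume "y \<in> S"
      show "poly (smult (f y / poly (Q y) y) (Q y)) x = (if y = x then f x else 0)"
        using fin that by (auto simp: Q_def poly_prod)
    qed simp
    then show ?thesis
      using fin that by simp
  qed
  moreover have "P1 = P2"
    if P1: "degree P1 \<le> m" "\<forall>x\<in>S. poly P1 x = f x"
      and P2: "degree P2 \<le> m" "\<forall>x\<in>S. poly P2 x = f x" for P1 P2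
  proof (rule ccontr)
    assume ne: "P1 \<noteq> P2"
    have "card S \<le> card {x. poly (P1 - P2) x = 0}"
      using ne P1 P2 by (intro card_mono poly_roots_finite) auto
    also have "\<dots> \<le> degree (P1 - P2)"
      using ne by (intro card_poly_roots_bound) auto
    also have "\<dots> \<le> m"
      using P1 P2 by (intro degree_diff_le)
    finally show False
      using assms by simp
  qed
  ultimately show ?thesis
    using degP by blast
qed

definition increasing_sequences :: "nat \<Rightarrow> real set \<Rightarrow> (nat \<times> (nat \<Rightarrow> real)) set" where
  "increasing_sequences m E = {(n, x). m \<le> n \<and> strict_mono_on {0..n} x \<and> x ` {0..n} \<subseteq> E}"

definition variation_functional :: "nat \<Rightarrow> real \<Rightarrow> real set \<Rightarrow> (real \<Rightarrow> real) \<Rightarrow> ennreal" where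
  "variation_functional m p E f =
     (SUP (n, x)\<in>increasing_sequences m E.
        ennreal ((\<Sum>i=0..n - m. (x (i + m) - x i) *
                    \<bar>divided_difference m f (x ` {i..i + m})\<bar> powr p) powr (1 / p)))"

end

theory Submission
  imports Defs
begin

text \<open>Say that \<open>W\<close> with \<open>0 \<le> W \<le> K\<close> is a majorant of \<open>G\<close> if
  \<open>\<bar>G b - G a\<bar>\<^sup>p \<le> (b - a)\<^sup>p\<^sup>-\<^sup>1 (W b - W a)\<close> for \<open>a < b\<close>. By a theorem of F. Riesz, such a \<open>W\<close>
  exists iff \<open>G\<close> is locally absolutely continuous and \<open>\<integral> \<bar>G'\<bar>\<^sup>p \<le> K\<close>; this turns both directions into
  statements about \<open>G = F\<^sup>(\<^sup>m\<^sup>-\<^sup>1\<^sup>)\<close> without integrals.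

  Necessity: \<open>(x\<^sub>i\<^sub>+\<^sub>m - x\<^sub>i) (m - 1)! \<Delta>\<^sup>m f[x\<^sub>i, \<dots>, x\<^sub>i\<^sub>+\<^sub>m]\<close> is a difference of two values of \<open>G\<close> on
  \<open>{x\<^sub>i..x\<^sub>i\<^sub>+\<^sub>m}\<close>, by the recurrence and the mean value theorem for divided differences, and the increments
  \<open>W x\<^sub>i\<^sub>+\<^sub>m - W x\<^sub>i\<close> telescope with multiplicity \<open>m\<close>.

  Sufficiency for finite sets follows a construction of de Boor: in Newton's formula, the term
  belonging to \<open>\<Delta>\<^sup>m f[x\<^sub>i, \<dots>, x\<^sub>i\<^sub>+\<^sub>m]\<close> is switched on by a spline step across the longest gap of
  \<open>x\<^sub>i, \<dots>, x\<^sub>i\<^sub>+\<^sub>m\<close>, so that its derivative of order \<open>m\<close> lives on this gap and is bounded by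
  \<open>C \<bar>\<Delta>\<^sup>m f\<bar>\<close>. For general sets, Tychonoff's theorem is applied to the values of the
  derivatives up to order \<open>m - 1\<close> and of the majorant; Taylor estimates and the majorant
  inequality are closed conditions in the product topology.\<close>

section \<open>Absolutely continuous functions\<close>

text \<open>The delicate point is that the constants must not depend on p. Every estimate compares
  p-th powers, and its constant is either bounded by \<open>C powr p\<close> with C built from m
  alone, or is m itself, where \<open>m powr (1 / p) \<le> m\<close>; so p disappears when the root
  is taken. Majorants are convenient because their inequality involves two points at a time and
  hence survives pointwise limits: no weak compactness in L_p is invoked, and Fatou's lemma enters
  only in the passage from a majorant back to the norm. Inequalities of Hoelder and Jensen type all
  come from the tangent line of \<open>t powr p\<close>, with a tangent point chosen for the
  purpose. In the finite construction the gap only has to fill at least 1/m of its window, and one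
  gap serves at most m windows; these two factors m are the whole loss beyond the constant of a
  single spline step.\<close>

lemma powr_tangent_le:
  fixes t c p :: real
  assumes "p \<ge> 1" "t \<ge> 0" "c > 0"
  shows "c powr p + p * c powr (p - 1) * (t - c) \<le> t powr p"
\<comment> \<open>Convexity is used on the open half line, so t = 0 is treated apart; there the left
  side is (1 - p) * c powr p, which is at most 0.\<close>
proof (cases "t = 0")
  case True
  have "c powr p = c powr (p - 1) * c"
    using assms by (simp add: powr_diff)
  then show ?thesis
    using True assms mult_right_mono[of 1 p "c powr (p - 1) * c"] by (simp add: mult.assoc)
next
  case False
  have der: "((\<lambda>x. x powr p) has_real_derivative p * c powr (p - 1)) (at c within {0<..})"
    using assms by (auto intro!: derivative_eq_intros)
  have "(t powr p) - c powr p \<ge> (p * c powr (p - 1)) * (t - c)"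
    by (rule convex_on_imp_above_tangent[OF powr_convex[of p] _ _ _ der])
       (use assms False in \<open>auto simp: interior_open\<close>)
  then show ?thesis by simp
qed

section \<open>Finite families of non-overlapping intervals\<close>

lemma interior_disjoint_Icc:
  fixes a b c d :: real
  assumes "a < b" "c < d" "interior {a..b} \<inter> interior {c..d} = {}"
  shows "b \<le> c \<or> d \<le> a"
proof (rule ccontr)
  assume "\<not> ?thesis"
  then have "(max a c + min b d) / 2 \<in> interior {a..b} \<inter> interior {c..d}"
    using assms(1,2) by auto
  then show False using assms(3) by blast
qed

text \<open>Indexed rather than a set of intervals, so that a degenerate interval may occur under
  several indices. This makes the notion stable under applying a monotone map to all end points, in
  particular under clamping.\<close>

definition disj_family :: "'i set \<Rightarrow> ('i \<Rightarrow> real) \<Rightarrow> ('i \<Rightarrow> real) \<Rightarrow> bool" where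
  "disj_family I u v \<longleftrightarrow>
     finite I \<and> (\<forall>i\<in>I. u i \<le> v i) \<and> (\<forall>i\<in>I. \<forall>j\<in>I. i \<noteq> j \<longrightarrow> v i \<le> u j \<or> v j \<le> u i)"

lemma disj_family_subset: "disj_family I u v \<Longrightarrow> J \<subseteq> I \<Longrightarrow> disj_family J u v"
  unfolding disj_family_def by (meson finite_subset subsetD)

lemma disj_family_mono_image:
  "disj_family I u v \<Longrightarrow> mono \<phi> \<Longrightarrow> disj_family I (\<lambda>i. \<phi> (u i)) (\<lambda>i. \<phi> (v i))"
  unfolding disj_family_def by (meson monoD)

text \<open>Strong induction on the number of members: removing one member k leaves the members to
  its left, a family in \<open>{c..u k}\<close>, and those to its right, a family in
  \<open>{v k..d}\<close>. The index set need not be sorted.\<close>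

lemma sum_disj_family_le:
  fixes W :: "real \<Rightarrow> real"
  assumes "disj_family I u v" "\<And>i. i \<in> I \<Longrightarrow> c \<le> u i \<and> v i \<le> d" "c \<le> d"
    and "mono_on {c..d} W"
  shows "(\<Sum>i\<in>I. W (v i) - W (u i)) \<le> W d - W c"
  using assms
proof (induction "card I" arbitrary: I c d rule: less_induct)
  case less
  have fin: "finite I" and le: "\<And>i. i \<in> I \<Longrightarrow> u i \<le> v i"
    using less.prems by (auto simp: disj_family_def)
  show ?case
  proof (cases "I = {}")
    case True
    then show ?thesis
      using less.prems by (auto dest: mono_onD)
  next
    case False
    then obtain k where k: "k \<in> I" by blast
    define J1 where "J1 = {j\<in>I - {k}. v j \<le> u k}"
    define J2 where "J2 = I - {k} - J1"
    have ck: "c \<le> u k" "u k \<le> v k" "v k \<le> d"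
      using less.prems(2)[OF k] le[OF k] by auto
    have sub: "J1 \<subset> I" "J2 \<subset> I"
      using k by (auto simp: J1_def J2_def)
    have 1: "(\<Sum>i\<in>J1. W (v i) - W (u i)) \<le> W (u k) - W c"
    proof (rule less.hyps)
      show "card J1 < card I" using sub fin by (simp add: psubset_card_mono)
      show "disj_family J1 u v" using disj_family_subset[OF less.prems(1)] sub by blast
      show "mono_on {c..u k} W" using less.prems(4) ck by (auto simp: mono_on_def)
    qed (use less.prems ck in \<open>auto simp: J1_def\<close>)
    have 2: "(\<Sum>i\<in>J2. W (v i) - W (u i)) \<le> W d - W (v k)"
    proof (rule less.hyps)
      show "card J2 < card I" using sub fin by (simp add: psubset_card_mono)
      show "disj_family J2 u v" using disj_family_subset[OF less.prems(1)] sub by blast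
      show "mono_on {v k..d} W" using less.prems(4) ck by (auto simp: mono_on_def)
      show "v k \<le> u i \<and> v i \<le> d" if "i \<in> J2" for i
        using that less.prems(1,2) k by (auto simp: J2_def J1_def disj_family_def)
    qed (use ck in auto)
    have "I = insert k (J1 \<union> J2)" "J1 \<inter> J2 = {}" "k \<notin> J1 \<union> J2"
      using k by (auto simp: J1_def J2_def)
    moreover have "finite J1" "finite J2" using fin sub by (auto intro: finite_subset)
    ultimately have "(\<Sum>i\<in>I. W (v i) - W (u i)) = (W (v k) - W (u k)) +
        ((\<Sum>i\<in>J1. W (v i) - W (u i)) + (\<Sum>i\<in>J2. W (v i) - W (u i)))"
      by (simp add: sum.union_disjoint)
    then show ?thesis
      using 1 2 by linarith
  qed
qed

text \<open>Degenerate intervals are dropped, since they would break injectivity of the passage from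
  indices to intervals.\<close>

lemma abs_continuous_on_familyD:
  assumes "abs_continuous_on S g" "\<epsilon> > 0" "\<And>a b. a \<in> S \<Longrightarrow> b \<in> S \<Longrightarrow> {a..b} \<subseteq> S"
  obtains \<delta> where "\<delta> > 0"
    "\<And>(I::'i set) u v. disj_family I u v \<Longrightarrow> (\<And>i. i \<in> I \<Longrightarrow> u i \<in> S \<and> v i \<in> S) \<Longrightarrow>
       (\<Sum>i\<in>I. v i - u i) < \<delta> \<Longrightarrow> (\<Sum>i\<in>I. \<bar>g (v i) - g (u i)\<bar>) < \<epsilon>"
proof -
  obtain \<delta> where \<delta>: "\<delta> > 0" and D: "\<And>\<D>. \<D> division_of \<Union>\<D> \<Longrightarrow> \<Union>\<D> \<subseteq> S \<Longrightarrow>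
      (\<Sum>K\<in>\<D>. Sup K - Inf K) < \<delta> \<Longrightarrow> (\<Sum>K\<in>\<D>. \<bar>g (Sup K) - g (Inf K)\<bar>) < \<epsilon>"
    using assms(1,2) unfolding abs_continuous_on_def by meson
  show thesis
  proof (rule that[OF \<delta>])
    fix I :: "'i set" and u v
    assume fam: "disj_family I u v" and inS: "\<And>i. i \<in> I \<Longrightarrow> u i \<in> S \<and> v i \<in> S"
      and small: "(\<Sum>i\<in>I. v i - u i) < \<delta>"
    define J where "J = {i\<in>I. u i < v i}"
    have fin: "finite I" and le: "\<And>i. i \<in> I \<Longrightarrow> u i \<le> v i"
      using fam by (auto simp: disj_family_def)
    define \<D> where "\<D> = (\<lambda>i. {u i..v i}) ` J"
    have inj: "inj_on (\<lambda>i. {u i..v i}) J"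
    proof (rule inj_onI)
      fix i j assume ij: "i \<in> J" "j \<in> J" and eq: "{u i..v i} = {u j..v j}"
      have "u i = u j" "v i = v j"
        using eq ij by (auto simp: J_def Icc_eq_Icc)
      then show "i = j"
        using fam ij by (force simp: J_def disj_family_def)
    qed
    have div: "\<D> division_of \<Union>\<D>"
      unfolding division_of_def
    proof (intro conjI ballI impI)
      show "finite \<D>" using fin by (auto simp: \<D>_def J_def)
      fix K assume "K \<in> \<D>"
      then obtain i where i: "i \<in> J" "K = {u i..v i}" by (auto simp: \<D>_def)
      show "K \<subseteq> \<Union>\<D>" using \<open>K \<in> \<D>\<close> by blast
      show "K \<noteq> {}" using i by (auto simp: J_def)
      show "\<exists>a b. K = cbox a b" using i by (metis cbox_interval)
      fix L assume "L \<in> \<D>" and "K \<noteq> L"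
      then obtain j where j: "j \<in> J" "L = {u j..v j}" "i \<noteq> j" using i by (auto simp: \<D>_def)
      then have "v i \<le> u j \<or> v j \<le> u i"
        using fam i by (auto simp: J_def disj_family_def)
      then show "interior K \<inter> interior L = {}"
        using i j by auto
    qed simp
    have sumJ: "(\<Sum>K\<in>\<D>. \<phi> K) = (\<Sum>i\<in>J. \<phi> {u i..v i})" for \<phi> :: "real set \<Rightarrow> real"
      unfolding \<D>_def using inj by (simp add: sum.reindex)
    have SI: "Sup {u i..v i} = v i" "Inf {u i..v i} = u i" if "i \<in> J" for i
      using that by (auto simp: J_def)
    have "(\<Sum>i\<in>J. \<bar>g (v i) - g (u i)\<bar>) = (\<Sum>K\<in>\<D>. \<bar>g (Sup K) - g (Inf K)\<bar>)"
      unfolding sumJ using SI by (intro sum.cong) auto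
    also have "\<dots> < \<epsilon>"
    proof (rule D[OF div])
      show "\<Union>\<D> \<subseteq> S"
        using inS assms(3) by (fastforce simp: \<D>_def J_def)
      have "(\<Sum>K\<in>\<D>. Sup K - Inf K) = (\<Sum>i\<in>J. v i - u i)"
        unfolding sumJ using SI by (intro sum.cong) auto
      also have "\<dots> = (\<Sum>i\<in>I. v i - u i)"
        using fin le by (intro sum.mono_neutral_left) (force simp: J_def)+
      finally show "(\<Sum>K\<in>\<D>. Sup K - Inf K) < \<delta>" using small by simp
    qed
    also have "(\<Sum>i\<in>J. \<bar>g (v i) - g (u i)\<bar>) = (\<Sum>i\<in>I. \<bar>g (v i) - g (u i)\<bar>)"
      using fin le by (intro sum.mono_neutral_left) (force simp: J_def)+
    finally show "(\<Sum>i\<in>I. \<bar>g (v i) - g (u i)\<bar>) < \<epsilon>" .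
  qed
qed

text \<open>Families indexed by \<open>real set\<close> suffice, since the members of a division can
  index themselves, with \<open>Inf\<close> and \<open>Sup\<close> as end point maps.\<close>

lemma abs_continuous_onI_family:
  assumes "\<And>\<epsilon>. \<epsilon> > 0 \<Longrightarrow> \<exists>\<delta>>0. \<forall>(I::real set set) u v. disj_family I u v \<longrightarrow>
      (\<forall>i\<in>I. u i \<in> S \<and> v i \<in> S) \<longrightarrow>
      (\<Sum>i\<in>I. v i - u i) < \<delta> \<longrightarrow> (\<Sum>i\<in>I. \<bar>g (v i) - g (u i)\<bar>) < \<epsilon>"
  shows "abs_continuous_on S g"
  unfolding abs_continuous_on_def
proof (intro allI impI)
  fix \<epsilon> :: real assume "\<epsilon> > 0"
  then obtain \<delta> where \<delta>: "\<delta> > 0" and D: "\<And>(I::real set set) u v. disj_family I u v \<Longrightarrow>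
      (\<forall>i\<in>I. u i \<in> S \<and> v i \<in> S) \<Longrightarrow>
      (\<Sum>i\<in>I. v i - u i) < \<delta> \<Longrightarrow> (\<Sum>i\<in>I. \<bar>g (v i) - g (u i)\<bar>) < \<epsilon>"
    using assms by meson
  show "\<exists>\<delta>>0. \<forall>\<D>. \<D> division_of \<Union>\<D> \<and> \<Union>\<D> \<subseteq> S \<and> (\<Sum>K\<in>\<D>. Sup K - Inf K) < \<delta>
        \<longrightarrow> (\<Sum>K\<in>\<D>. \<bar>g (Sup K) - g (Inf K)\<bar>) < \<epsilon>"
  proof (intro exI[of _ \<delta>] conjI allI impI \<delta>)
    fix \<D> :: "real set set"
    assume "\<D> division_of \<Union>\<D> \<and> \<Union>\<D> \<subseteq> S \<and> (\<Sum>K\<in>\<D>. Sup K - Inf K) < \<delta>"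
    then have div: "\<D> division_of \<Union>\<D>" and sub: "\<Union>\<D> \<subseteq> S" and small: "(\<Sum>K\<in>\<D>. Sup K - Inf K) < \<delta>"
      by auto
    have fin: "finite \<D>" using div by (rule division_of_finite)
    have K: "K = {Inf K..Sup K}" "Inf K \<le> Sup K" if K: "K \<in> \<D>" for K
    proof -
      obtain a b where "K \<noteq> {}" "K = cbox a b"
        using division_ofD(3,4)[OF div K] by blast
      then show "K = {Inf K..Sup K}" "Inf K \<le> Sup K" by auto
    qed
    \<comment> \<open>A degenerate member of a division has empty interior and may lie inside
      another member, which \<open>disj_family\<close> forbids. Such members contribute 0 to both
      sums.\<close>
    define J where "J = {K\<in>\<D>. Inf K < Sup K}"
    have eq: "(\<Sum>K\<in>\<D>. \<phi> (Sup K) - \<phi> (Inf K)) = (\<Sum>K\<in>J. \<phi> (Sup K) - \<phi> (Inf K))" for \<phi> :: "real \<Rightarrow> real"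
      using fin K by (intro sum.mono_neutral_right) (force simp: J_def)+
    have eq': "(\<Sum>K\<in>\<D>. \<bar>g (Sup K) - g (Inf K)\<bar>) = (\<Sum>K\<in>J. \<bar>g (Sup K) - g (Inf K)\<bar>)"
      using fin K by (intro sum.mono_neutral_right) (force simp: J_def)+
    have "(\<Sum>K\<in>J. \<bar>g (Sup K) - g (Inf K)\<bar>) < \<epsilon>"
    proof (rule D)
      show "disj_family J Inf Sup"
        unfolding disj_family_def
      proof (intro conjI ballI impI)
        show "finite J" using fin by (simp add: J_def)
        show "Inf i \<le> Sup i" if "i \<in> J" for i using that by (simp add: J_def)
        fix A B assume AB: "A \<in> J" "B \<in> J" "A \<noteq> B"
        have int: "interior A \<inter> interior B = {}"
          using division_ofD(5)[OF div] AB by (auto simp: J_def)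
        show "Sup A \<le> Inf B \<or> Sup B \<le> Inf A"
        proof (rule interior_disjoint_Icc)
          show "interior {Inf A..Sup A} \<inter> interior {Inf B..Sup B} = {}"
            using int AB K(1)[of A] K(1)[of B] by (simp add: J_def)
        qed (use AB in \<open>auto simp: J_def\<close>)
      qed
      show "\<forall>K\<in>J. Inf K \<in> S \<and> Sup K \<in> S"
      proof
        fix A assume "A \<in> J"
        then have "A \<in> \<D>" by (simp add: J_def)
        then have "Inf A \<in> A" "Sup A \<in> A" using K by (metis atLeastAtMost_iff order_refl)+
        then show "Inf A \<in> S \<and> Sup A \<in> S" using \<open>A \<in> \<D>\<close> sub by blast
      qed
      show "(\<Sum>K\<in>J. Sup K - Inf K) < \<delta>" using small eq[of "\<lambda>x. x"] by simp
    qed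
    then show "(\<Sum>K\<in>\<D>. \<bar>g (Sup K) - g (Inf K)\<bar>) < \<epsilon>" using eq' by simp
  qed
qed

section \<open>Positive variation\<close>

definition families_in :: "real \<Rightarrow> real \<Rightarrow> (nat set \<times> (nat \<Rightarrow> real) \<times> (nat \<Rightarrow> real)) set" where
  "families_in c d = {(I, u, v). disj_family I u v \<and> (\<forall>i\<in>I. c \<le> u i \<and> v i \<le> d)}"

definition family_sum :: "(real \<Rightarrow> real) \<Rightarrow> nat set \<times> (nat \<Rightarrow> real) \<times> (nat \<Rightarrow> real) \<Rightarrow> real" where
  "family_sum g = (\<lambda>(I, u, v). \<Sum>i\<in>I. g (v i) - g (u i))"

text \<open>Members with negative increment can be left out of a family, so although the sums carry
  no absolute value their supremum is the positive variation of the Jordan decomposition.\<close>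

definition pos_variation :: "(real \<Rightarrow> real) \<Rightarrow> real \<Rightarrow> real \<Rightarrow> real" where
  "pos_variation g c d = Sup (family_sum g ` families_in c d)"

lemma families_in_mono: "c' \<le> c \<Longrightarrow> d \<le> d' \<Longrightarrow> families_in c d \<subseteq> families_in c' d'"
  unfolding families_in_def by force

lemma empty_families_in: "({}, u, v) \<in> families_in c d"
  by (simp add: families_in_def disj_family_def)

text \<open>Clamping with \<open>min\<close> and \<open>max\<close> at d cuts a member that contains
  d in two and makes every member on the far side degenerate, with contribution 0. Both halves can
  therefore keep the index set I.\<close>

lemma family_sum_split:
  fixes g :: "real \<Rightarrow> real"
  assumes "T \<in> families_in c e" "c \<le> d" "d \<le> e"
  obtains T1 T2 where "T1 \<in> families_in c d" "T2 \<in> families_in d e"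
    "family_sum g T = family_sum g T1 + family_sum g T2"
proof -
  obtain I u v where T: "T = (I, u, v)" by (cases T)
  have fam: "disj_family I u v" and bd: "\<And>i. i \<in> I \<Longrightarrow> c \<le> u i \<and> v i \<le> e"
    using assms(1) by (auto simp: T families_in_def)
  have le: "\<And>i. i \<in> I \<Longrightarrow> u i \<le> v i" using fam by (simp add: disj_family_def)
  have m1: "mono (\<lambda>x. min x d)" and m2: "mono (\<lambda>x. max x d)"
    by (auto simp: mono_def)
  show thesis
  proof (rule that)
    show "(I, \<lambda>i. min (u i) d, \<lambda>i. min (v i) d) \<in> families_in c d"
      using disj_family_mono_image[OF fam m1] bd assms by (auto simp: families_in_def)
    show "(I, \<lambda>i. max (u i) d, \<lambda>i. max (v i) d) \<in> families_in d e"
      using disj_family_mono_image[OF fam m2] bd le assms by (auto simp: families_in_def)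
    show "family_sum g T = family_sum g (I, \<lambda>i. min (u i) d, \<lambda>i. min (v i) d)
        + family_sum g (I, \<lambda>i. max (u i) d, \<lambda>i. max (v i) d)"
      unfolding T family_sum_def by (auto simp: sum.distrib[symmetric] min_def max_def intro!: sum.cong)
  qed
qed

lemma families_in_length_le:
  assumes "(I, u, v) \<in> families_in c d" "c \<le> d"
  shows "(\<Sum>i\<in>I. v i - u i) \<le> d - c"
  using assms sum_disj_family_le[of I u v c d "\<lambda>x. x"]
  by (auto simp: families_in_def mono_on_def)

context
  fixes g :: "real \<Rightarrow> real" and a b :: real
  assumes ac: "abs_continuous_on {a..b} g" and ab: "a \<le> b"
begin

text \<open>The interval is exhausted in steps of length \<delta>/2, where \<delta> belongs to
  \<epsilon> = 1 in absolute continuity; every step adds at most 1 to a family sum.\<close>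

lemma bdd_above_family_sum:
  assumes "a \<le> c" "d \<le> b"
  shows "bdd_above (family_sum g ` families_in c d)"
proof -
  obtain \<delta> where \<delta>: "\<delta> > 0" and D: "\<And>(I::nat set) u v. disj_family I u v \<Longrightarrow>
      (\<And>i. i \<in> I \<Longrightarrow> u i \<in> {a..b} \<and> v i \<in> {a..b}) \<Longrightarrow>
       (\<Sum>i\<in>I. v i - u i) < \<delta> \<Longrightarrow> (\<Sum>i\<in>I. \<bar>g (v i) - g (u i)\<bar>) < 1"
    by (rule abs_continuous_on_familyD[OF ac, of 1, where ?'i = nat]) auto
  have *: "family_sum g T \<le> real k"
    if "T \<in> families_in a x" "a \<le> x" "x \<le> b" "x \<le> a + k * (\<delta> / 2)" for k :: nat and T x
    using that
  proof (induction k arbitrary: T x)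
    case 0
    obtain I u v where T: "T = (I, u, v)" by (cases T)
    have "v i = u i" if "i \<in> I" for i
      using 0 that unfolding T families_in_def disj_family_def by force
    then show ?case by (auto simp: T family_sum_def)
  next
    case (Suc k)
    define y where "y = max a (x - \<delta> / 2)"
    have y: "a \<le> y" "y \<le> x" "y \<le> b" "y \<le> a + k * (\<delta> / 2)" "x - y < \<delta>"
      using Suc.prems \<delta> by (auto simp: y_def field_simps max_def)
    obtain T1 T2 where T: "T1 \<in> families_in a y" "T2 \<in> families_in y x"
        "family_sum g T = family_sum g T1 + family_sum g T2"
      using family_sum_split[OF Suc.prems(1) y(1,2)] by blast
    obtain I u v where T2: "T2 = (I, u, v)" by (cases T2)
    have "(\<Sum>i\<in>I. \<bar>g (v i) - g (u i)\<bar>) < 1"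
    proof (rule D)
      show "disj_family I u v" using T by (simp add: T2 families_in_def)
      show "u i \<in> {a..b} \<and> v i \<in> {a..b}" if "i \<in> I" for i
        using T y Suc.prems that unfolding T2 families_in_def disj_family_def by force
      show "(\<Sum>i\<in>I. v i - u i) < \<delta>"
        using families_in_length_le[of I u v y x] T y by (simp add: T2)
    qed
    moreover have "family_sum g T2 \<le> (\<Sum>i\<in>I. \<bar>g (v i) - g (u i)\<bar>)"
      unfolding T2 family_sum_def by (auto intro!: sum_mono)
    ultimately show ?case using T Suc.IH[OF T(1)] y by simp
  qed
  obtain k :: nat where "(b - a) / (\<delta> / 2) < k" using reals_Archimedean2 by blast
  then have "b \<le> a + k * (\<delta> / 2)" using \<delta> by (simp add: field_simps)
  then have "family_sum g T \<le> real k" if "T \<in> families_in c d" for T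
    using *[of T b k] families_in_mono[of a c d b] that assms ab by auto
  then show ?thesis by (auto intro!: bdd_aboveI)
qed

lemma family_sum_le_pos_variation:
  assumes "T \<in> families_in c d" "a \<le> c" "d \<le> b"
  shows "family_sum g T \<le> pos_variation g c d"
  unfolding pos_variation_def using assms by (intro cSup_upper bdd_above_family_sum) auto

lemma pos_variation_le:
  assumes "\<And>T. T \<in> families_in c d \<Longrightarrow> family_sum g T \<le> M"
  shows "pos_variation g c d \<le> M"
  unfolding pos_variation_def using assms empty_families_in by (intro cSup_least) fast+

lemma pos_variation_mono:
  assumes "a \<le> c" "d \<le> e" "e \<le> b"
  shows "pos_variation g c d \<le> pos_variation g c e"
  using families_in_mono[of c c d e] assms
  by (intro pos_variation_le family_sum_le_pos_variation) auto

text \<open>This makes the difference of the positive variation and g monotone. A family in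
  \<open>{c..d}\<close> is enlarged by the interval \<open>{d..e}\<close>, for which
  \<open>case_nat\<close> frees the index 0.\<close>

lemma pos_variation_increment_ge:
  assumes "a \<le> c" "c \<le> d" "d \<le> e" "e \<le> b"
  shows "pos_variation g c d + (g e - g d) \<le> pos_variation g c e"
proof -
  have "pos_variation g c d \<le> pos_variation g c e - (g e - g d)"
  proof (rule pos_variation_le)
    fix T assume T0: "T \<in> families_in c d"
    obtain I u v where T: "T = (I, u, v)" by (cases T)
    define u' v' where "u' = case_nat d u" and "v' = case_nat e v"
    define J where "J = insert 0 (Suc ` I)"
    have fin: "finite I" using T0 by (simp add: T families_in_def disj_family_def)
    have "(J, u', v') \<in> families_in c e"
      using T0 assms unfolding T families_in_def disj_family_def J_def u'_def v'_def
      by force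
    then have "family_sum g (J, u', v') \<le> pos_variation g c e"
      using assms by (intro family_sum_le_pos_variation) auto
    moreover have "family_sum g (J, u', v') = family_sum g T + (g e - g d)"
      unfolding T family_sum_def J_def u'_def v'_def using fin
      by (simp add: sum.reindex)
    ultimately show "family_sum g T \<le> pos_variation g c e - (g e - g d)" by simp
  qed
  then show ?thesis by simp
qed

lemma pos_variation_triangle:
  assumes "a \<le> c" "c \<le> d" "d \<le> e" "e \<le> b"
  shows "pos_variation g c e \<le> pos_variation g c d + pos_variation g d e"
proof (rule pos_variation_le)
  fix T assume "T \<in> families_in c e"
  then obtain T1 T2 where T: "T1 \<in> families_in c d" "T2 \<in> families_in d e"
        "family_sum g T = family_sum g T1 + family_sum g T2"
    using family_sum_split assms by blast
  then show "family_sum g T \<le> pos_variation g c d + pos_variation g d e"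
    using family_sum_le_pos_variation[OF T(1)] family_sum_le_pos_variation[OF T(2)] assms by simp
qed

text \<open>Nearly optimal families inside the members are merged into one family indexed by pairs.
  Its total length is no larger, so the \<delta> of g serves. Letting the slack \<eta> tend to 0
  weakens the strict inequality to \<open>\<le>\<close>.\<close>

lemma pos_variation_abs_continuous:
  assumes "\<epsilon> > 0"
  obtains \<delta> where "\<delta> > 0"
    "\<And>(J::'j set) c d. disj_family J c d \<Longrightarrow> (\<And>j. j \<in> J \<Longrightarrow> c j \<in> {a..b} \<and> d j \<in> {a..b}) \<Longrightarrow>
       (\<Sum>j\<in>J. d j - c j) < \<delta> \<Longrightarrow>
       (\<Sum>j\<in>J. pos_variation g a (d j) - pos_variation g a (c j)) \<le> \<epsilon>"
proof -
  obtain \<delta> where \<delta>: "\<delta> > 0" and D: "\<And>(I::('j \<times> nat) set) u v. disj_family I u v \<Longrightarrow>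
      (\<And>i. i \<in> I \<Longrightarrow> u i \<in> {a..b} \<and> v i \<in> {a..b}) \<Longrightarrow>
       (\<Sum>i\<in>I. v i - u i) < \<delta> \<Longrightarrow> (\<Sum>i\<in>I. \<bar>g (v i) - g (u i)\<bar>) < \<epsilon>"
    by (rule abs_continuous_on_familyD[OF ac assms, where ?'i = "'j \<times> nat"]) auto
  show thesis
  proof (rule that[OF \<delta>])
    fix J :: "'j set" and c d
    assume fam: "disj_family J c d" and inS: "\<And>j. j \<in> J \<Longrightarrow> c j \<in> {a..b} \<and> d j \<in> {a..b}"
      and small: "(\<Sum>j\<in>J. d j - c j) < \<delta>"
    have fin: "finite J" and le: "\<And>j. j \<in> J \<Longrightarrow> c j \<le> d j" using fam by (auto simp: disj_family_def)
    have bound: "(\<Sum>j\<in>J. pos_variation g (c j) (d j) - \<eta>) \<le> \<epsilon>" if "\<eta> > 0" for \<eta>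
    proof -
      have "\<exists>T \<in> families_in (c j) (d j). pos_variation g (c j) (d j) - \<eta> < family_sum g T" for j
      proof (rule ccontr)
        assume "\<not> ?thesis"
        then have "pos_variation g (c j) (d j) \<le> pos_variation g (c j) (d j) - \<eta>"
          by (intro pos_variation_le) (auto simp: not_less)
        then show False using that by simp
      qed
      then obtain T where T: "\<And>j. T j \<in> families_in (c j) (d j)"
          "\<And>j. pos_variation g (c j) (d j) - \<eta> < family_sum g (T j)"
        by metis
      define I where "I j = fst (T j)" for j
      define u where "u j = fst (snd (T j))" for j
      define v where "v j = snd (snd (T j))" for j
      have Tj: "T j = (I j, u j, v j)" for j by (simp add: I_def u_def v_def)
      have F: "disj_family (I j) (u j) (v j)" "\<And>i. i \<in> I j \<Longrightarrow> c j \<le> u j i \<and> v j i \<le> d j"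
         for j using T(1)[of j] by (auto simp: Tj families_in_def)
      have F': "finite (I j)" "\<And>i. i \<in> I j \<Longrightarrow> u j i \<le> v j i" for j
        using F(1)[of j] by (auto simp: disj_family_def)
      have "(\<Sum>j\<in>J. pos_variation g (c j) (d j) - \<eta>) \<le> (\<Sum>j\<in>J. family_sum g (T j))"
        using T(2) by (intro sum_mono less_imp_le)
      also have "\<dots> = (\<Sum>(j,i)\<in>Sigma J I. g (v j i) - g (u j i))"
        using fin F' by (simp add: sum.Sigma family_sum_def Tj)
      also have "\<dots> \<le> (\<Sum>(j,i)\<in>Sigma J I. \<bar>g (v j i) - g (u j i)\<bar>)"
        by (intro sum_mono) auto
      also have "\<dots> = (\<Sum>p\<in>Sigma J I. \<bar>g ((\<lambda>(j,i). v j i) p) - g ((\<lambda>(j,i). u j i) p)\<bar>)"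
        by (intro sum.cong) auto
      also have "\<dots> < \<epsilon>"
      proof (rule D)
        show "disj_family (Sigma J I) (\<lambda>(j,i). u j i) (\<lambda>(j,i). v j i)"
          unfolding disj_family_def
        proof (intro conjI ballI impI)
          show "finite (Sigma J I)" using fin F' by auto
          show "(case p of (j, i) \<Rightarrow> u j i) \<le> (case p of (j, i) \<Rightarrow> v j i)" if "p \<in> Sigma J I" for p
            using that F' by auto
          fix p q assume pq: "p \<in> Sigma J I" "q \<in> Sigma J I" "p \<noteq> q"
          obtain j i j' i' where eq: "p = (j,i)" "q = (j',i')" by (cases p, cases q)
          show "(case p of (j, i) \<Rightarrow> v j i) \<le> (case q of (j, i) \<Rightarrow> u j i) \<or>
                (case q of (j, i) \<Rightarrow> v j i) \<le> (case p of (j, i) \<Rightarrow> u j i)"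
          proof (cases "j = j'")
            case True
            then show ?thesis using F(1)[of j] pq eq by (auto simp: disj_family_def)
          next
            case False
            then have "d j \<le> c j' \<or> d j' \<le> c j"
              using fam pq eq by (auto simp: disj_family_def)
            then show ?thesis using F(2)[of i j] F(2)[of i' j'] pq eq by auto
          qed
        qed
        show "(case p of (j, i) \<Rightarrow> u j i) \<in> {a..b} \<and> (case p of (j, i) \<Rightarrow> v j i) \<in> {a..b}"
          if p: "p \<in> Sigma J I" for p
        proof -
          obtain j i where eq: "p = (j,i)" "j \<in> J" "i \<in> I j" using p by (cases p) auto
          then show ?thesis using F(2)[of i j] F'(2)[of i j] inS[of j] by auto
        qed
        have "(\<Sum>p\<in>Sigma J I. (\<lambda>(j,i). v j i) p - (\<lambda>(j,i). u j i) p) = (\<Sum>(j,i)\<in>Sigma J I. v j i - u j i)"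
          by (intro sum.cong) auto
        also have "\<dots> = (\<Sum>j\<in>J. \<Sum>i\<in>I j. v j i - u j i)"
          using fin F' by (simp add: sum.Sigma)
        also have "\<dots> \<le> (\<Sum>j\<in>J. d j - c j)"
          using T(1) le by (intro sum_mono families_in_length_le) (auto simp: Tj)
        also have "\<dots> < \<delta>" by fact
        finally show "(\<Sum>p\<in>Sigma J I. (\<lambda>(j,i). v j i) p - (\<lambda>(j,i). u j i) p) < \<delta>" .
      qed
      finally show ?thesis by simp
    qed
    have "(\<Sum>j\<in>J. pos_variation g (c j) (d j)) \<le> \<epsilon>"
    proof (rule field_le_epsilon)
      fix e :: real assume "e > 0"
      have "(\<Sum>j\<in>J. pos_variation g (c j) (d j) - e / (card J + 1)) \<le> \<epsilon>"
        using bound \<open>e > 0\<close> by simp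
      then have "(\<Sum>j\<in>J. pos_variation g (c j) (d j)) \<le> \<epsilon> + card J * (e / (card J + 1))"
        by (simp add: sum_subtractf)
      also have "card J * (e / (card J + 1)) \<le> e"
        using \<open>e > 0\<close> by (simp add: field_simps)
      finally show "(\<Sum>j\<in>J. pos_variation g (c j) (d j)) \<le> \<epsilon> + e" by simp
    qed
    moreover have "(\<Sum>j\<in>J. pos_variation g a (d j) - pos_variation g a (c j)) \<le> (\<Sum>j\<in>J. pos_variation g (c j) (d j))"
    proof (rule sum_mono)
      fix j assume "j \<in> J"
      then show "pos_variation g a (d j) - pos_variation g a (c j) \<le> pos_variation g (c j) (d j)"
        using pos_variation_triangle[of a "c j" "d j"] inS[of j] le[of j] by auto
    qed
    ultimately show "(\<Sum>j\<in>J. pos_variation g a (d j) - pos_variation g a (c j)) \<le> \<epsilon>" by simp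
  qed
qed

end

section \<open>Monotone absolutely continuous functions as integrals\<close>

lemma interval_measure_null_set:
  fixes F :: "real \<Rightarrow> real"
  assumes mono: "mono F" and cont: "continuous_on UNIV F"
    and ac: "\<And>\<epsilon>. \<epsilon> > 0 \<Longrightarrow> \<exists>\<delta>>0. \<forall>(J::real set set) c d. disj_family J c d \<longrightarrow>
       (\<Sum>j\<in>J. d j - c j) < \<delta> \<longrightarrow> (\<Sum>j\<in>J. F (d j) - F (c j)) \<le> \<epsilon>"
    and N: "N \<in> null_sets lborel"
  shows "N \<in> null_sets (interval_measure F)"
proof -
  let ?\<mu> = "interval_measure F"
  have Icc: "emeasure ?\<mu> {a..b} = ennreal (F b - F a)" if "a \<le> b" for a b
    by (rule emeasure_interval_measure_Icc) (use that mono cont in \<open>auto simp: mono_def\<close>)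
  \<comment> \<open>A bounded part M of N lies in an open set U of Lebesgue measure below \<delta>.
    Countably many non-overlapping intervals inside U cover M. Finitely many of them have measure at
    most \<epsilon> by absolute continuity of F, and continuity from below extends this to the whole
    cover.\<close>
  have "N \<inter> {- real n..real n} \<in> null_sets ?\<mu>" for n :: nat
  proof -
    define M where "M = N \<inter> {- real n..real n}"
    have Mnull: "M \<in> null_sets lborel" using N by (auto simp: M_def intro: null_set_Int2)
    have bound: "emeasure ?\<mu> M \<le> ennreal \<epsilon>" if \<epsilon>: "\<epsilon> > 0" for \<epsilon>
    proof -
      obtain \<delta> where \<delta>: "\<delta> > 0" and D: "\<And>(J::real set set) c d. disj_family J c d \<Longrightarrow>
          (\<Sum>j\<in>J. d j - c j) < \<delta> \<Longrightarrow> (\<Sum>j\<in>J. F (d j) - F (c j)) \<le> \<epsilon>"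
        using ac[OF \<epsilon>] by meson
      have "M \<in> sets lebesgue" "emeasure lebesgue M = 0"
        using Mnull by (auto simp: null_sets_completionI null_setsD1 null_setsD2 )
      then obtain U where U: "open U" "M \<subseteq> U" "emeasure lebesgue (U - M) < ennreal \<delta>"
        using sets_lebesgue_outer_open[of M \<delta>] \<delta> by metis
      have "emeasure lebesgue U \<le> emeasure lebesgue (U - M) + emeasure lebesgue M"
        using U(1) \<open>M \<in> sets lebesgue\<close>
        by (intro order_trans[OF emeasure_mono emeasure_subadditive]) auto
      then have Usmall: "emeasure lborel U < ennreal \<delta>"
        using U \<open>emeasure lebesgue M = 0\<close> by auto
      \<comment> \<open>Each interval of the cover is controlled by the gauge at one of its points
        in M, and is thereby forced into U.\<close>
      define \<gamma> where "\<gamma> x = (if x \<in> M then U else UNIV)" for x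
      have gauge: "gauge \<gamma>" using U by (auto simp: gauge_def \<gamma>_def)
      \<comment> \<open>The margin 1 gives the box a nonempty interior even for n = 0, as the
        covering lemma demands.\<close>
      have Msub: "M \<subseteq> cbox (- real n - 1) (real n + 1)" by (auto simp: M_def)
      obtain \<D> where \<D>: "countable \<D>"
          "\<And>K. K \<in> \<D> \<Longrightarrow> interior K \<noteq> {} \<and> (\<exists>c d. K = cbox c d)"
          "pairwise (\<lambda>A B. interior A \<inter> interior B = {}) \<D>"
          "\<And>K. K \<in> \<D> \<Longrightarrow> \<exists>x \<in> M \<inter> K. K \<subseteq> \<gamma> x" "M \<subseteq> \<Union>\<D>"
        by (rule covering_lemma[OF Msub _ gauge]) (auto simp: box_real)
      have K: "K = {Inf K..Sup K}" "Inf K < Sup K" "K \<subseteq> U" if "K \<in> \<D>" for K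
        using \<D>(2,4)[OF that] by (auto simp: \<gamma>_def)
      have fin: "emeasure ?\<mu> (\<Union>\<E>) \<le> ennreal \<epsilon>" if \<E>: "finite \<E>" "\<E> \<subseteq> \<D>" for \<E>
      proof -
        have disj: "Sup A \<le> Inf B \<or> Sup B \<le> Inf A" if "A \<in> \<E>" "B \<in> \<E>" "A \<noteq> B" for A B
        proof (rule interior_disjoint_Icc)
          show "interior {Inf A..Sup A} \<inter> interior {Inf B..Sup B} = {}"
          proof -
            have "A \<in> \<D>" "B \<in> \<D>" using that \<E> by auto
            then show ?thesis
              using pairwiseD[OF \<D>(3) _ _ that(3)] K(1)[of A] K(1)[of B] by metis
          qed
        qed (use that \<E> K(2) in auto)
        have fam: "disj_family \<E> Inf Sup"
          unfolding disj_family_def using \<E> K(2) disj by (auto intro: less_imp_le)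
        have "ennreal (\<Sum>K\<in>\<E>. Sup K - Inf K) = (\<Sum>K\<in>\<E>. emeasure lborel {Inf K<..<Sup K})"
          using K(2) \<E> by (subst sum_ennreal[symmetric]) (auto intro!: sum.cong less_imp_le emeasure_lborel_Ioo[symmetric])
        also have "\<dots> = emeasure lborel (\<Union>K\<in>\<E>. {Inf K<..<Sup K})"
        proof (rule sum_emeasure)
          show "disjoint_family_on (\<lambda>K. {Inf K<..<Sup K}) \<E>"
            unfolding disjoint_family_on_def
          proof (intro ballI impI)
            fix A B assume "A \<in> \<E>" "B \<in> \<E>" "A \<noteq> B"
            then show "{Inf A<..<Sup A} \<inter> {Inf B<..<Sup B} = {}"
              using disj[of A B] by auto
          qed
        qed (use \<E> in auto)
        also have "\<dots> \<le> emeasure lborel U"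
        proof (rule emeasure_mono)
          show "(\<Union>K\<in>\<E>. {Inf K<..<Sup K}) \<subseteq> U"
          proof
            fix z assume "z \<in> (\<Union>K\<in>\<E>. {Inf K<..<Sup K})"
            then obtain A where A: "A \<in> \<E>" "z \<in> {Inf A<..<Sup A}" by blast
            then have "z \<in> {Inf A..Sup A}" by simp
            then show "z \<in> U" using K(1,3)[of A] A \<E> by blast
          qed
        qed (use U in auto)
        also have "\<dots> < ennreal \<delta>" by fact
        finally have "(\<Sum>K\<in>\<E>. Sup K - Inf K) < \<delta>"
          by (meson ennreal_leI not_less)
        then have le: "(\<Sum>K\<in>\<E>. F (Sup K) - F (Inf K)) \<le> \<epsilon>" by (rule D[OF fam])
        have "emeasure ?\<mu> (\<Union>\<E>) \<le> (\<Sum>K\<in>\<E>. emeasure ?\<mu> K)"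
          using emeasure_subadditive_finite[of \<E> "\<lambda>K. K" ?\<mu>] \<E> \<D>(2) by (force simp: image_def)
        also have "\<dots> = (\<Sum>K\<in>\<E>. ennreal (F (Sup K) - F (Inf K)))"
        proof (rule sum.cong)
          fix A assume "A \<in> \<E>"
          then show "emeasure ?\<mu> A = ennreal (F (Sup A) - F (Inf A))"
            using Icc[of "Inf A" "Sup A"] K(1,2)[of A] \<E> by auto
        qed simp
        also have "\<dots> = ennreal (\<Sum>K\<in>\<E>. F (Sup K) - F (Inf K))"
        proof (rule sum_ennreal)
          show "0 \<le> F (Sup A) - F (Inf A)" if A: "A \<in> \<E>" for A
            using monoD[OF mono less_imp_le[OF K(2)[of A]]] A \<E> by auto
        qed
        also have "\<dots> \<le> ennreal \<epsilon>" using le by (rule ennreal_leI)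
        finally show ?thesis .
      qed
      have "emeasure ?\<mu> M \<le> emeasure ?\<mu> (\<Union>\<D>)"
      proof (rule emeasure_mono[OF \<D>(5)])
        show "\<Union>\<D> \<in> sets ?\<mu>"
          using \<D>(1,2) by (intro sets.countable_Union) force+
      qed
      also have "\<dots> \<le> ennreal \<epsilon>"
      proof (cases "\<D> = {}")
        case True
        then show ?thesis by simp
      next
        case False
        have eq: "\<Union>\<D> = (\<Union>n. \<Union>(from_nat_into \<D> ` {..n}))"
        proof (intro equalityI subsetI)
          fix z assume "z \<in> \<Union>\<D>"
          then obtain A where A: "A \<in> \<D>" "z \<in> A" by blast
          then obtain n where "from_nat_into \<D> n = A"
            using from_nat_into_surj[OF \<D>(1)] by blast
          then show "z \<in> (\<Union>n. \<Union>(from_nat_into \<D> ` {..n}))" using A(2) by auto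
        next
          fix z assume "z \<in> (\<Union>n. \<Union>(from_nat_into \<D> ` {..n}))"
          then show "z \<in> \<Union>\<D>" using from_nat_into[OF False] by auto
        qed
        have sub: "from_nat_into \<D> ` {..n} \<subseteq> \<D>" for n
          using from_nat_into[OF False] by auto
        have "emeasure ?\<mu> (\<Union>\<D>) = (SUP n. emeasure ?\<mu> (\<Union>(from_nat_into \<D> ` {..n})))"
          unfolding eq
        proof (rule SUP_emeasure_incseq[symmetric])
          have "\<Union>(from_nat_into \<D> ` {..n}) \<in> sets ?\<mu>" for n
          proof (rule sets.finite_Union)
            show "from_nat_into \<D> ` {..n} \<subseteq> sets ?\<mu>"
              using sub[of n] \<D>(2) by fastforce
          qed simp
          then show "range (\<lambda>n. \<Union>(from_nat_into \<D> ` {..n})) \<subseteq> sets ?\<mu>" by blast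
          show "incseq (\<lambda>n. \<Union>(from_nat_into \<D> ` {..n}))"
            by (intro monoI Union_mono image_mono) auto
        qed
        also have "\<dots> \<le> ennreal \<epsilon>"
          using fin sub by (intro SUP_least) auto
        finally show ?thesis .
      qed
      finally show ?thesis .
    qed
    have "emeasure ?\<mu> M \<le> 0"
    proof (rule ennreal_le_epsilon)
      fix e :: real assume "0 < e"
      then show "emeasure ?\<mu> M \<le> 0 + ennreal e" unfolding add_0 by (rule bound)
    qed
    moreover have "M \<in> sets ?\<mu>" using null_setsD2[OF Mnull] by simp
    ultimately show ?thesis unfolding M_def[symmetric] by (intro null_setsI) auto
  qed
  then have "(\<Union>n. N \<inter> {- real n..real n}) \<in> null_sets ?\<mu>"
    by (rule null_sets_UN)
  moreover have "(\<Union>n. N \<inter> {- real n..real n}) = N"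
  proof -
    have "\<exists>n. - real n \<le> x \<and> x \<le> real n" for x
    proof -
      obtain n where "\<bar>x\<bar> \<le> real n" using real_arch_simple by blast
      then show ?thesis by (intro exI[of _ n]) auto
    qed
    then show ?thesis by auto
  qed
  ultimately show ?thesis by simp
qed

text \<open>By the null set lemma the Stieltjes measure of F is absolutely continuous with respect
  to Lebesgue measure, so h is its Radon-Nikodym density.\<close>

lemma mono_abs_continuous_has_integral:
  fixes F :: "real \<Rightarrow> real"
  assumes mono: "mono F"
    and ac: "\<And>\<epsilon>. \<epsilon> > 0 \<Longrightarrow> \<exists>\<delta>>0. \<forall>(J::real set set) c d. disj_family J c d \<longrightarrow>
       (\<Sum>j\<in>J. d j - c j) < \<delta> \<longrightarrow> (\<Sum>j\<in>J. F (d j) - F (c j)) \<le> \<epsilon>"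
  shows "\<exists>h. \<forall>x y. x \<le> y \<longrightarrow> (h has_integral (F y - F x)) {x..y}"
proof -
  let ?\<mu> = "interval_measure F"
  have cont: "continuous_on UNIV F"
    unfolding continuous_on_iff
  proof (intro ballI allI impI)
    fix x e :: real assume "e > 0"
    then obtain \<delta> where \<delta>: "\<delta> > 0" and D: "\<And>(J::real set set) c d. disj_family J c d \<Longrightarrow>
       (\<Sum>j\<in>J. d j - c j) < \<delta> \<Longrightarrow> (\<Sum>j\<in>J. F (d j) - F (c j)) \<le> e / 2"
      using ac[of "e / 2"] half_gt_zero by meson
    \<comment> \<open>A family with a single member; its index \<open>{}\<close> is an arbitrary
      element of type \<open>real set\<close>.\<close>
    have le: "F z - F y \<le> e / 2" if "y \<le> z" "z - y < \<delta>" for y z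
      using D[of "{{}}" "\<lambda>_. y" "\<lambda>_. z"] that by (simp add: disj_family_def)
    show "\<exists>d>0. \<forall>x'\<in>UNIV. dist x' x < d \<longrightarrow> dist (F x') (F x) < e"
    proof (intro exI[of _ \<delta>] conjI \<delta> ballI impI)
      fix y assume "dist y x < \<delta>"
      then show "dist (F y) (F x) < e"
        using le[of x y] le[of y x] monoD[OF mono, of x y] monoD[OF mono, of y x] \<open>e > 0\<close>
        by (cases "x \<le> y") (auto simp: dist_real_def)
    qed
  qed
  have monoF: "\<And>x y. x \<le> y \<Longrightarrow> F x \<le> F y" using mono by (simp add: mono_def)
  have Icc: "emeasure ?\<mu> {a..b} = ennreal (F b - F a)" if "a \<le> b" for a b
    by (rule emeasure_interval_measure_Icc) (use that mono cont in \<open>auto simp: mono_def\<close>)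
  have "absolutely_continuous lborel ?\<mu>"
    unfolding absolutely_continuous_def using interval_measure_null_set[OF mono cont ac] by blast
  then obtain f where f: "f \<in> borel_measurable lborel" "density lborel f = ?\<mu>"
    using sigma_finite_measure.Radon_Nikodym[OF sigma_finite_lborel, of ?\<mu>] by auto
  define h where "h x = enn2real (f x)" for x
  have [measurable]: "f \<in> borel_measurable borel" using f by simp
  have "(h has_integral (F y - F x)) {x..y}" if "x \<le> y" for x y
  proof -
    have I: "(\<integral>\<^sup>+z. f z * indicator {x..y} z \<partial>lborel) = ennreal (F y - F x)"
      using Icc[OF that] f by (simp add: emeasure_density[symmetric])
    have "AE z in lborel. f z * indicator {x..y} z \<noteq> \<infinity>"
      by (rule nn_integral_PInf_AE) (auto simp: I)
    then have AE: "AE z in lborel. ennreal (h z * indicator {x..y} z) = f z * indicator {x..y} z"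
      by eventually_elim (auto simp: h_def indicator_def less_top)
    have "((\<lambda>z. h z * indicator {x..y} z) has_integral (F y - F x)) UNIV"
    proof (rule nn_integral_has_integral)
      show "(\<integral>\<^sup>+z. ennreal (h z * indicator {x..y} z) \<partial>lborel) = ennreal (F y - F x)"
        using I nn_integral_cong_AE[OF AE] by simp
    qed (use monoF that in \<open>auto simp: h_def\<close>)
    then show ?thesis
      by (simp add: indicator_def of_bool_def has_integral_restrict_UNIV[of "{x..y}" h, symmetric] if_distrib cong: if_cong)
  qed
  then show ?thesis by blast
qed

text \<open>Jordan decomposition g = P - Q with P the positive variation; both parts are monotone
  and absolutely continuous, so each is an integral. Clamping to \<open>{a..b}\<close> extends
  everything to the whole line, where the monotone case is stated.\<close>

lemma abs_continuous_has_integral: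
  fixes g :: "real \<Rightarrow> real"
  assumes ac: "abs_continuous_on {a..b} g" and ab: "a \<le> b"
  shows "\<exists>h. \<forall>x y. x \<le> y \<longrightarrow>
    (h has_integral (g (max a (min b y)) - g (max a (min b x)))) {x..y}"
proof -
  define cl where "cl x = max a (min b x)" for x
  have cl: "mono cl" "\<And>x. cl x \<in> {a..b}" and clm: "\<And>x y. x \<le> y \<Longrightarrow> cl y - cl x \<le> y - x"
    using ab by (auto simp: cl_def mono_def)
  define P where "P x = pos_variation g a (cl x)" for x
  define Q where "Q x = P x - g (cl x)" for x
  have P: "mono P"
    unfolding P_def using pos_variation_mono[OF ac ab] cl by (auto simp: mono_def)
  have Q: "mono Q"
  proof (rule monoI)
    fix x y :: real assume "x \<le> y"
    then show "Q x \<le> Q y"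
      using pos_variation_increment_ge[OF ac ab, of a "cl x" "cl y"] cl(2)[of x] cl(2)[of y] monoD[OF cl(1), of x y]
      unfolding Q_def P_def by simp
  qed
  have fam: "disj_family J (\<lambda>j. cl (c j)) (\<lambda>j. cl (d j))"
      "(\<Sum>j\<in>J. cl (d j) - cl (c j)) \<le> (\<Sum>j\<in>J. d j - c j)"
    if "disj_family J c d" for J :: "real set set" and c d
    using disj_family_mono_image[OF that cl(1)] that clm
    by (auto simp: disj_family_def intro: sum_mono)
  have acP: "\<exists>\<delta>>0. \<forall>(J::real set set) c d. disj_family J c d \<longrightarrow>
       (\<Sum>j\<in>J. d j - c j) < \<delta> \<longrightarrow> (\<Sum>j\<in>J. P (d j) - P (c j)) \<le> \<epsilon>" if eps: "\<epsilon> > 0" for \<epsilon>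
  proof -
    obtain \<delta> where \<delta>: "\<delta> > 0" and D: "\<And>(J::real set set) c d. disj_family J c d \<Longrightarrow>
       (\<And>j. j \<in> J \<Longrightarrow> c j \<in> {a..b} \<and> d j \<in> {a..b}) \<Longrightarrow> (\<Sum>j\<in>J. d j - c j) < \<delta> \<Longrightarrow>
       (\<Sum>j\<in>J. pos_variation g a (d j) - pos_variation g a (c j)) \<le> \<epsilon>"
      by (rule pos_variation_abs_continuous[OF ac ab eps, where ?'j = "real set"]) auto
    show ?thesis
    proof (intro exI[of _ \<delta>] conjI \<delta> allI impI)
      fix J :: "real set set" and c d assume J: "disj_family J c d" "(\<Sum>j\<in>J. d j - c j) < \<delta>"
      show "(\<Sum>j\<in>J. P (d j) - P (c j)) \<le> \<epsilon>"
        unfolding P_def using fam[OF J(1)] J(2) cl(2) by (intro D) auto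
    qed
  qed
  have acQ: "\<exists>\<delta>>0. \<forall>(J::real set set) c d. disj_family J c d \<longrightarrow>
       (\<Sum>j\<in>J. d j - c j) < \<delta> \<longrightarrow> (\<Sum>j\<in>J. Q (d j) - Q (c j)) \<le> \<epsilon>" if eps: "\<epsilon> > 0" for \<epsilon>
  proof -
    have eps2: "\<epsilon> / 2 > 0" using eps by simp
    obtain \<delta> where \<delta>: "\<delta> > 0" and D: "\<And>(J::real set set) c d. disj_family J c d \<Longrightarrow>
       (\<And>j. j \<in> J \<Longrightarrow> c j \<in> {a..b} \<and> d j \<in> {a..b}) \<Longrightarrow> (\<Sum>j\<in>J. d j - c j) < \<delta> \<Longrightarrow>
       (\<Sum>j\<in>J. \<bar>g (d j) - g (c j)\<bar>) < \<epsilon> / 2"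
      by (rule abs_continuous_on_familyD[OF ac eps2, where ?'i = "real set"]) auto
    obtain \<delta>' where \<delta>': "\<delta>' > 0" and D': "\<And>(J::real set set) c d. disj_family J c d \<Longrightarrow>
       (\<Sum>j\<in>J. d j - c j) < \<delta>' \<Longrightarrow> (\<Sum>j\<in>J. P (d j) - P (c j)) \<le> \<epsilon> / 2"
      using acP[OF eps2] by meson
    show ?thesis
    proof (intro exI[of _ "min \<delta> \<delta>'"] conjI allI impI)
      fix J :: "real set set" and c d assume J: "disj_family J c d" "(\<Sum>j\<in>J. d j - c j) < min \<delta> \<delta>'"
      have "(\<Sum>j\<in>J. \<bar>g (cl (d j)) - g (cl (c j))\<bar>) < \<epsilon> / 2"
        using fam[OF J(1)] J(2) cl(2) by (intro D) auto
      moreover have "(\<Sum>j\<in>J. P (d j) - P (c j)) \<le> \<epsilon> / 2" using J by (intro D') auto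
      moreover have "(\<Sum>j\<in>J. Q (d j) - Q (c j)) \<le>
          (\<Sum>j\<in>J. P (d j) - P (c j)) + (\<Sum>j\<in>J. \<bar>g (cl (d j)) - g (cl (c j))\<bar>)"
        unfolding Q_def sum.distrib[symmetric] by (intro sum_mono) auto
      ultimately show "(\<Sum>j\<in>J. Q (d j) - Q (c j)) \<le> \<epsilon>" by linarith
    qed (use \<delta> \<delta>' in auto)
  qed
  obtain h1 where h1: "\<And>x y. x \<le> y \<Longrightarrow> (h1 has_integral (P y - P x)) {x..y}"
    using mono_abs_continuous_has_integral[OF P acP] by blast
  obtain h2 where h2: "\<And>x y. x \<le> y \<Longrightarrow> (h2 has_integral (Q y - Q x)) {x..y}"
    using mono_abs_continuous_has_integral[OF Q acQ] by blast
  have "((\<lambda>z. h1 z - h2 z) has_integral (g (cl y) - g (cl x))) {x..y}" if "x \<le> y" for x y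
    using has_integral_diff[OF h1[OF that] h2[OF that]] by (simp add: Q_def algebra_simps)
  then show ?thesis unfolding cl_def by blast
qed

section \<open>Differentiation of primitives almost everywhere\<close>

lemma has_integral_right_derivative:
  fixes h H :: "real \<Rightarrow> real"
  assumes "\<And>x y. x \<le> y \<Longrightarrow> (h has_integral (H y - H x)) {x..y}"
  obtains N where "negligible N" "\<And>x e. x \<notin> N \<Longrightarrow> e > 0 \<Longrightarrow>
    \<exists>d>0. \<forall>t. 0 < t \<and> t < d \<longrightarrow> \<bar>(H (x + t) - H x) / t - h x\<bar> < e"
proof -
  have "h integrable_on cbox a b" for a b
    using assms[of a b] by (cases "a \<le> b") (auto simp: integrable_on_def)
  then obtain N where N: "negligible N" "\<And>x e. \<lbrakk>x \<notin> N; 0 < e\<rbrakk> \<Longrightarrow>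
               \<exists>d>0. \<forall>t. 0 < t \<and> t < d \<longrightarrow>
                         norm(integral (cbox x (x + t *\<^sub>R One)) h /\<^sub>R t ^ DIM(real) - h x) < e"
    using integrable_ccontinuous_explicit[of h] by metis
  have "integral {x..x + t} h = H (x + t) - H x" if "t > 0" for x t
    using assms[of x "x + t"] that by (intro integral_unique) auto
  then show thesis
    using N by (intro that[of N]) (auto simp: divide_inverse_commute)
qed

text \<open>Differentiation along the intervals \<open>{x..x + t}\<close> yields only the right
  derivative. The left one is the right derivative of the reflected primitive
  \<open>\<lambda>x. - H (- x)\<close>, whose exceptional set is reflected back.\<close>

lemma has_integral_AE_derivative:
  fixes h H :: "real \<Rightarrow> real"
  assumes H: "\<And>x y. x \<le> y \<Longrightarrow> (h has_integral (H y - H x)) {x..y}"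
  obtains N where "negligible N" "\<And>x. x \<notin> N \<Longrightarrow> (H has_real_derivative h x) (at x)"
proof -
  obtain N1 where N1: "negligible N1" "\<And>x e. x \<notin> N1 \<Longrightarrow> e > 0 \<Longrightarrow>
    \<exists>d>0. \<forall>t. 0 < t \<and> t < d \<longrightarrow> \<bar>(H (x + t) - H x) / t - h x\<bar> < e"
    using has_integral_right_derivative[OF H] by metis
  have "((\<lambda>x. h (- x)) has_integral (- H (- y) - (- H (- x)))) {x..y}" if "x \<le> y" for x y
    using has_integral_reflect_lemma_real[OF H[of "-y" "-x"]] that by simp
  then obtain N2 where N2: "negligible N2" "\<And>x e. x \<notin> N2 \<Longrightarrow> e > 0 \<Longrightarrow>
    \<exists>d>0. \<forall>t. 0 < t \<and> t < d \<longrightarrow> \<bar>(- H (- (x + t)) - (- H (- x))) / t - h (- x)\<bar> < e"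
    using has_integral_right_derivative[of "\<lambda>x. h (- x)" "\<lambda>x. - H (- x)"] by metis
  have neg: "negligible (uminus ` N2)"
    by (rule negligible_differentiable_image_negligible[OF order_refl N2(1)])
       (auto intro!: derivative_intros)
  show thesis
  proof (rule that)
    show "negligible (N1 \<union> uminus ` N2)" using N1(1) neg by (rule negligible_Un)
    fix x assume x: "x \<notin> N1 \<union> uminus ` N2"
    then have x2: "- x \<notin> N2" by (metis UnI2 add.inverse_inverse image_eqI)
    show "(H has_real_derivative h x) (at x)"
      unfolding has_field_derivative_iff
    proof (rule tendstoI)
      fix e :: real assume e: "e > 0"
      obtain d1 where d1: "d1 > 0" "\<And>t. 0 < t \<Longrightarrow> t < d1 \<Longrightarrow> \<bar>(H (x + t) - H x) / t - h x\<bar> < e"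
        using N1(2)[of x e] x e by blast
      obtain d2 where d2: "d2 > 0"
          "\<And>t. 0 < t \<Longrightarrow> t < d2 \<Longrightarrow> \<bar>(- H (- (- x + t)) - (- H (- (- x)))) / t - h (- (- x))\<bar> < e"
        using N2(2)[of "-x" e] x2 e by blast
      show "\<forall>\<^sub>F y in at x. dist ((H y - H x) / (y - x)) (h x) < e"
        unfolding eventually_at
      proof (intro exI[of _ "min d1 d2"] conjI ballI impI)
        fix y assume y: "y \<noteq> x \<and> dist y x < min d1 d2"
        show "dist ((H y - H x) / (y - x)) (h x) < e"
        proof (cases "y > x")
          case True
          then show ?thesis using d1(2)[of "y - x"] y by (simp add: dist_real_def)
        next
          case False
          have "(H y - H x) / (y - x) = (H x - H y) / (x - y)"
            by (metis minus_diff_eq minus_divide_divide)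
          then show ?thesis using d2(2)[of "x - y"] y False by (simp add: dist_real_def)
        qed
      qed (use d1 d2 in auto)
    qed
  qed
qed

text \<open>Each window \<open>{-real n..real n}\<close> has its own density h n. Off a null set it
  coincides with \<open>deriv G\<close>, so this one integrand serves all windows, and the
  exceptional sets form a countable union.\<close>

lemma locally_abs_continuous_derivative:
  assumes "locally_abs_continuous G"
  shows locally_abs_continuous_AE_differentiable: "negligible {x. \<not> G field_differentiable at x}"
    and locally_abs_continuous_FTC: "\<And>x y. x \<le> y \<Longrightarrow> (deriv G has_integral (G y - G x)) {x..y}"
proof -
  have "\<exists>h N. negligible N \<and> (\<forall>x\<in>{-real n<..<real n} - N. (G has_real_derivative h x) (at x)) \<and>
      (\<forall>x y. - real n \<le> x \<longrightarrow> x \<le> y \<longrightarrow> y \<le> real n \<longrightarrow> (h has_integral (G y - G x)) {x..y})" for n :: nat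
  proof -
    define H where "H x = G (max (- real n) (min (real n) x))" for x
    have "abs_continuous_on {- real n..real n} G" using assms by (simp add: locally_abs_continuous_def)
    then obtain h where h: "\<And>x y. x \<le> y \<Longrightarrow> (h has_integral (H y - H x)) {x..y}"
      using abs_continuous_has_integral[of "- real n" "real n" G] unfolding H_def by auto
    then obtain N where N: "negligible N" "\<And>x. x \<notin> N \<Longrightarrow> (H has_real_derivative h x) (at x)"
      using has_integral_AE_derivative by metis
    have HG: "H x = G x" if "- real n \<le> x" "x \<le> real n" for x
      using that by (simp add: H_def)
    have "(G has_real_derivative h x) (at x)" if "x \<in> {-real n<..<real n} - N" for x
      using has_field_derivative_transform_within_open[OF N(2)[of x], of "{-real n<..<real n}" G] that HG
      by auto
    moreover have "(h has_integral (G y - G x)) {x..y}"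
      if "- real n \<le> x" "x \<le> y" "y \<le> real n" for x y
      using h[OF that(2)] HG[of x] HG[of y] that by simp
    ultimately show ?thesis using N(1) by blast
  qed
  then obtain h N where N: "\<And>n. negligible (N n)"
    and h: "\<And>n x. x \<in> {-real n<..<real n} - N n \<Longrightarrow> (G has_real_derivative h n x) (at x)"
    and int: "\<And>n x y. - real n \<le> x \<Longrightarrow> x \<le> y \<Longrightarrow> y \<le> real n \<Longrightarrow> (h n has_integral (G y - G x)) {x..y}"
    by metis
  have "negligible (\<Union>n. N n)" using N by (intro negligible_countable_Union) auto
  moreover have "{x. \<not> G field_differentiable at x} \<subseteq> (\<Union>n. N n)"
  proof
    fix x assume x: "x \<in> {x. \<not> G field_differentiable at x}"
    obtain n :: nat where "\<bar>x\<bar> < real n" using reals_Archimedean2 by blast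
    then have "x \<in> {-real n<..<real n}" by auto
    then show "x \<in> (\<Union>n. N n)" using h[of x n] x by (auto simp: field_differentiable_def)
  qed
  ultimately show "negligible {x. \<not> G field_differentiable at x}" by (rule negligible_subset)
  fix x y :: real assume xy: "x \<le> y"
  obtain n :: nat where n: "max \<bar>x\<bar> \<bar>y\<bar> < real n" using reals_Archimedean2 by blast
  show "(deriv G has_integral (G y - G x)) {x..y}"
  proof (rule has_integral_spike[OF N[of n]])
    show "(h n has_integral (G y - G x)) {x..y}" using n xy by (intro int) auto
    show "deriv G z = h n z" if "z \<in> {x..y} - N n" for z
    proof -
      have "- real n < z" "z < real n" using that n by auto
      then show ?thesis using h[of z n] that by (intro DERIV_imp_deriv) auto
    qed
  qed
qed

section \<open>The theorem of Riesz\<close>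

text \<open>The role of \<open>W\<close> is that of \<open>t \<mapsto> \<integral>\<^bsub>x \<le> t\<^esub> \<bar>G' x\<bar>\<^sup>p\<close>.\<close>

definition power_majorant :: "real \<Rightarrow> real \<Rightarrow> (real \<Rightarrow> real) \<Rightarrow> (real \<Rightarrow> real) \<Rightarrow> bool" where
  "power_majorant p K W G \<longleftrightarrow> (\<forall>x. 0 \<le> W x \<and> W x \<le> K) \<and>
     (\<forall>a b. a < b \<longrightarrow> \<bar>G b - G a\<bar> powr p \<le> (b - a) powr (p - 1) * (W b - W a))"

lemma power_majorant_bounds: "power_majorant p K W G \<Longrightarrow> 0 \<le> W x \<and> W x \<le> K"
  by (simp add: power_majorant_def)

lemma power_majorant_increment:
  "power_majorant p K W G \<Longrightarrow> a < b \<Longrightarrow> \<bar>G b - G a\<bar> powr p \<le> (b - a) powr (p - 1) * (W b - W a)"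
  by (simp add: power_majorant_def)

lemma power_majorant_mono:
  assumes "power_majorant p K W G"
  shows "mono W"
proof (rule monoI)
  fix a b :: real assume "a \<le> b"
  show "W a \<le> W b"
  proof (cases "a = b")
    case False
    then have ab: "a < b" using \<open>a \<le> b\<close> by simp
    have "0 \<le> (b - a) powr (p - 1) * (W b - W a)"
      by (rule order_trans[OF powr_ge_zero power_majorant_increment[OF assms ab]])
    moreover have "(b - a) powr (p - 1) > 0" using ab by simp
    ultimately show ?thesis by (simp add: zero_le_mult_iff)
  qed simp
qed

text \<open>The difference quotient t of G satisfies an estimate for \<open>t powr p\<close>;
  replacing this power by its tangent at c gives an inequality that is additive over intervals and
  can be summed over a family, with c still free.\<close>

lemma power_majorant_linear_bound:
  assumes maj: "power_majorant p K W G" and p: "p > 1" and c: "c > 0" and "a \<le> b"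
  shows "p * c powr (p - 1) * \<bar>G b - G a\<bar> \<le> (W b - W a) + (p - 1) * c powr p * (b - a)"
proof (cases "a = b")
  case False
  then have ab: "a < b" using \<open>a \<le> b\<close> by simp
  define t where "t = \<bar>G b - G a\<bar> / (b - a)"
  have t: "t \<ge> 0" "\<bar>G b - G a\<bar> = t * (b - a)" using ab by (auto simp: t_def)
  have "t powr p * (b - a) powr p \<le> (b - a) powr (p - 1) * (W b - W a)"
    using power_majorant_increment[OF maj ab] t ab by (simp add: powr_mult)
  also have "(b - a) powr p = (b - a) powr (p - 1) * (b - a)"
    using ab by (simp add: powr_diff)
  finally have "t powr p * (b - a) \<le> W b - W a"
    using ab by (simp add: mult.left_commute)
  moreover have "(c powr p + p * c powr (p - 1) * (t - c)) * (b - a) \<le> t powr p * (b - a)"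
    using powr_tangent_le[of p t c] p c t ab by (intro mult_right_mono) auto
  ultimately have "(c powr p + p * c powr (p - 1) * (t - c)) * (b - a) \<le> W b - W a" by simp
  moreover define A where "A = c powr (p - 1)"
  moreover have "c powr p = A * c"
    using c by (simp add: A_def powr_diff)
  ultimately have "(A * c + p * A * (t - c)) * (b - a) \<le> W b - W a" by simp
  then show ?thesis
    unfolding t(2) \<open>c powr p = A * c\<close> A_def[symmetric] by (simp add: algebra_simps)
qed simp

lemma power_majorant_imp_abs_continuous:
  assumes maj: "power_majorant p K W G" and p: "p > 1"
  shows "locally_abs_continuous G"
  unfolding locally_abs_continuous_def
proof (intro allI abs_continuous_onI_family)
  fix a b \<epsilon> :: real assume \<epsilon>: "\<epsilon> > 0"
  have K: "K \<ge> 0" using power_majorant_bounds[OF maj, of 0] by linarith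
  \<comment> \<open>The choice of c makes the factor of the sum equal to 2 * (K + 1) / \<epsilon>,
    and \<delta> makes the length term at most 1. The right side is then at most K + 1, so the sum
    is at most \<epsilon>/2; K + 1 replaces K to stay positive.\<close>
  define c where "c = (2 * (K + 1) / (\<epsilon> * p)) powr (1 / (p - 1))"
  have c: "c > 0" "p * c powr (p - 1) = 2 * (K + 1) / \<epsilon>"
    using K \<epsilon> p by (auto simp: c_def powr_powr)
  define \<delta> where "\<delta> = 1 / ((p - 1) * c powr p)"
  have \<delta>: "\<delta> > 0" "(p - 1) * c powr p * \<delta> = 1" using p c by (auto simp: \<delta>_def)
  show "\<exists>\<delta>>0. \<forall>(I::real set set) u v. disj_family I u v \<longrightarrow> (\<forall>i\<in>I. u i \<in> {a..b} \<and> v i \<in> {a..b}) \<longrightarrow>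
      (\<Sum>i\<in>I. v i - u i) < \<delta> \<longrightarrow> (\<Sum>i\<in>I. \<bar>G (v i) - G (u i)\<bar>) < \<epsilon>"
  proof (intro exI[of _ \<delta>] conjI \<delta> allI impI)
    fix I :: "real set set" and u v
    assume fam: "disj_family I u v" and inS: "\<forall>i\<in>I. u i \<in> {a..b} \<and> v i \<in> {a..b}"
      and small: "(\<Sum>i\<in>I. v i - u i) < \<delta>"
    have le: "\<And>i. i \<in> I \<Longrightarrow> u i \<le> v i" using fam by (auto simp: disj_family_def)
    have WK: "(\<Sum>i\<in>I. W (v i) - W (u i)) \<le> K"
    proof (cases "I = {}")
      case False
      then have "a \<le> b" using inS by fastforce
      then have "(\<Sum>i\<in>I. W (v i) - W (u i)) \<le> W b - W a"
        using power_majorant_mono[OF maj] inS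
        by (intro sum_disj_family_le fam) (auto simp: mono_on_def mono_def)
      then show ?thesis using power_majorant_bounds[OF maj, of b] power_majorant_bounds[OF maj, of a] by simp
    qed (use K in simp)
    have "(p * c powr (p - 1)) * (\<Sum>i\<in>I. \<bar>G (v i) - G (u i)\<bar>)
        \<le> (\<Sum>i\<in>I. (W (v i) - W (u i)) + (p - 1) * c powr p * (v i - u i))"
      unfolding sum_distrib_left using le by (intro sum_mono power_majorant_linear_bound[OF maj p c(1)]) auto
    also have "\<dots> = (\<Sum>i\<in>I. W (v i) - W (u i)) + (p - 1) * c powr p * (\<Sum>i\<in>I. v i - u i)"
      by (simp add: sum.distrib sum_distrib_left)
    also have "\<dots> \<le> K + (p - 1) * c powr p * \<delta>"
      using WK small p by (intro add_mono mult_left_mono) auto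
    finally have "2 * (K + 1) / \<epsilon> * (\<Sum>i\<in>I. \<bar>G (v i) - G (u i)\<bar>) \<le> K + 1"
      using \<delta> c by simp
    then have "(K + 1) * (2 * (\<Sum>i\<in>I. \<bar>G (v i) - G (u i)\<bar>)) \<le> (K + 1) * \<epsilon>"
      using \<epsilon> by (simp add: field_simps)
    then have "2 * (\<Sum>i\<in>I. \<bar>G (v i) - G (u i)\<bar>) \<le> \<epsilon>"
      by (rule mult_left_le_imp_le) (use K in simp)
    then show "(\<Sum>i\<in>I. \<bar>G (v i) - G (u i)\<bar>) < \<epsilon>" using \<epsilon> by simp
  qed
qed

lemma straddle_derivative:
  fixes G :: "real \<Rightarrow> real"
  assumes "(G has_real_derivative D) (at x)" "e > 0"
  obtains d where "d > 0"
    "\<And>a b. a \<le> x \<Longrightarrow> x \<le> b \<Longrightarrow> b - a < d \<Longrightarrow> \<bar>G b - G a - D * (b - a)\<bar> \<le> e * (b - a)"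
proof -
  have "(G has_derivative (*) D) (at x)" using assms(1) by (simp add: has_field_derivative_def)
  then obtain d where d: "d > 0"
      "\<And>y. \<bar>y - x\<bar> < d \<Longrightarrow> \<bar>G y - G x - D * (y - x)\<bar> \<le> e * \<bar>y - x\<bar>"
    using assms(2) unfolding has_derivative_at_alt by auto
  show thesis
  proof (rule that[OF d(1)])
    fix a b assume ab: "a \<le> x" "x \<le> b" "b - a < d"
    have "\<bar>G b - G x - D * (b - x)\<bar> \<le> e * (b - x)" "\<bar>G a - G x - D * (a - x)\<bar> \<le> e * (x - a)"
      using d(2)[of b] d(2)[of a] ab by auto
    moreover have "G b - G a - D * (b - a) = (G b - G x - D * (b - x)) - (G a - G x - D * (a - x))"
      by (simp add: algebra_simps)
    ultimately show "\<bar>G b - G a - D * (b - a)\<bar> \<le> e * (b - a)"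
      by (simp add: algebra_simps)
  qed
qed

text \<open>Difference quotients of G over the cells of ever finer grids give step functions S n.
  The majorant inequality bounds the integral of S n by a telescoping sum of increments of W, hence
  by K. Since S n converges to \<open>\<bar>deriv G x\<bar> powr p\<close> wherever G is
  differentiable, Fatou's lemma finishes.\<close>

lemma power_majorant_imp_Lp:
  assumes maj: "power_majorant p K W G" and p: "p > 1"
  shows "Lp_function p (deriv G)" "(LINT x|lebesgue. \<bar>deriv G x\<bar> powr p) \<le> K"
proof -
  have lac: "locally_abs_continuous G" by (rule power_majorant_imp_abs_continuous[OF maj p])
  have K: "K \<ge> 0" using power_majorant_bounds[OF maj, of 0] by linarith
  have AEd: "AE x in lebesgue. (G has_real_derivative deriv G x) (at x)"
  proof (rule AE_I')
    show "{x. \<not> G field_differentiable at x} \<in> null_sets lebesgue"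
      using locally_abs_continuous_AE_differentiable[OF lac] by (simp add: negligible_iff_null_sets)
    show "{x \<in> space lebesgue. \<not> (G has_real_derivative deriv G x) (at x)} \<subseteq> {x. \<not> G field_differentiable at x}"
      by (auto simp: field_differentiable_derivI)
  qed
  have "(\<lambda>x. indicator {-real n..real n} x * deriv G x) \<in> borel_measurable lebesgue" for n
    using has_integral_implies_lebesgue_measurable[OF locally_abs_continuous_FTC[OF lac, of "-real n" "real n"]]
    by simp
  then have meas: "deriv G \<in> borel_measurable lebesgue"
  proof (rule borel_measurable_LIMSEQ_real[rotated])
    fix x
    show "(\<lambda>n. indicator {-real n..real n} x * deriv G x) \<longlonglongrightarrow> deriv G x"
    proof (rule tendsto_eventually)
      have "\<forall>\<^sub>F n in sequentially. real n \<ge> \<bar>x\<bar>"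
        using filterlim_real_sequentially by (simp add: filterlim_at_top)
      then show "\<forall>\<^sub>F n in sequentially. indicator {-real n..real n} x * deriv G x = deriv G x"
        by eventually_elim (auto simp: indicator_def)
    qed
  qed
  \<comment> \<open>The mesh is 1 / r n, with r n positive for n = 0 too. The (n + 1)^2 cells on
    either side of 0 fill the interval from -(n + 1) to n + 1, so every x is eventually
    covered.\<close>
  define r where "r n = real n + 1" for n :: nat
  have r: "r n > 0" for n by (simp add: r_def)
  define q where "q n k = r n * (G ((real_of_int k + 1) / r n) - G (k / r n))" for n and k :: int
  define M where "M n = (int n + 1)\<^sup>2" for n :: nat
  define S where "S n x = (\<Sum>k\<in>{- M n..<M n}. ennreal (\<bar>q n k\<bar> powr p) * indicator {k / r n..<(real_of_int k + 1) / r n} x)"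
    for n x
  have Sint: "(\<integral>\<^sup>+x. S n x \<partial>lebesgue) \<le> ennreal K" for n
  proof -
    have len: "(real_of_int k + 1) / r n - k / r n = 1 / r n" for k
      by (simp add: diff_divide_distrib[symmetric])
    have one: "(\<integral>\<^sup>+x. c * indicator {k / r n..<(real_of_int k + 1) / r n} x \<partial>lebesgue)
        = c * ennreal (1 / r n)" for c k
    proof -
      have "real_of_int k / r n \<le> (real_of_int k + 1) / r n"
        using r[of n] by (simp add: divide_right_mono)
      then have "emeasure lebesgue {k / r n..<(real_of_int k + 1) / r n} = ennreal (1 / r n)"
        by (simp add: len)
      moreover have "(\<integral>\<^sup>+x. c * indicator {k / r n..<(real_of_int k + 1) / r n} x \<partial>lebesgue)
          = c * emeasure lebesgue {k / r n..<(real_of_int k + 1) / r n}"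
        by (rule nn_integral_cmult_indicator) simp
      ultimately show ?thesis by simp
    qed
    have "(\<integral>\<^sup>+x. S n x \<partial>lebesgue) = (\<Sum>k\<in>{- M n..<M n}. ennreal (\<bar>q n k\<bar> powr p) * ennreal (1 / r n))"
    proof -
      have "(\<integral>\<^sup>+x. S n x \<partial>lebesgue) = (\<Sum>k\<in>{- M n..<M n}. \<integral>\<^sup>+x. ennreal (\<bar>q n k\<bar> powr p) *
          indicator {k / r n..<(real_of_int k + 1) / r n} x \<partial>lebesgue)"
        unfolding S_def
        by (rule nn_integral_sum)
           (intro borel_measurable_times_ennreal borel_measurable_const borel_measurable_indicator, simp)
      then show ?thesis by (simp only: one)
    qed
    also have "\<dots> = (\<Sum>k\<in>{- M n..<M n}. ennreal (\<bar>q n k\<bar> powr p * (1 / r n)))"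
      using r[of n] by (intro sum.cong refl ennreal_mult[symmetric]) auto
    also have "\<dots> \<le> (\<Sum>k\<in>{- M n..<M n}. ennreal (W ((real_of_int k + 1) / r n) - W (k / r n)))"
    proof (intro sum_mono ennreal_leI)
      fix k
      have lt: "real_of_int k / r n < (real_of_int k + 1) / r n" using r[of n] by (simp add: divide_strict_right_mono)
      have "\<bar>q n k\<bar> powr p = r n powr p * \<bar>G ((real_of_int k + 1) / r n) - G (k / r n)\<bar> powr p"
        using r[of n] by (simp add: q_def abs_mult powr_mult)
      also have "\<dots> \<le> r n powr p * ((1 / r n) powr (p - 1) * (W ((real_of_int k + 1) / r n) - W (k / r n)))"
        using power_majorant_increment[OF maj lt] unfolding len by (intro mult_left_mono) auto
      also have "\<dots> = r n * (W ((real_of_int k + 1) / r n) - W (k / r n))"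
        using r[of n] by (simp add: powr_divide powr_diff)
      finally show "\<bar>q n k\<bar> powr p * (1 / r n) \<le> W ((real_of_int k + 1) / r n) - W (k / r n)"
        using r[of n] by (simp add: field_simps)
    qed
    also have "\<dots> = ennreal (\<Sum>k\<in>{- M n..<M n}. W ((real_of_int k + 1) / r n) - W (k / r n))"
      using r[of n] by (intro sum_ennreal) (auto intro!: monoD[OF power_majorant_mono[OF maj]] divide_right_mono)
    also have "\<dots> \<le> ennreal K"
    proof (rule ennreal_leI)
      have "(\<Sum>k\<in>{- M n..<M n}. W ((real_of_int k + 1) / r n) - W (k / r n)) \<le> W (real_of_int (M n) / r n) - W (real_of_int (- M n) / r n)"
      proof (rule sum_disj_family_le[where u = "\<lambda>k. real_of_int k / r n" and v = "\<lambda>k. (real_of_int k + 1) / r n"])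
        show "disj_family {- M n..<M n} (\<lambda>k. real_of_int k / r n) (\<lambda>k. (real_of_int k + 1) / r n)"
          unfolding disj_family_def using r[of n] by (auto simp: divide_le_cancel)
        show "real_of_int (- M n) / r n \<le> real_of_int k / r n \<and> (real_of_int k + 1) / r n \<le> real_of_int (M n) / r n"
          if "k \<in> {- M n..<M n}" for k
        proof -
          have "real_of_int (- M n) \<le> real_of_int k" "real_of_int k + 1 \<le> real_of_int (M n)"
            using that by auto
          then show ?thesis using r[of n] by (intro conjI divide_right_mono) auto
        qed
        show "real_of_int (- M n) / r n \<le> real_of_int (M n) / r n"
          using r[of n] by (intro divide_right_mono) (auto simp: M_def)
        show "mono_on {real_of_int (- M n) / r n..real_of_int (M n) / r n} W"
          using power_majorant_mono[OF maj] by (auto simp: mono_on_def mono_def)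
      qed
      then show "(\<Sum>k\<in>{- M n..<M n}. W ((real_of_int k + 1) / r n) - W (k / r n)) \<le> K"
        using power_majorant_bounds[OF maj, of "M n / r n"] power_majorant_bounds[OF maj, of "real_of_int (- M n) / r n"]
        by linarith
    qed
    finally show ?thesis .
  qed
  have Slim: "(\<lambda>n. S n x) \<longlonglongrightarrow> ennreal (\<bar>deriv G x\<bar> powr p)"
    if der: "(G has_real_derivative deriv G x) (at x)" for x
  proof -
    define k where "k n = \<lfloor>r n * x\<rfloor>" for n
    have kx: "k n / r n \<le> x" "x < (real_of_int (k n) + 1) / r n" for n
      using r[of n] by (auto simp: k_def field_simps) linarith+
    have "\<forall>\<^sub>F n in sequentially. real n \<ge> \<bar>x\<bar>"
      using filterlim_real_sequentially by (simp add: filterlim_at_top)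
    then have "\<forall>\<^sub>F n in sequentially. ennreal (\<bar>q n (k n)\<bar> powr p) = S n x"
    proof eventually_elim
      case (elim n)
      have "r n * \<bar>x\<bar> < r n * r n" using elim r[of n] by (intro mult_strict_left_mono) (auto simp: r_def)
      then have "\<bar>r n * x\<bar> < r n * r n" using r[of n] by (simp add: abs_mult)
      then have "\<bar>r n * x\<bar> < real_of_int (M n)" by (simp add: M_def r_def power2_eq_square)
      then have kM: "k n \<in> {- M n..<M n}" unfolding k_def by (auto simp: abs_less_iff) linarith+
      have ind: "indicator {j / r n..<(real_of_int j + 1) / r n} x = (if j = k n then 1 else 0 :: ennreal)" for j
      proof -
        have "x \<in> {j / r n..<(real_of_int j + 1) / r n} \<longleftrightarrow> j = k n"
          using r[of n] by (auto simp: k_def field_simps floor_eq_iff) linarith+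
        then show ?thesis by (simp add: indicator_def)
      qed
      show ?case unfolding S_def ind using kM by (simp add: if_distrib cong: if_cong)
    qed
    \<comment> \<open>In general x is not an end point of its cell, so differentiability is used in
      the straddling form, for cells that contain x and shrink to it.\<close>
    moreover have "(\<lambda>n. q n (k n)) \<longlonglongrightarrow> deriv G x"
    proof (rule LIMSEQ_I)
      fix e :: real assume "e > 0"
      then obtain d where d: "d > 0" "\<And>a b. a \<le> x \<Longrightarrow> x \<le> b \<Longrightarrow> b - a < d \<Longrightarrow>
          \<bar>G b - G a - deriv G x * (b - a)\<bar> \<le> e / 2 * (b - a)"
        using straddle_derivative[OF der, of "e / 2"] by auto
      obtain n0 :: nat where n0: "1 / d < n0" using reals_Archimedean2 by blast
      show "\<exists>no. \<forall>n\<ge>no. norm (q n (k n) - deriv G x) < e"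
      proof (intro exI[of _ n0] allI impI)
        fix n assume "n0 \<le> n"
        then have "1 / d < r n" using n0 by (simp add: r_def)
        then have "1 / r n < d" using d r[of n] by (simp add: field_simps)
        moreover have len: "(real_of_int (k n) + 1) / r n - k n / r n = 1 / r n"
          by (simp add: diff_divide_distrib[symmetric])
        ultimately have "\<bar>G ((real_of_int (k n) + 1) / r n) - G (k n / r n) - deriv G x * (1 / r n)\<bar> \<le> e / 2 * (1 / r n)"
          using d(2)[of "k n / r n" "(real_of_int (k n) + 1) / r n"] kx[of n] by simp
        then have "r n * \<bar>G ((real_of_int (k n) + 1) / r n) - G (k n / r n) - deriv G x * (1 / r n)\<bar> \<le> e / 2"
          using r[of n] by (simp add: field_simps)
        moreover have "q n (k n) - deriv G x = r n * (G ((real_of_int (k n) + 1) / r n) - G (k n / r n) - deriv G x * (1 / r n))"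
          using r[of n] by (simp add: q_def field_simps)
        ultimately show "norm (q n (k n) - deriv G x) < e"
          using r[of n] \<open>e > 0\<close> by (simp add: abs_mult)
      qed
    qed
    then have "(\<lambda>n. ennreal (\<bar>q n (k n)\<bar> powr p)) \<longlonglongrightarrow> ennreal (\<bar>deriv G x\<bar> powr p)"
      using p by (intro tendsto_ennrealI tendsto_powr' tendsto_rabs tendsto_const) auto
    ultimately show ?thesis by (rule Lim_transform_eventually[rotated])
  qed
  have "(\<integral>\<^sup>+x. ennreal (\<bar>deriv G x\<bar> powr p) \<partial>lebesgue) = (\<integral>\<^sup>+x. liminf (\<lambda>n. S n x) \<partial>lebesgue)"
    using AEd by (intro nn_integral_cong_AE, eventually_elim) (metis Slim lim_imp_Liminf sequentially_bot)
  also have "\<dots> \<le> liminf (\<lambda>n. \<integral>\<^sup>+x. S n x \<partial>lebesgue)"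
    unfolding S_def
    by (intro nn_integral_liminf borel_measurable_sum borel_measurable_times_ennreal
        borel_measurable_const borel_measurable_indicator) simp
  also have "\<dots> \<le> ennreal K"
    using Liminf_le[of sequentially "\<lambda>n. \<integral>\<^sup>+x. S n x \<partial>lebesgue" "ennreal K"] Sint by simp
  finally have le: "(\<integral>\<^sup>+x. ennreal (\<bar>deriv G x\<bar> powr p) \<partial>lebesgue) \<le> ennreal K" .
  have measp: "(\<lambda>x. \<bar>deriv G x\<bar> powr p) \<in> borel_measurable lebesgue"
    using meas by measurable
  have int: "integrable lebesgue (\<lambda>x. \<bar>deriv G x\<bar> powr p)"
    using le measp by (intro integrableI_nonneg) (auto simp: le_less_trans)
  then show "Lp_function p (deriv G)" using meas by (simp add: Lp_function_def)
  have "ennreal (LINT x|lebesgue. \<bar>deriv G x\<bar> powr p) \<le> ennreal K"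
    using nn_integral_eq_integral[OF int] le by simp
  then show "(LINT x|lebesgue. \<bar>deriv G x\<bar> powr p) \<le> K" using K by simp
qed

text \<open>For W, the integral of \<open>\<bar>deriv G x\<bar> powr p\<close> up to t, the majorant
  inequality is Hoelder's inequality on \<open>{a..b}\<close>. It is obtained by integrating the
  tangent inequality.\<close>

lemma Lp_imp_power_majorant:
  assumes lac: "locally_abs_continuous G" and Lp: "Lp_function p (deriv G)" and p: "p > 1"
  shows "\<exists>W. power_majorant p (LINT x|lebesgue. \<bar>deriv G x\<bar> powr p) W G"
proof -
  define \<phi> where "\<phi> x = \<bar>deriv G x\<bar> powr p" for x
  have int: "integrable lebesgue \<phi>" using Lp by (simp add: Lp_function_def \<phi>_def[abs_def])
  then have absi: "\<phi> absolutely_integrable_on UNIV" by (simp add: set_integrable_def)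
  have ion: "\<phi> integrable_on T" if "T \<in> sets lebesgue" for T
    using set_lebesgue_integral_eq_integral(1)[OF set_integrable_subset[OF absi that]] by simp
  define W where "W t = integral {..t} \<phi>" for t
  have tot: "integral UNIV \<phi> = (LINT x|lebesgue. \<phi> x)"
    using set_lebesgue_integral_eq_integral(2)[OF absi] by (simp add: set_lebesgue_integral_def)
  have W: "0 \<le> W t" "W t \<le> (LINT x|lebesgue. \<phi> x)" for t
    unfolding W_def tot[symmetric]
    by (auto intro!: integral_nonneg integral_subset_le ion simp: \<phi>_def)
  have "\<bar>G b - G a\<bar> powr p \<le> (b - a) powr (p - 1) * (W b - W a)" if ab: "a < b" for a b
  proof -
    have "(\<phi> has_integral (W a + integral {a..b} \<phi>)) ({..a} \<union> {a..b})"
      unfolding W_def using ion ab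
      by (intro has_integral_Un integrable_integral) (auto intro!: negligible_subset[of "{a}"])
    moreover have "{..a} \<union> {a..b} = {..b}" using ab by auto
    ultimately have WI: "W b - W a = integral {a..b} \<phi>"
      unfolding W_def by (metis add_diff_cancel_left' integral_unique)
    define D where "D = \<bar>G b - G a\<bar>"
    show ?thesis
    proof (cases "D = 0")
      case True
      then show ?thesis using WI ion[of "{a..b}"]
        by (auto simp: D_def \<phi>_def intro!: mult_nonneg_nonneg integral_nonneg)
    next
      case False
      \<comment> \<open>The tangent point is the mean slope, for which the linear terms cancel after
        integration. It must be positive, hence the separate case D = 0. The sign s turns
        \<open>\<bar>G b - G a\<bar>\<close> into an integral of s * deriv G.\<close>
      define c where "c = D / (b - a)"
      have c: "c > 0" "D = c * (b - a)" using False ab by (auto simp: c_def D_def)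
      define s where "s = sgn (G b - G a)"
      have s: "s * (G b - G a) = D" by (auto simp: s_def D_def sgn_if)
      have der: "((\<lambda>x. s * deriv G x) has_integral D) {a..b}"
        using has_integral_mult_right[OF locally_abs_continuous_FTC[OF lac less_imp_le[OF ab]], of s] s by simp
      have const: "((\<lambda>x. C) has_integral C * (b - a)) {a..b}" for C
        using has_integral_const_real[of C a b] ab by (simp add: mult.commute)
      have "((\<lambda>x. (c powr p - p * c powr (p - 1) * c) + p * c powr (p - 1) * (s * deriv G x)) has_integral
          ((c powr p - p * c powr (p - 1) * c) * (b - a) + p * c powr (p - 1) * D)) {a..b}"
        by (intro has_integral_add const has_integral_mult_right der)
      then have "(c powr p - p * c powr (p - 1) * c) * (b - a) + p * c powr (p - 1) * D \<le> integral {a..b} \<phi>"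
      proof (rule has_integral_le)
        show "(\<phi> has_integral integral {a..b} \<phi>) {a..b}" using ion by auto
        fix x
        have "s * deriv G x \<le> \<bar>deriv G x\<bar>"
          by (auto simp: s_def sgn_if)
        then have "p * c powr (p - 1) * (s * deriv G x) \<le> p * c powr (p - 1) * \<bar>deriv G x\<bar>"
          using p by (intro mult_left_mono) auto
        moreover have "c powr p + p * c powr (p - 1) * (\<bar>deriv G x\<bar> - c) \<le> \<phi> x"
          unfolding \<phi>_def using p c by (intro powr_tangent_le) auto
        moreover have "p * c powr (p - 1) * (\<bar>deriv G x\<bar> - c) = p * c powr (p - 1) * \<bar>deriv G x\<bar> - p * c powr (p - 1) * c"
          by (rule right_diff_distrib)
        ultimately show "(c powr p - p * c powr (p - 1) * c) + p * c powr (p - 1) * (s * deriv G x) \<le> \<phi> x"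
          by linarith
      qed
      then have "c powr p * (b - a) \<le> W b - W a"
        unfolding WI c(2) by (simp add: algebra_simps)
      then have "(b - a) powr (p - 1) * (c powr p * (b - a)) \<le> (b - a) powr (p - 1) * (W b - W a)"
        by (intro mult_left_mono) auto
      moreover have "(b - a) powr (p - 1) * (c powr p * (b - a)) = D powr p"
        unfolding c(2) using ab c by (simp add: powr_mult powr_diff)
      ultimately show ?thesis by (simp add: D_def)
    qed
  qed
  then have "power_majorant p (LINT x|lebesgue. \<phi> x) W G"
    using W by (simp add: power_majorant_def)
  then show ?thesis unfolding \<phi>_def by blast
qed

section \<open>Divided differences\<close>

lemma
  fixes f :: "real \<Rightarrow> real"
  assumes "card S = Suc m"
  shows degree_Lagrange_poly: "degree (Lagrange_poly m f S) \<le> m"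
    and poly_Lagrange_poly: "\<And>x. x \<in> S \<Longrightarrow> poly (Lagrange_poly m f S) x = f x"
  using theI'[OF Lagrange_poly_ex1[OF assms, of f]] by (auto simp: Lagrange_poly_def)

lemma divided_difference_eq_coeff:
  fixes f :: "real \<Rightarrow> real"
  assumes "card S = Suc m" "degree P \<le> m" "\<And>x. x \<in> S \<Longrightarrow> poly P x = f x"
  shows "divided_difference m f S = coeff P m"
  using the1_equality[OF Lagrange_poly_ex1[OF assms(1), of f], of P] assms(2,3)
  by (simp add: divided_difference_def Lagrange_poly_def)

text \<open>Adding to Q the right multiple of the monic polynomial with zeros \<open>S - {z}\<close>
  produces the interpolant on S. As Q has no term of degree m, this multiple is the divided
  difference.\<close>

lemma divided_difference_Newton:
  fixes f :: "real \<Rightarrow> real"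
  assumes S: "card S = Suc m" "z \<in> S" and Q: "degree Q \<le> m" "coeff Q m = 0"
    and agree: "\<And>y. y \<in> S \<Longrightarrow> y \<noteq> z \<Longrightarrow> poly Q y = f y"
  shows "f z - poly Q z = divided_difference m f S * (\<Prod>y\<in>S - {z}. z - y)"
proof -
  have fin: "finite S" using S by (intro card_ge_0_finite) simp
  define N where "N = (\<Prod>y\<in>S - {z}. [:- y, 1:])"
  have degN: "degree N = m"
    unfolding N_def using S fin by (subst degree_prod_eq_sum_degree) auto
  have lcN: "coeff N m = 1"
    using lead_coeff_prod[of "\<lambda>y. [:- y, 1:]" "S - {z}"] degN unfolding N_def by simp
  have polyN: "poly N x = (\<Prod>y\<in>S - {z}. x - y)" for x by (simp add: N_def poly_prod)
  have N0: "poly N z \<noteq> 0" using fin by (simp add: polyN)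
  define c where "c = (f z - poly Q z) / poly N z"
  have "divided_difference m f S = coeff (Q + smult c N) m"
  proof (rule divided_difference_eq_coeff[OF S(1)])
    show "degree (Q + smult c N) \<le> m"
      using Q(1) degN by (intro degree_add_le) (auto intro: order_trans[OF degree_smult_le])
    show "poly (Q + smult c N) x = f x" if "x \<in> S" for x
    proof (cases "x = z")
      case True
      then show ?thesis using N0 by (simp add: c_def)
    next
      case False
      then have "poly N x = 0" using that fin by (auto simp: polyN)
      then show ?thesis using agree[OF that False] by simp
    qed
  qed
  then show ?thesis using Q(2) lcN N0 by (simp add: c_def polyN)
qed

text \<open>Neville's scheme: the interpolants on \<open>S - {a}\<close> and \<open>S - {b}\<close>,
  weighted by x - a and x - b, combine to the interpolant on S.\<close>

lemma divided_difference_recurrence: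
  fixes f :: "real \<Rightarrow> real"
  assumes S: "card S = Suc (Suc m)" "a \<in> S" "b \<in> S" "a \<noteq> b"
  shows "(b - a) * divided_difference (Suc m) f S =
    divided_difference m f (S - {a}) - divided_difference m f (S - {b})"
proof -
  have fin: "finite S" using S by (intro card_ge_0_finite) simp
  have card: "card (S - {a}) = Suc m" "card (S - {b}) = Suc m" using S fin by auto
  define P1 P0 where "P1 = Lagrange_poly m f (S - {a})" and "P0 = Lagrange_poly m f (S - {b})"
  note P1 = degree_Lagrange_poly[OF card(1), of f, folded P1_def]
    poly_Lagrange_poly[OF card(1), of _ f, folded P1_def]
  note P0 = degree_Lagrange_poly[OF card(2), of f, folded P0_def]
    poly_Lagrange_poly[OF card(2), of _ f, folded P0_def]
  define R where "R = [:- a, 1:] * P1 - [:- b, 1:] * P0"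
  have "divided_difference (Suc m) f S = coeff (smult (1 / (b - a)) R) (Suc m)"
  proof (rule divided_difference_eq_coeff[OF S(1)])
    have "degree ([:- c, 1:] * P) \<le> Suc m" if "degree P \<le> m" for c and P :: "real poly"
      using degree_mult_le[of "[:- c, 1:]" P] that by simp
    then have "degree R \<le> Suc m" unfolding R_def using P1(1) P0(1) by (intro degree_diff_le) auto
    then show "degree (smult (1 / (b - a)) R) \<le> Suc m" by (rule order_trans[OF degree_smult_le])
    show "poly (smult (1 / (b - a)) R) x = f x" if x: "x \<in> S" for x
    proof -
      have "poly R x = (b - a) * f x"
        using P1(2)[of x] P0(2)[of x] x S by (cases "x = a"; cases "x = b") (auto simp: R_def algebra_simps)
      then show ?thesis using S by simp
    qed
  qed
  moreover have "coeff R (Suc m) = coeff P1 m - coeff P0 m"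
    using P1(1) P0(1) by (simp add: R_def coeff_eq_0)
  ultimately show ?thesis
    using S by (simp add: divided_difference_def P1_def P0_def)
qed

text \<open>The derivatives are given as a sequence D, so the induction can pass to
  \<open>\<lambda>k. D (Suc k)\<close> and the zeros that Rolle's theorem places between consecutive
  nodes.\<close>

lemma iterated_Rolle:
  fixes D :: "nat \<Rightarrow> real \<Rightarrow> real"
  assumes "\<And>k x. k < n \<Longrightarrow> (D k has_real_derivative D (Suc k) x) (at x)"
    and "strict_mono_on {0..n} x" "\<And>i. i \<le> n \<Longrightarrow> D 0 (x i) = 0"
  shows "\<exists>\<xi>\<in>{x 0..x n}. D n \<xi> = 0"
  using assms
proof (induction n arbitrary: D x)
  case 0
  then show ?case by auto
next
  case (Suc n)
  have "\<exists>y. x i < y \<and> y < x (Suc i) \<and> D 1 y = 0" if "i \<le> n" for i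
  proof -
    have lt: "x i < x (Suc i)" using Suc.prems(2) that by (auto simp: strict_mono_on_def)
    have der: "(D 0 has_real_derivative D 1 z) (at z)" for z using Suc.prems(1)[of 0 z] by simp
    have "continuous_on {x i..x (Suc i)} (D 0)"
      using der by (intro continuous_at_imp_continuous_on ballI DERIV_isCont) blast
    moreover have "D 0 (x i) = D 0 (x (Suc i))"
      using Suc.prems(3)[of i] Suc.prems(3)[of "Suc i"] that by simp
    ultimately obtain y where "x i < y" "y < x (Suc i)" "(D 0 has_real_derivative 0) (at y)"
      using Rolle[OF lt, of "D 0"] der real_differentiable_def by blast
    then show ?thesis using DERIV_unique[OF der] by blast
  qed
  then obtain y where y: "\<And>i. i \<le> n \<Longrightarrow> x i < y i \<and> y i < x (Suc i) \<and> D 1 (y i) = 0" by metis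
  have "strict_mono_on {0..n} y"
  proof (rule strict_mono_onI)
    fix i j assume ij: "i \<in> {0..n}" "j \<in> {0..n}" "i < j"
    have "x (Suc i) \<le> x j"
      using strict_mono_on_leD[OF Suc.prems(2), of "Suc i" j] ij by auto
    then show "y i < y j" using y[of i] y[of j] ij by auto
  qed
  then have "\<exists>\<xi>\<in>{y 0..y n}. D (Suc n) \<xi> = 0"
    using Suc.IH[of "\<lambda>k. D (Suc k)" y] Suc.prems(1) y by auto
  then show ?case using y[of 0] y[of n] by force
qed

lemma DERIV_higher_pderiv:
  fixes P :: "real poly"
  shows "((\<lambda>x. poly ((pderiv ^^ k) P) x) has_real_derivative poly ((pderiv ^^ Suc k) P) x) (at x)"
  using poly_DERIV[of "(pderiv ^^ k) P" x] by simp

lemma poly_higher_pderiv_degree: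
  fixes P :: "real poly"
  assumes "degree P \<le> n"
  shows "poly ((pderiv ^^ n) P) x = fact n * coeff P n"
proof -
  have "coeff ((pderiv ^^ n) P) i = 0" if "i > 0" for i
    using that assms by (simp add: coeff_higher_pderiv coeff_eq_0)
  then have "degree ((pderiv ^^ n) P) = 0" by (metis gr0I leading_coeff_0_iff degree_0 less_irrefl)
  then obtain c where c: "(pderiv ^^ n) P = [:c:]" by (rule degree_eq_zeroE)
  have "coeff ((pderiv ^^ n) P) 0 = fact n * coeff P n"
    by (simp add: coeff_higher_pderiv pochhammer_fact)
  then show ?thesis using c by simp
qed

text \<open>Iterated Rolle for the difference between D 0 and its interpolant P, whose derivative of
  order n is constant.\<close>

lemma divided_difference_mean_value:
  fixes D :: "nat \<Rightarrow> real \<Rightarrow> real"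
  assumes der: "\<And>k x. k < n \<Longrightarrow> (D k has_real_derivative D (Suc k) x) (at x)"
    and x: "strict_mono_on {0..n} x" and f: "\<And>i. i \<le> n \<Longrightarrow> D 0 (x i) = f (x i)"
  shows "\<exists>\<xi>\<in>{x 0..x n}. D n \<xi> = fact n * divided_difference n f (x ` {0..n})"
proof -
  have card: "card (x ` {0..n}) = Suc n"
    using strict_mono_on_imp_inj_on[OF x] by (simp add: card_image)
  define P where "P = Lagrange_poly n f (x ` {0..n})"
  have P: "degree P \<le> n" "\<And>y. y \<in> x ` {0..n} \<Longrightarrow> poly P y = f y"
    unfolding P_def by (rule degree_Lagrange_poly[OF card], rule poly_Lagrange_poly[OF card])
  have "\<exists>\<xi>\<in>{x 0..x n}. D n \<xi> - poly ((pderiv ^^ n) P) \<xi> = 0"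
  proof (rule iterated_Rolle[of n "\<lambda>k z. D k z - poly ((pderiv ^^ k) P) z", OF _ x])
    show "((\<lambda>z. D k z - poly ((pderiv ^^ k) P) z) has_real_derivative
        D (Suc k) z - poly ((pderiv ^^ Suc k) P) z) (at z)" if "k < n" for k z
      using DERIV_diff[OF der[OF that] DERIV_higher_pderiv] .
    show "D 0 (x i) - poly ((pderiv ^^ 0) P) (x i) = 0" if "i \<le> n" for i
      using f[OF that] P(2)[of "x i"] that by simp
  qed
  then show ?thesis
    unfolding poly_higher_pderiv_degree[OF P(1)] by (simp add: divided_difference_def P_def)
qed

text \<open>The two divided differences of order n in the recurrence are, up to n!, values of D n at
  points \<xi> and \<eta> of the window, to which the majorant inequality applies. The factor n! is
  at least 1 and is discarded.\<close>

lemma divided_difference_power_bound: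
  fixes D :: "nat \<Rightarrow> real \<Rightarrow> real"
  assumes der: "\<And>k x. k < n \<Longrightarrow> (D k has_real_derivative D (Suc k) x) (at x)"
    and maj: "power_majorant p K W (D n)" and p: "p > 1"
    and x: "strict_mono_on {0..Suc n} x" and f: "\<And>i. i \<le> Suc n \<Longrightarrow> D 0 (x i) = f (x i)"
  shows "(x (Suc n) - x 0) * \<bar>divided_difference (Suc n) f (x ` {0..Suc n})\<bar> powr p
    \<le> W (x (Suc n)) - W (x 0)"
proof -
  have inj: "inj_on x {0..Suc n}" by (rule strict_mono_on_imp_inj_on[OF x])
  have lt: "x i < x j" if "i < j" "j \<le> Suc n" for i j
    using x that by (auto simp: strict_mono_on_def)
  define S where "S = x ` {0..Suc n}"
  define h where "h = x (Suc n) - x 0"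
  have h: "h > 0" using lt[of 0 "Suc n"] by (simp add: h_def)
  have card: "card S = Suc (Suc n)" unfolding S_def using inj by (simp add: card_image)
  have "{0..Suc n} - {0} = {Suc 0..Suc n}" "{0..Suc n} - {Suc n} = {0..n}" by auto
  then have S0: "S - {x 0} = (\<lambda>i. x (Suc i)) ` {0..n}" and S1: "S - {x (Suc n)} = x ` {0..n}"
    unfolding S_def using inj_on_image_set_diff[OF inj, of "{0..Suc n}" "{0}"]
      inj_on_image_set_diff[OF inj, of "{0..Suc n}" "{Suc n}"]
    by (simp_all add: image_image[of x Suc, symmetric])
  obtain \<xi> where \<xi>: "\<xi> \<in> {x (Suc 0)..x (Suc n)}" "D n \<xi> = fact n * divided_difference n f (S - {x 0})"
    using divided_difference_mean_value[of n D "\<lambda>i. x (Suc i)" f, OF der] x f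
    unfolding S0 by (auto simp: strict_mono_on_def)
  obtain \<eta> where \<eta>: "\<eta> \<in> {x 0..x n}" "D n \<eta> = fact n * divided_difference n f (S - {x (Suc n)})"
    using divided_difference_mean_value[of n D x f, OF der] x f
    unfolding S1 by (auto simp: strict_mono_on_def)
  define \<Delta> where "\<Delta> = divided_difference (Suc n) f S"
  have "h * \<Delta> = divided_difference n f (S - {x 0}) - divided_difference n f (S - {x (Suc n)})"
    unfolding h_def \<Delta>_def
    by (rule divided_difference_recurrence[OF card]) (use h in \<open>auto simp: S_def h_def\<close>)
  then have eq: "fact n * (h * \<Delta>) = D n \<xi> - D n \<eta>"
    using \<xi>(2) \<eta>(2) by (simp add: right_diff_distrib)
  have "h * \<bar>\<Delta>\<bar> \<le> fact n * (h * \<bar>\<Delta>\<bar>)"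
    using h by (intro mult_right_mono[of 1 "fact n", simplified]) (auto simp: fact_ge_1)
  also have "\<dots> = \<bar>D n \<xi> - D n \<eta>\<bar>"
    unfolding eq[symmetric] using h by (simp add: abs_mult)
  finally have le: "h * \<bar>\<Delta>\<bar> \<le> \<bar>D n \<xi> - D n \<eta>\<bar>" .
  \<comment> \<open>Both the length and the increment of W grow when \<open>{s..t}\<close> is
    enlarged to the whole window. The relative position of \<xi> and \<eta> is unknown, so this is
    applied in either order.\<close>
  have incr: "\<bar>D n t - D n s\<bar> powr p \<le> h powr (p - 1) * (W (x (Suc n)) - W (x 0))"
    if "x 0 \<le> s" "s \<le> t" "t \<le> x (Suc n)" for s t
  proof (cases "s = t")
    case True
    then show ?thesis using monoD[OF power_majorant_mono[OF maj], of "x 0" "x (Suc n)"] h by (simp add: h_def)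
  next
    case False
    then have "\<bar>D n t - D n s\<bar> powr p \<le> (t - s) powr (p - 1) * (W t - W s)"
      using power_majorant_increment[OF maj, of s t] that by simp
    also have "\<dots> \<le> h powr (p - 1) * (W (x (Suc n)) - W (x 0))"
      using that p monoD[OF power_majorant_mono[OF maj]]
      by (intro mult_mono powr_mono2 diff_mono) (auto simp: h_def)
    finally show ?thesis .
  qed
  have bnd: "x 0 \<le> \<xi>" "\<xi> \<le> x (Suc n)" "x 0 \<le> \<eta>" "\<eta> \<le> x (Suc n)"
    using \<xi>(1) \<eta>(1) lt[of 0 "Suc 0"] lt[of n "Suc n"] by auto
  have "(h * \<bar>\<Delta>\<bar>) powr p \<le> \<bar>D n \<xi> - D n \<eta>\<bar> powr p"
    using le h p by (intro powr_mono2) auto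
  also have "\<dots> \<le> h powr (p - 1) * (W (x (Suc n)) - W (x 0))"
    using incr[of \<xi> \<eta>] incr[of \<eta> \<xi>] bnd by (cases "\<xi> \<le> \<eta>") (auto simp: abs_minus_commute)
  finally have "h powr (p - 1) * (h * \<bar>\<Delta>\<bar> powr p) \<le> h powr (p - 1) * (W (x (Suc n)) - W (x 0))"
    using h by (simp add: powr_mult powr_diff)
  then have "h * \<bar>\<Delta>\<bar> powr p \<le> W (x (Suc n)) - W (x 0)"
    using h by simp
  then show ?thesis by (simp add: h_def \<Delta>_def S_def)
qed

text \<open>Raising the shift by one adds a telescoping sum of unit increments, which costs at most
  K.\<close>

lemma sum_shift_diff_le:
  fixes w :: "nat \<Rightarrow> real"
  assumes "\<And>i. 0 \<le> w i \<and> w i \<le> K"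
  shows "(\<Sum>i=0..N. w (i + m) - w i) \<le> real m * K"
proof (induction m)
  case (Suc m)
  have "(\<Sum>i=0..N. w (i + Suc m) - w i)
      = (\<Sum>i=0..N. w (Suc (i + m)) - w (i + m)) + (\<Sum>i=0..N. w (i + m) - w i)"
    by (simp add: sum.distrib[symmetric])
  also have "(\<Sum>i=0..N. w (Suc (i + m)) - w (i + m)) = w (Suc N + m) - w m"
    using sum_Suc_diff[of 0 N "\<lambda>i. w (i + m)"] by simp
  also have "\<dots> \<le> K" using assms[of "Suc N + m"] assms[of m] by linarith
  finally show ?case using Suc.IH by (simp add: algebra_simps)
qed simp

lemma variation_functional_le:
  fixes D :: "nat \<Rightarrow> real \<Rightarrow> real"
  assumes m: "m \<ge> 1" and der: "\<And>k x. k < m - 1 \<Longrightarrow> (D k has_real_derivative D (Suc k) x) (at x)"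
    and maj: "power_majorant p K W (D (m - 1))" and p: "p > 1"
    and f: "\<And>x. x \<in> E \<Longrightarrow> D 0 x = f x"
  shows "variation_functional m p E f \<le> ennreal (real m * K powr (1 / p))"
  unfolding variation_functional_def
proof (rule SUP_least, clarify)
  fix n x assume "(n, x) \<in> increasing_sequences m E"
  then have x: "m \<le> n" "strict_mono_on {0..n} x" "x ` {0..n} \<subseteq> E"
    by (auto simp: increasing_sequences_def)
  have K: "K \<ge> 0" using power_majorant_bounds[OF maj, of 0] by linarith
  have "(x (i + m) - x i) * \<bar>divided_difference m f (x ` {i..i + m})\<bar> powr p \<le> W (x (i + m)) - W (x i)"
    if i: "i \<in> {0..n - m}" for i
  proof -
    obtain l where l: "m = Suc l" using m by (cases m) auto
    have img: "(\<lambda>j. x (i + j)) ` {0..Suc l} = x ` {i..i + m}"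
    proof -
      have "{i..i + m} = (+) i ` {0..Suc l}" by (simp add: l)
      then show ?thesis by (simp only: image_image)
    qed
    have "strict_mono_on {0..Suc l} (\<lambda>j. x (i + j))"
    proof (rule strict_mono_onI)
      fix r s assume "r \<in> {0..Suc l}" "s \<in> {0..Suc l}" "r < s"
      then show "x (i + r) < x (i + s)"
        using x(1) i l by (intro strict_mono_onD[OF x(2)]) auto
    qed
    moreover have "D 0 (x (i + j)) = f (x (i + j))" if "j \<le> Suc l" for j
    proof (rule f)
      have "i + j \<in> {0..n}" using x(1) i l that by auto
      then show "x (i + j) \<in> E" using x(3) by blast
    qed
    ultimately show ?thesis
      using divided_difference_power_bound[of l D p K W "\<lambda>j. x (i + j)" f] der maj p l
      unfolding img by simp
  qed
  then have "(\<Sum>i=0..n - m. (x (i + m) - x i) * \<bar>divided_difference m f (x ` {i..i + m})\<bar> powr p)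
      \<le> (\<Sum>i=0..n - m. W (x (i + m)) - W (x i))" by (rule sum_mono)
  also have "\<dots> \<le> real m * K"
    using power_majorant_bounds[OF maj] by (intro sum_shift_diff_le)
  finally have "(\<Sum>i=0..n - m. (x (i + m) - x i) * \<bar>divided_difference m f (x ` {i..i + m})\<bar> powr p) \<le> real m * K" .
  moreover have "0 \<le> (x (i + m) - x i) * \<bar>divided_difference m f (x ` {i..i + m})\<bar> powr p" if "i \<in> {0..n - m}" for i
    using strict_mono_on_leD[OF x(2), of i "i + m"] that x(1) by (intro mult_nonneg_nonneg) auto
  ultimately have "(\<Sum>i=0..n - m. (x (i + m) - x i) * \<bar>divided_difference m f (x ` {i..i + m})\<bar> powr p) powr (1 / p)
      \<le> (real m * K) powr (1 / p)"
    using p by (intro powr_mono2 sum_nonneg) auto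
  also have "\<dots> = real m powr (1 / p) * K powr (1 / p)" using K by (simp add: powr_mult)
  \<comment> \<open>Since 1 / p \<le> 1 and m \<ge> 1, the factor \<open>m powr (1 / p)\<close> is
    at most m, which removes p from the constant.\<close>
  also have "\<dots> \<le> real m * K powr (1 / p)"
    using m p powr_mono[of "1 / p" 1 "real m"] by (intro mult_right_mono) auto
  finally show "ennreal ((\<Sum>i=0..n - m. (x (i + m) - x i) * \<bar>divided_difference m f (x ` {i..i + m})\<bar> powr p) powr (1 / p))
      \<le> ennreal (real m * K powr (1 / p))"
    by (rule ennreal_leI)
qed

section \<open>Interpolation on finite sets\<close>

lemma DERIV_max0_power:
  fixes s :: real
  shows "((\<lambda>s. max 0 s ^ Suc (Suc j)) has_real_derivative real (Suc (Suc j)) * max 0 s ^ Suc j) (at s)"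
proof -
  consider "s < 0" | "s = 0" | "s > 0" by linarith
  then show ?thesis
  proof cases
    case 1
    have "((\<lambda>s. max 0 s ^ Suc (Suc j)) has_real_derivative 0) (at s)"
      by (rule has_field_derivative_transform_within_open[OF DERIV_const[of 0], of "{..<0}"])
         (use 1 in auto)
    then show ?thesis using 1 by simp
  next
    case 2
    \<comment> \<open>At the knot the difference quotient is a truncated power of one degree less,
      which tends to 0 because that degree is still at least 1; \<open>max 0 s\<close> itself has a
      corner.\<close>
    have "((\<lambda>h::real. max 0 h ^ Suc j) \<longlongrightarrow> max 0 0 ^ Suc j) (at 0)"
      by (intro tendsto_intros)
    moreover have "\<forall>\<^sub>F h in at (0::real). max 0 h ^ Suc j = (max 0 h ^ Suc (Suc j) - max 0 0 ^ Suc (Suc j)) / (h - 0)"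
      unfolding eventually_at by (intro exI[of _ 1]) (auto simp: max_def)
    ultimately have "((\<lambda>h::real. (max 0 h ^ Suc (Suc j) - max 0 0 ^ Suc (Suc j)) / (h - 0)) \<longlongrightarrow> 0) (at 0)"
      by (simp add: tendsto_cong)
    then show ?thesis using 2 by (simp add: has_field_derivative_iff)
  next
    case 3
    have "((\<lambda>s. s ^ Suc (Suc j)) has_real_derivative real (Suc (Suc j)) * s ^ Suc j) (at s)"
      by (rule derivative_eq_intros refl | simp)+
    then have "((\<lambda>s. max 0 s ^ Suc (Suc j)) has_real_derivative real (Suc (Suc j)) * s ^ Suc j) (at s)"
      by (rule has_field_derivative_transform_within_open[of _ _ _ "{0<..}"]) (use 3 in auto)
    then show ?thesis using 3 by simp
  qed
qed

text \<open>Solvability of a Vandermonde system: \<alpha> l is the value, on the l-th Lagrange basis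
  polynomial, of the linear functional that sends z^i to \<beta> i.\<close>

lemma moment_problem:
  fixes c \<beta> :: "nat \<Rightarrow> real"
  assumes inj: "inj_on c {..m}"
  shows "\<exists>\<alpha>. \<forall>k\<le>m. (\<Sum>l\<le>m. \<alpha> l * c l ^ k) = \<beta> k"
proof -
  have card: "card (c ` {..m}) = Suc m" using inj by (simp add: card_image)
  define L where "L l = Lagrange_poly m (\<lambda>z. if z = c l then 1 else 0) (c ` {..m})" for l
  have L: "degree (L l) \<le> m" "\<And>z. z \<in> c ` {..m} \<Longrightarrow> poly (L l) z = (if z = c l then 1 else 0)" for l
    unfolding L_def by (rule degree_Lagrange_poly[OF card], rule poly_Lagrange_poly[OF card])
  have eq: "monom 1 k = (\<Sum>l\<le>m. smult (c l ^ k) (L l))" (is "_ = ?R") if "k \<le> m" for k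
  proof -
    have "degree ?R \<le> m"
      by (intro degree_sum_le order_trans[OF degree_smult_le L(1)]) auto
    moreover have "poly ?R z = z ^ k" if z: "z \<in> c ` {..m}" for z
    proof -
      obtain i where i: "i \<le> m" "z = c i" using z by auto
      have "poly ?R z = (\<Sum>l\<le>m. if l = i then c i ^ k else 0)"
        unfolding poly_sum using i L(2)[OF z] inj by (intro sum.cong) (auto simp: inj_on_eq_iff)
      then show ?thesis using i by simp
    qed
    ultimately show ?thesis
      using Lagrange_poly_ex1[OF card, of "\<lambda>z. z ^ k"] that
      by (metis degree_monom_le order_trans poly_monom mult_1)
  qed
  define \<alpha> where "\<alpha> l = (\<Sum>i\<le>m. coeff (L l) i * \<beta> i)" for l
  have "(\<Sum>l\<le>m. \<alpha> l * c l ^ k) = \<beta> k" if k: "k \<le> m" for k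
  proof -
    have "(\<Sum>l\<le>m. \<alpha> l * c l ^ k) = (\<Sum>i\<le>m. \<Sum>l\<le>m. c l ^ k * coeff (L l) i * \<beta> i)"
      unfolding \<alpha>_def sum_distrib_right by (subst sum.swap) (simp add: mult_ac)
    also have "\<dots> = (\<Sum>i\<le>m. coeff (monom 1 k) i * \<beta> i)"
      unfolding eq[OF k] by (simp add: coeff_sum sum_distrib_right)
    also have "\<dots> = (\<Sum>i\<le>m. if i = k then \<beta> k else 0)" by (intro sum.cong) auto
    finally show ?thesis using k by simp
  qed
  then show ?thesis by blast
qed

text \<open>By the binomial theorem a combination of the powers (s - c l)^m depends only on the
  moments of \<alpha>; prescribing them isolates s^j. The moment of order 0 is zero because j < m,
  which will make the derivative of order m - 1 of the spline constant beyond the last knot.\<close>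

lemma monomial_as_shifted_powers:
  fixes c :: "nat \<Rightarrow> real"
  assumes inj: "inj_on c {..m}"
  shows "\<exists>\<alpha>. \<forall>j<m. (\<forall>s. (\<Sum>l\<le>m. \<alpha> l j * (s - c l) ^ m) = s ^ j) \<and> (\<Sum>l\<le>m. \<alpha> l j) = 0"
proof -
  have "\<exists>\<alpha>. (\<forall>s. (\<Sum>l\<le>m. \<alpha> l * (s - c l) ^ m) = s ^ j) \<and> (\<Sum>l\<le>m. \<alpha> l) = 0" if j: "j < m" for j
  proof -
    \<comment> \<open>The only nonzero moment cancels the sign and the binomial coefficient of s^j
      in the expansion.\<close>
    define \<beta> where "\<beta> k = (if k = m - j then (- 1) ^ k / real (m choose k) else 0)" for k
    obtain \<alpha> where \<alpha>: "\<And>k. k \<le> m \<Longrightarrow> (\<Sum>l\<le>m. \<alpha> l * c l ^ k) = \<beta> k"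
      using moment_problem[OF inj, of \<beta>] by blast
    have "(\<Sum>l\<le>m. \<alpha> l * (s - c l) ^ m) = s ^ j" for s
    proof -
      have "(s - c l) ^ m = (\<Sum>k\<le>m. real (m choose k) * (- 1) ^ k * s ^ (m - k) * c l ^ k)" for l
        using binomial_ring[of "- c l" s m] by (simp add: power_minus[of "c l"] mult_ac)
      then have "(\<Sum>l\<le>m. \<alpha> l * (s - c l) ^ m)
          = (\<Sum>l\<le>m. \<Sum>k\<le>m. real (m choose k) * (- 1) ^ k * s ^ (m - k) * (\<alpha> l * c l ^ k))"
        by (simp add: sum_distrib_left mult_ac)
      also have "\<dots> = (\<Sum>k\<le>m. real (m choose k) * (- 1) ^ k * s ^ (m - k) * \<beta> k)"
        by (subst sum.swap) (simp add: sum_distrib_left[symmetric] \<alpha>)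
      also have "\<dots> = (\<Sum>k\<le>m. if k = m - j then s ^ j else 0)"
        using j by (intro sum.cong) (auto simp: \<beta>_def power_mult_distrib[symmetric])
      finally show ?thesis using j by simp
    qed
    moreover have "(\<Sum>l\<le>m. \<alpha> l) = 0" using \<alpha>[of 0] j by (simp add: \<beta>_def)
    ultimately show ?thesis by blast
  qed
  then obtain \<alpha> where "\<And>j. j < m \<Longrightarrow> (\<forall>s. (\<Sum>l\<le>m. \<alpha> j l * (s - c l) ^ m) = s ^ j) \<and> (\<Sum>l\<le>m. \<alpha> j l) = 0"
    by metis
  then show ?thesis by (intro exI[of _ "\<lambda>l j. \<alpha> j l"]) blast
qed

lemma coeff_prod_linear_bound:
  fixes y :: "'i \<Rightarrow> real"
  assumes "finite A" "\<And>k. k \<in> A \<Longrightarrow> \<bar>y k\<bar> \<le> B" "B \<ge> 0"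
  shows "\<bar>coeff (\<Prod>k\<in>A. [:- y k, 1:]) j\<bar> \<le> (1 + B) ^ card A"
  using assms(1,2)
proof (induction A arbitrary: j rule: finite_induct)
  case empty
  then show ?case by (auto simp: coeff_1)
next
  case (insert k A)
  define P where "P = (\<Prod>k\<in>A. [:- y k, 1:])"
  have IH: "\<bar>coeff P i\<bar> \<le> (1 + B) ^ card A" for i
    unfolding P_def using insert.IH insert.prems by simp
  have nn: "0 \<le> (1 + B) ^ card A" using assms(3) by simp
  have 1: "\<bar>y k * coeff P j\<bar> \<le> B * (1 + B) ^ card A"
    unfolding abs_mult using insert.prems[of k] IH[of j] assms(3) by (intro mult_mono) auto
  have 2: "\<bar>case j of 0 \<Rightarrow> 0 | Suc i \<Rightarrow> coeff P i\<bar> \<le> (1 + B) ^ card A"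
    using IH nn by (cases j) auto
  have "coeff ([:- y k, 1:] * P) j = (case j of 0 \<Rightarrow> 0 | Suc i \<Rightarrow> coeff P i) - y k * coeff P j"
    by (cases j) (auto simp: coeff_pCons)
  then have "\<bar>coeff ([:- y k, 1:] * P) j\<bar> \<le> (1 + B) ^ card A + B * (1 + B) ^ card A"
    using 1 2 by linarith
  then show ?case using insert.hyps by (simp add: P_def[symmetric] algebra_simps)
qed

definition clamp_to :: "real \<Rightarrow> real \<Rightarrow> real \<Rightarrow> real" where
  "clamp_to a b t = max a (min b t)"

text \<open>A spline with equally spaced knots in \<open>{a..b}\<close> that switches from \<open>0\<close> to a given monic
  polynomial of degree \<open>m - 1\<close>. The constant \<open>C\<close> is scale invariant since the zeros of
  the polynomial stay within distance \<open>m * (b - a)\<close> of \<open>a\<close>.\<close>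

lemma spline_step:
  assumes m: "m \<ge> 1"
  shows "\<exists>C\<ge>0. \<forall>a b (A::nat set) y. a < b \<longrightarrow> finite A \<longrightarrow> card A = m - 1 \<longrightarrow>
       (\<forall>k\<in>A. \<bar>y k - a\<bar> \<le> real m * (b - a)) \<longrightarrow>
       (\<exists>G. (\<forall>k<m - 1. \<forall>t. (G k has_real_derivative G (Suc k) t) (at t)) \<and>
          (\<forall>t\<le>a. G 0 t = 0) \<and> (\<forall>t\<ge>b. G 0 t = (\<Prod>k\<in>A. t - y k)) \<and>
          (\<forall>s t. \<bar>G (m - 1) t - G (m - 1) s\<bar> \<le> C / (b - a) * \<bar>clamp_to a b t - clamp_to a b s\<bar>))"
proof -
  define c where "c l = real l / real m" for l
  have c01: "0 \<le> c l" "c l \<le> 1" if "l \<le> m" for l using that m by (auto simp: c_def)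
  have "inj_on c {..m}" using m by (auto simp: inj_on_def c_def)
  then obtain \<alpha> where \<alpha>: "\<And>j s. j < m \<Longrightarrow> (\<Sum>l\<le>m. \<alpha> l j * (s - c l) ^ m) = s ^ j"
      "\<And>j. j < m \<Longrightarrow> (\<Sum>l\<le>m. \<alpha> l j) = 0"
    using monomial_as_shifted_powers[of c m] by metis
  define C where "C = fact m * (\<Sum>l\<le>m. \<Sum>j<m. (1 + real m) ^ (m - 1) * \<bar>\<alpha> l j\<bar>)"
  show ?thesis
  proof (intro exI[of _ C] conjI allI impI)
    show "C \<ge> 0" unfolding C_def by (intro mult_nonneg_nonneg sum_nonneg) auto
    fix a b :: real and A :: "nat set" and y
    assume ab: "a < b" and A: "finite A" "card A = m - 1"
      and y0: "\<forall>k\<in>A. \<bar>y k - a\<bar> \<le> real m * (b - a)"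
    note y = bspec[OF y0]
    define h where "h = b - a"
    have h: "h > 0" using ab by (simp add: h_def)
    define \<sigma> where "\<sigma> t = (t - a) / h" for t
    define Q where "Q = (\<Prod>k\<in>A. [:- ((y k - a) / h), 1:])"
    define e where "e j = coeff Q j" for j
    have "\<bar>(y k - a) / h\<bar> \<le> real m" if "k \<in> A" for k
      using y[OF that] h by (simp add: h_def divide_le_eq abs_divide)
    then have e: "\<bar>e j\<bar> \<le> (1 + real m) ^ (m - 1)" for j
      unfolding e_def Q_def A(2)[symmetric] by (intro coeff_prod_linear_bound A) auto
    have degQ: "degree Q = m - 1"
      unfolding Q_def using A by (subst degree_prod_eq_sum_degree) auto
    have polyQ: "poly Q s = (\<Sum>j<m. e j * s ^ j)" for s
      unfolding poly_altdef degQ e_def using m by (intro sum.cong) auto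
    \<comment> \<open>With these weights the powers (s - c l)^m add up to Q in the normalised
      variable. Right of all knots, truncated and full powers agree, so the spline equals Q
      there.\<close>
    define w where "w l = (\<Sum>j<m. e j * \<alpha> l j)" for l
    have wpow: "(\<Sum>l\<le>m. w l * (s - c l) ^ m) = poly Q s" for s
    proof -
      have "(\<Sum>l\<le>m. w l * (s - c l) ^ m) = (\<Sum>j<m. \<Sum>l\<le>m. e j * (\<alpha> l j * (s - c l) ^ m))"
        unfolding w_def sum_distrib_right by (subst sum.swap) (simp add: mult_ac)
      then show ?thesis by (simp add: sum_distrib_left[symmetric] \<alpha>(1) polyQ)
    qed
    have wsum: "(\<Sum>l\<le>m. w l) = 0"
      unfolding w_def by (subst sum.swap) (simp add: sum_distrib_left[symmetric] \<alpha>(2))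
    \<comment> \<open>The k-th derivative of the spline in closed form: the factor h^(m - 1) undoes
      the scaling of the m - 1 zeros, and every derivative in t costs one factor 1 / h.\<close>
    define G where "G k t = h ^ (m - 1 - k) * (\<Sum>l\<le>m. w l * (fact m / fact (m - k)) * max 0 (\<sigma> t - c l) ^ (m - k))"
      for k t
    have der: "(G k has_real_derivative G (Suc k) t) (at t)" if k: "k < m - 1" for k t
    proof -
      obtain r where r: "m - k = Suc (Suc r)" "m - Suc k = Suc r" "m - 1 - k = Suc r" "m - 1 - Suc k = r"
        using k by (metis Suc_diff_Suc diff_Suc_Suc diff_commute diff_diff_left plus_1_eq_Suc Suc_pred' less_imp_Suc_add zero_less_diff diff_Suc_1)
      have s: "((\<lambda>t. \<sigma> t - c l) has_real_derivative 1 / h) (at t)" for l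
        unfolding \<sigma>_def using h by (auto intro!: derivative_eq_intros)
      have "((\<lambda>t. max 0 (\<sigma> t - c l) ^ Suc (Suc r)) has_real_derivative
          (real (Suc (Suc r)) * max 0 (\<sigma> t - c l) ^ Suc r) * (1 / h)) (at t)" for l
        by (rule DERIV_chain2[OF DERIV_max0_power s])
      then have "(G k has_real_derivative h ^ Suc r * (\<Sum>l\<le>m. w l * (fact m / fact (Suc (Suc r))) *
          ((real (Suc (Suc r)) * max 0 (\<sigma> t - c l) ^ Suc r) * (1 / h)))) (at t)"
        unfolding G_def[abs_def] r by (intro DERIV_cmult DERIV_sum) auto
      also have "h ^ Suc r * (\<Sum>l\<le>m. w l * (fact m / fact (Suc (Suc r))) *
          ((real (Suc (Suc r)) * max 0 (\<sigma> t - c l) ^ Suc r) * (1 / h))) = G (Suc k) t"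
        unfolding G_def r sum_distrib_left
      proof (rule sum.cong)
        fix l
        show "h ^ Suc r * (w l * (fact m / fact (Suc (Suc r))) *
          ((real (Suc (Suc r)) * max 0 (\<sigma> t - c l) ^ Suc r) * (1 / h)))
          = h ^ r * (w l * (fact m / fact (Suc r)) * max 0 (\<sigma> t - c l) ^ Suc r)"
          using h by (simp add: fact_Suc[of "Suc r"] divide_simps del: of_nat_Suc fact_Suc)
      qed simp
      finally show ?thesis .
    qed
    have zero: "G 0 t = 0" if "t \<le> a" for t
    proof -
      have "\<sigma> t \<le> 0" using that h by (simp add: \<sigma>_def divide_le_0_iff)
      then have "max 0 (\<sigma> t - c l) = 0" if "l \<le> m" for l using c01[OF that] by simp
      then show ?thesis using m by (simp add: G_def power_0_left)
    qed
    have right: "G 0 t = (\<Prod>k\<in>A. t - y k)" if "t \<ge> b" for t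
    proof -
      have "1 \<le> \<sigma> t" using that h by (simp add: \<sigma>_def h_def le_divide_eq)
      then have "max 0 (\<sigma> t - c l) = \<sigma> t - c l" if "l \<le> m" for l using c01[OF that] by simp
      then have "G 0 t = h ^ (m - 1) * poly Q (\<sigma> t)" unfolding wpow[symmetric] by (simp add: G_def)
      also have "\<dots> = (\<Prod>k\<in>A. h) * (\<Prod>k\<in>A. \<sigma> t - (y k - a) / h)"
        using A by (simp add: Q_def poly_prod)
      also have "\<dots> = (\<Prod>k\<in>A. t - y k)"
        unfolding prod.distrib[symmetric] \<sigma>_def using h by (intro prod.cong) (auto simp: field_simps)
      finally show ?thesis .
    qed
    define \<Phi> where "\<Phi> t = (\<Sum>l\<le>m. w l * max 0 (\<sigma> t - c l))" for t
    have G\<Phi>: "G (m - 1) t = fact m * \<Phi> t" for t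
      using m by (simp add: G_def \<Phi>_def sum_distrib_left mult_ac)
    \<comment> \<open>Left of a all terms vanish; right of b the slopes w l add up to 0. So only the
      part of a change of t inside \<open>{a..b}\<close> is seen, as the localised Lipschitz bound
      requires.\<close>
    have \<Phi>cl: "\<Phi> t = \<Phi> (clamp_to a b t)" for t
    proof -
      consider "t < a" | "a \<le> t" "t \<le> b" | "t > b" by linarith
      then show ?thesis
      proof cases
        case 1
        then have "\<sigma> t \<le> 0" "\<sigma> (clamp_to a b t) \<le> 0"
          using h ab by (auto simp: \<sigma>_def clamp_to_def divide_le_0_iff)
        then have "max 0 (\<sigma> t - c l) = 0" "max 0 (\<sigma> (clamp_to a b t) - c l) = 0" if "l \<le> m" for l
          using c01[OF that] by auto
        then show ?thesis by (simp add: \<Phi>_def)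
      next
        case 2
        then show ?thesis by (simp add: clamp_to_def)
      next
        case 3
        have "\<Phi> u = - (\<Sum>l\<le>m. w l * c l)" if "u \<ge> b" for u
        proof -
          have "1 \<le> \<sigma> u" using that h by (simp add: \<sigma>_def h_def le_divide_eq)
          then have "max 0 (\<sigma> u - c l) = \<sigma> u - c l" if "l \<le> m" for l using c01[OF that] by simp
          then have "\<Phi> u = (\<Sum>l\<le>m. w l) * \<sigma> u - (\<Sum>l\<le>m. w l * c l)"
            by (simp add: \<Phi>_def right_diff_distrib sum_subtractf sum_distrib_right)
          then show ?thesis by (simp add: wsum)
        qed
        from this[of t] this[of "clamp_to a b t"] show ?thesis using 3 ab by (simp add: clamp_to_def)
      qed
    qed
    have lip: "\<bar>G (m - 1) t - G (m - 1) s\<bar> \<le> C / (b - a) * \<bar>clamp_to a b t - clamp_to a b s\<bar>" for s t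
    proof -
      define t' s' where "t' = clamp_to a b t" and "s' = clamp_to a b s"
      have "\<bar>w l\<bar> \<le> (\<Sum>j<m. (1 + real m) ^ (m - 1) * \<bar>\<alpha> l j\<bar>)" for l
        unfolding w_def using e
        by (intro order_trans[OF sum_abs] sum_mono) (auto simp: abs_mult intro!: mult_right_mono)
      then have wC: "fact m * (\<Sum>l\<le>m. \<bar>w l\<bar>) \<le> C"
        unfolding C_def by (intro mult_left_mono sum_mono) auto
      have "G (m - 1) t - G (m - 1) s = fact m * (\<Phi> t' - \<Phi> s')"
        unfolding G\<Phi> t'_def s'_def \<Phi>cl[symmetric] by (rule right_diff_distrib[symmetric])
      then have "\<bar>G (m - 1) t - G (m - 1) s\<bar> = fact m * \<bar>\<Phi> t' - \<Phi> s'\<bar>"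
        by (simp add: abs_mult)
      also have "\<bar>\<Phi> t' - \<Phi> s'\<bar> \<le> (\<Sum>l\<le>m. \<bar>w l\<bar> * \<bar>\<sigma> t' - \<sigma> s'\<bar>)"
        unfolding \<Phi>_def sum_subtractf[symmetric] right_diff_distrib[symmetric]
        by (intro order_trans[OF sum_abs] sum_mono) (auto simp: abs_mult intro!: mult_left_mono)
      also have "\<dots> = (\<Sum>l\<le>m. \<bar>w l\<bar>) * \<bar>\<sigma> t' - \<sigma> s'\<bar>" by (simp add: sum_distrib_right)
      also have "\<bar>\<sigma> t' - \<sigma> s'\<bar> = \<bar>t' - s'\<bar> / h"
        using h by (simp add: \<sigma>_def diff_divide_distrib[symmetric])
      finally have "\<bar>G (m - 1) t - G (m - 1) s\<bar> \<le> (fact m * (\<Sum>l\<le>m. \<bar>w l\<bar>)) * (\<bar>t' - s'\<bar> / h)"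
        by (simp add: mult.assoc)
      also have "\<dots> \<le> C * (\<bar>t' - s'\<bar> / h)" using wC h by (intro mult_right_mono) auto
      finally show ?thesis by (simp add: t'_def s'_def h_def)
    qed
    show "\<exists>G. (\<forall>k<m - 1. \<forall>t. (G k has_real_derivative G (Suc k) t) (at t)) \<and>
          (\<forall>t\<le>a. G 0 t = 0) \<and> (\<forall>t\<ge>b. G 0 t = (\<Prod>k\<in>A. t - y k)) \<and>
          (\<forall>s t. \<bar>G (m - 1) t - G (m - 1) s\<bar> \<le> C / (b - a) * \<bar>clamp_to a b t - clamp_to a b s\<bar>)"
      using der zero right lip by (intro exI[of _ G]) blast
  qed
qed

text \<open>Jensen's inequality for weights of total at most L, from the tangent at c = s /
  L.\<close>

lemma weighted_power_mean_le:
  fixes a u :: "'i \<Rightarrow> real"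
  assumes p: "p \<ge> 1" and nn: "\<And>i. i \<in> I \<Longrightarrow> 0 \<le> a i \<and> 0 \<le> u i"
    and L: "(\<Sum>i\<in>I. u i) \<le> L" "L > 0"
  shows "(\<Sum>i\<in>I. a i * u i) powr p \<le> L powr (p - 1) * (\<Sum>i\<in>I. a i powr p * u i)"
proof (cases "(\<Sum>i\<in>I. a i * u i) = 0")
  case True
  then show ?thesis using nn L by (auto intro!: mult_nonneg_nonneg sum_nonneg)
next
  case False
  define s where "s = (\<Sum>i\<in>I. a i * u i)"
  have "s \<ge> 0" unfolding s_def using nn by (intro sum_nonneg) auto
  then have s: "s > 0" using False by (simp add: s_def)
  define c where "c = s / L"
  have c: "c > 0" "s = c * L" using s L by (auto simp: c_def)
  have "(\<Sum>i\<in>I. (c powr p + p * c powr (p - 1) * (a i - c)) * u i) \<le> (\<Sum>i\<in>I. a i powr p * u i)"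
    using nn p c by (intro sum_mono mult_right_mono powr_tangent_le) auto
  also have "(\<Sum>i\<in>I. (c powr p + p * c powr (p - 1) * (a i - c)) * u i)
      = (c powr p - p * c powr (p - 1) * c) * (\<Sum>i\<in>I. u i) + p * c powr (p - 1) * s"
    unfolding s_def sum_distrib_left sum.distrib[symmetric] by (intro sum.cong) (auto simp: algebra_simps)
  also have "p * c powr (p - 1) * c = p * c powr p" using c by (simp add: powr_diff)
  finally have "(c powr p - p * c powr p) * (\<Sum>i\<in>I. u i) + p * c powr (p - 1) * s \<le> (\<Sum>i\<in>I. a i powr p * u i)" .
  \<comment> \<open>The constant term of the tangent is not positive since p \<ge> 1, so replacing
    the total weight by the larger L only decreases the lower bound.\<close>
  moreover have "(c powr p - p * c powr p) * L \<le> (c powr p - p * c powr p) * (\<Sum>i\<in>I. u i)"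
    using p L by (intro mult_left_mono_neg) (auto intro: mult_left_le_one_le simp: mult_le_cancel_right1)
  moreover have "p * c powr (p - 1) * s = p * c powr p * L"
    using c by (simp add: powr_diff)
  moreover have "(c powr p - p * c powr p) * L + p * c powr p * L = c powr p * L"
    by (simp add: algebra_simps)
  ultimately have "c powr p * L \<le> (\<Sum>i\<in>I. a i powr p * u i)" by linarith
  then have "L powr (p - 1) * (c powr p * L) \<le> L powr (p - 1) * (\<Sum>i\<in>I. a i powr p * u i)"
    by (intro mult_left_mono) auto
  moreover have "L powr (p - 1) * (c powr p * L) = s powr p"
    unfolding c(2) using c L by (simp add: powr_mult powr_diff)
  ultimately show ?thesis by (simp add: s_def)
qed

section \<open>Assembly of the finite interpolant\<close>

lemma clamp_to_mono: "s \<le> t \<Longrightarrow> clamp_to a b s \<le> clamp_to a b t"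
  by (auto simp: clamp_to_def)

lemma clamp_to_bounds: "a \<le> b \<Longrightarrow> a \<le> clamp_to a b t \<and> clamp_to a b t \<le> b"
  by (auto simp: clamp_to_def)

lemma clamp_to_diff_le: "s \<le> t \<Longrightarrow> clamp_to a b t - clamp_to a b s \<le> t - s"
  by (auto simp: clamp_to_def max_def min_def)

text \<open>For a \<le> b, \<open>clamp_to a b t - a\<close> is the length of the part of
  \<open>{a..b}\<close> left of t; such lengths add up over adjacent intervals. The second conjunct
  is carried along for the induction.\<close>

lemma sum_clamp_to:
  fixes z :: "nat \<Rightarrow> real"
  assumes "\<And>i. i < M \<Longrightarrow> z i \<le> z (Suc i)"
  shows "(\<Sum>i<M. clamp_to (z i) (z (Suc i)) t - z i) = clamp_to (z 0) (z M) t - z 0 \<and> z 0 \<le> z M"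
  using assms
proof (induction M)
  case (Suc M)
  have IH: "(\<Sum>i<M. clamp_to (z i) (z (Suc i)) t - z i) = clamp_to (z 0) (z M) t - z 0" "z 0 \<le> z M"
    using Suc.IH Suc.prems by auto
  have le: "z M \<le> z (Suc M)" using Suc.prems by simp
  have "clamp_to (z 0) (z M) t + clamp_to (z M) (z (Suc M)) t - z M = clamp_to (z 0) (z (Suc M)) t"
    using IH(2) le by (auto simp: clamp_to_def max_def min_def)
  then show ?case using IH le by simp
qed (simp add: clamp_to_def)

text \<open>Interpolants of degree at most m - 1 on consecutive windows of m nodes differ by
  \<Delta> i * h i times the product of x - x k over the m - 1 common nodes. Starting from the first
  window, each such correction is added as a spline step instead of globally.\<close>

lemma finite_interpolation:
  assumes m: "m \<ge> 1"
  shows "\<exists>C\<ge>1. \<forall>p n x f. p > 1 \<longrightarrow> m \<le> n \<longrightarrow> strict_mono_on {0..n} x \<longrightarrow>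
      (\<exists>D W. (\<forall>k<m - 1. \<forall>t. (D k has_real_derivative D (Suc k) t) (at t)) \<and>
        power_majorant p (C powr p *
           (\<Sum>i=0..n - m. (x (i + m) - x i) * \<bar>divided_difference m f (x ` {i..i + m})\<bar> powr p))
          W (D (m - 1)) \<and>
        (\<forall>i\<le>n. D 0 (x i) = f (x i)))"
proof -
  obtain C0 :: real where C0: "C0 \<ge> 0" and step:
    "\<forall>a b (A::nat set) y. a < b \<longrightarrow> finite A \<longrightarrow> card A = m - 1 \<longrightarrow>
       (\<forall>k\<in>A. \<bar>y k - a\<bar> \<le> real m * (b - a)) \<longrightarrow>
       (\<exists>G. (\<forall>k<m - 1. \<forall>t. (G k has_real_derivative G (Suc k) t) (at t)) \<and>
          (\<forall>t\<le>a. G 0 t = 0) \<and> (\<forall>t\<ge>b. G 0 t = (\<Prod>k\<in>A. t - y k)) \<and>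
          (\<forall>s t. \<bar>G (m - 1) t - G (m - 1) s\<bar> \<le> C0 / (b - a) * \<bar>clamp_to a b t - clamp_to a b s\<bar>))"
    using spline_step[OF m] by (elim exE conjE) (rule that)
  \<comment> \<open>One factor m compares the window with its chosen gap, the other counts how often
    a gap can be chosen.\<close>
  define C where "C = 1 + C0 * real m * real m"
  show ?thesis
  proof (intro exI[of _ C] conjI allI impI)
    show "C \<ge> 1" using C0 by (simp add: C_def)
    fix p :: real and n :: nat and x :: "nat \<Rightarrow> real" and f :: "real \<Rightarrow> real"
    assume p: "p > 1" and n: "m \<le> n" and x: "strict_mono_on {0..n} x"
    have lt: "x i < x j" if "i < j" "j \<le> n" for i j
      using x that by (auto simp: strict_mono_on_def)
    have le: "x i \<le> x j" if "i \<le> j" "j \<le> n" for i j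
      using lt[of i j] that by (cases "i = j") auto
    have inj: "inj_on x {0..n}" by (rule strict_mono_on_imp_inj_on[OF x])
    define N where "N = n - m"
    define h where "h i = x (i + m) - x i" for i
    define \<Delta> where "\<Delta> i = divided_difference m f (x ` {i..i + m})" for i
    \<comment> \<open>Pigeonhole: the m gaps of a window add up to h i.\<close>
    have "\<exists>r\<in>{i..<i + m}. h i \<le> real m * (x (Suc r) - x r)" if "i \<le> N" for i
    proof (rule ccontr)
      assume "\<not> ?thesis"
      then have "(\<Sum>r\<in>{i..<i + m}. real m * (x (Suc r) - x r)) < (\<Sum>r\<in>{i..<i + m}. h i)"
        using m by (intro sum_strict_mono) (auto simp: not_le)
      moreover have "(\<Sum>r\<in>{i..<i + m}. real m * (x (Suc r) - x r)) = real m * h i"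
        unfolding sum_distrib_left[symmetric] h_def by (simp add: sum_Suc_diff')
      ultimately show False by simp
    qed
    then obtain r where r: "\<And>i. i \<le> N \<Longrightarrow> i \<le> r i \<and> r i < i + m \<and> h i \<le> real m * (x (Suc (r i)) - x (r i))"
      by (metis atLeastLessThan_iff)
    define a b where "a i = x (r i)" and "b i = x (Suc (r i))" for i
    have imn: "i + m \<le> n" if "i \<le> N" for i using that n unfolding N_def by linarith
    have rn: "Suc (r i) \<le> n" if "i \<le> N" for i using r[OF that] imn[OF that] by linarith
    have ab: "a i < b i" if "i \<le> N" for i using lt[of "r i" "Suc (r i)"] rn[OF that] by (simp add: a_def b_def)
    have hab: "h i \<le> real m * (b i - a i)" "b i - a i \<le> h i" if "i \<le> N" for i
      using r[OF that] le[of i "r i"] le[of "Suc (r i)" "i + m"] imn[OF that]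
      by (auto simp: a_def b_def h_def)
    define steps where "steps i g \<longleftrightarrow>
        (\<forall>k<m - 1. \<forall>t. (g k has_real_derivative g (Suc k) t) (at t)) \<and>
        (\<forall>t\<le>a i. g 0 t = 0) \<and> (\<forall>t\<ge>b i. g 0 t = (\<Prod>k\<in>{Suc i..<i + m}. t - x k)) \<and>
        (\<forall>s t. \<bar>g (m - 1) t - g (m - 1) s\<bar>
           \<le> C0 / (b i - a i) * \<bar>clamp_to (a i) (b i) t - clamp_to (a i) (b i) s\<bar>)"
      for i and g :: "nat \<Rightarrow> real \<Rightarrow> real"
    have "\<exists>g. steps i g" if i: "i \<le> N" for i
      unfolding steps_def
    proof (rule step[rule_format, OF ab[OF i]])
      fix k assume k: "k \<in> {Suc i..<i + m}"
      have "i + m \<le> n" using i n by (simp add: N_def)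
      then have "\<bar>x k - a i\<bar> \<le> h i"
        using le[of i k] le[of k "i + m"] le[of i "r i"] le[of "r i" "i + m"] r[OF i] k
        by (auto simp: a_def h_def)
      then show "\<bar>x k - a i\<bar> \<le> real m * (b i - a i)" using hab(1)[OF i] by simp
    qed auto
    then obtain G where G: "\<And>i. i \<le> N \<Longrightarrow> steps i (G i)" by metis
    have Gder: "(G i k has_real_derivative G i (Suc k) t) (at t)" if "i \<le> N" "k < m - 1" for i k t
      using G[OF that(1)] that(2) unfolding steps_def by blast
    have G0: "G i 0 t = 0" if "i \<le> N" "t \<le> a i" for i t
      using G[OF that(1)] that(2) unfolding steps_def by blast
    have G1: "G i 0 t = (\<Prod>k\<in>{Suc i..<i + m}. t - x k)" if "i \<le> N" "t \<ge> b i" for i t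
      using G[OF that(1)] that(2) unfolding steps_def by blast
    have Glip: "\<bar>G i (m - 1) t - G i (m - 1) s\<bar>
          \<le> C0 / (b i - a i) * \<bar>clamp_to (a i) (b i) t - clamp_to (a i) (b i) s\<bar>" if "i \<le> N" for i s t
      using G[OF that(1)] unfolding steps_def by blast
    \<comment> \<open>Where the step is switched on is invisible at the nodes: left of the gap it
      vanishes by construction, and at the remaining nodes before i + m the product has a
      zero.\<close>
    have Gz: "G i 0 (x l) = 0" if "i \<le> N" "l < i + m" "l \<le> n" for i l
    proof (cases "l \<le> r i")
      case True
      then show ?thesis using le[of l "r i"] rn[of i] that by (intro G0) (auto simp: a_def)
    next
      case False
      then have "G i 0 (x l) = (\<Prod>k\<in>{Suc i..<i + m}. x l - x k)"
        using le[of "Suc (r i)" l] that by (intro G1) (auto simp: b_def)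
      moreover have "l \<in> {Suc i..<i + m}" using False r[of i] that by auto
      ultimately show ?thesis by auto
    qed
    have Gp: "G i 0 (x l) = (\<Prod>k\<in>{Suc i..<i + m}. x l - x k)" if "i \<le> N" "i < l" "l \<le> n" for i l
    proof (cases "l < i + m")
      case True
      then have "l \<in> {Suc i..<i + m}" using that by auto
      then have "(\<Prod>k\<in>{Suc i..<i + m}. x l - x k) = 0" by auto
      then show ?thesis using Gz[of i l] True that by simp
    next
      case False
      then show ?thesis using le[of "Suc (r i)" l] r[of i] that by (intro G1) (auto simp: b_def)
    qed
    define P where "P = Lagrange_poly (m - 1) f (x ` {0..<m})"
    have "inj_on x {0..<m}" by (rule inj_on_subset[OF inj]) (use n in auto)
    then have "card (x ` {0..<m}) = Suc (m - 1)" using m by (simp add: card_image)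
    from degree_Lagrange_poly[OF this, of f] poly_Lagrange_poly[OF this, of _ f]
    have P: "degree P \<le> m - 1" "\<And>l. l < m \<Longrightarrow> poly P (x l) = f (x l)" by (auto simp: P_def)
    define D where "D k t = poly ((pderiv ^^ k) P) t + (\<Sum>i\<le>N. \<Delta> i * h i * G i k t)" for k t
    have der: "(D k has_real_derivative D (Suc k) t) (at t)" if "k < m - 1" for k t
      unfolding D_def[abs_def]
      by (intro DERIV_add DERIV_higher_pderiv DERIV_sum DERIV_cmult Gder) (use that in auto)
    have interp: "D 0 (x l) = f (x l)" if "l \<le> n" for l
      using that
    proof (induction l rule: less_induct)
      case (less l)
      show ?case
      proof (cases "l < m")
        case True
        then show ?thesis using P(2)[OF True] Gz[of _ l] less.prems by (simp add: D_def)
      next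
        case False
        define i0 where "i0 = l - m"
        have i0: "l = i0 + m" "i0 \<le> N" using False less.prems n unfolding i0_def N_def by linarith+
        \<comment> \<open>At the nodes from i0 to l all steps with i < i0 are fully on. Steps with i
          \<ge> i0 vanish before l, so Q matches f at the m nodes preceding l, and at l only the
          step i0 is added, with the value that Newton's formula demands.\<close>
        define Q where "Q = P + (\<Sum>i<i0. smult (\<Delta> i * h i) (\<Prod>k\<in>{Suc i..<i + m}. [:- x k, 1:]))"
        have DQ: "D 0 (x j) = poly Q (x j) + (\<Sum>i\<in>{i0..N}. \<Delta> i * h i * G i 0 (x j))"
          if "i0 \<le> j" "j \<le> l" for j
        proof -
          have split: "{..N} = {..<i0} \<union> {i0..N}" using i0 by auto
          have "(\<Sum>i<i0. \<Delta> i * h i * G i 0 (x j)) =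
              (\<Sum>i<i0. \<Delta> i * h i * (\<Prod>k\<in>{Suc i..<i + m}. x j - x k))"
            using that i0 less.prems by (intro sum.cong refl) (subst Gp, auto)
          then show ?thesis
            unfolding D_def Q_def split by (subst sum.union_disjoint) (auto simp: poly_sum poly_prod)
        qed
        have Qj: "poly Q (x j) = f (x j)" if "i0 \<le> j" "j < l" for j
        proof -
          have "(\<Sum>i\<in>{i0..N}. \<Delta> i * h i * G i 0 (x j)) = 0"
            using that i0 less.prems by (intro sum.neutral) (auto simp: Gz)
          then show ?thesis using DQ[of j] less.IH[of j] that less.prems by simp
        qed
        have degQ: "degree Q \<le> m - 1"
          unfolding Q_def
        proof (intro degree_add_le P(1) degree_sum_le order_trans[OF degree_smult_le])
          fix i
          have "degree (\<Prod>k\<in>{Suc i..<i + m}. [:- x k, 1:]) \<le> (\<Sum>k\<in>{Suc i..<i + m}. degree [:- x k, 1:])"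
            by (rule order_trans[OF degree_prod_sum_le]) auto
          then show "degree (\<Prod>k\<in>{Suc i..<i + m}. [:- x k, 1:]) \<le> m - 1" by simp
        qed auto
        define S where "S = x ` {i0..i0 + m}"
        have injS: "inj_on x {i0..i0 + m}" using inj_on_subset[OF inj] i0 less.prems by auto
        have "{i0..i0 + m} - {l} = {i0..<l}" using i0 by auto
        then have Sl: "S - {x l} = x ` {i0..<l}"
          unfolding S_def using inj_on_image_set_diff[OF injS Diff_subset, of "{l}"] i0 by simp
        have "f (x l) - poly Q (x l) = \<Delta> i0 * (\<Prod>y\<in>S - {x l}. x l - y)"
          unfolding \<Delta>_def S_def[symmetric]
        proof (rule divided_difference_Newton)
          show "card S = Suc m" unfolding S_def using injS by (simp add: card_image)
          show "x l \<in> S" using i0 by (auto simp: S_def)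
          show "degree Q \<le> m" using degQ by simp
          show "coeff Q m = 0" using degQ m by (intro coeff_eq_0) auto
          fix y assume "y \<in> S" "y \<noteq> x l"
          then have "y \<in> x ` {i0..<l}" using Sl by blast
          then show "poly Q y = f y" using Qj by auto
        qed
        also have "(\<Prod>y\<in>S - {x l}. x l - y) = (\<Prod>k\<in>{i0..<l}. x l - x k)"
        proof -
          have "inj_on x {i0..<l}" by (rule inj_on_subset[OF injS]) (use i0 in auto)
          then show ?thesis unfolding Sl by (simp add: prod.reindex)
        qed
        also have "\<dots> = h i0 * (\<Prod>k\<in>{Suc i0..<i0 + m}. x l - x k)"
          using prod.atLeast_Suc_lessThan[of i0 l "\<lambda>k. x l - x k"] i0 m by (simp add: h_def)
        also have "(\<Prod>k\<in>{Suc i0..<i0 + m}. x l - x k) = G i0 0 (x l)"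
          using Gp[of i0 l] i0 m less.prems by simp
        finally have "f (x l) = poly Q (x l) + \<Delta> i0 * h i0 * G i0 0 (x l)" by simp
        also have "\<Delta> i0 * h i0 * G i0 0 (x l) = (\<Sum>i\<in>{i0..N}. \<Delta> i * h i * G i 0 (x l))"
        proof -
          have "(\<Sum>i\<in>{i0..N}. \<Delta> i * h i * G i 0 (x l)) = (\<Sum>i\<in>{i0}. \<Delta> i * h i * G i 0 (x l))"
            using i0 less.prems by (intro sum.mono_neutral_right) (auto simp: Gz)
          then show ?thesis by simp
        qed
        finally show ?thesis using DQ[of l] i0 by simp
      qed
    qed
    define u where "u i s t = clamp_to (a i) (b i) t - clamp_to (a i) (b i) s" for i s t
    have u0: "0 \<le> u i s t" if "s \<le> t" for i s t using clamp_to_mono[OF that] by (simp add: u_def)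
    \<comment> \<open>The gap chosen for window i has left index i + d with d < m. For fixed d these
      gaps are adjacent as i varies, so their parts within \<open>{s..t}\<close> have total length
      at most t - s.\<close>
    have usum: "(\<Sum>i\<le>N. u i s t) \<le> real m * (t - s)" if st: "s \<le> t" for s t
    proof -
      define v where "v q = clamp_to (x q) (x (Suc q)) t - clamp_to (x q) (x (Suc q)) s" for q
      have v0: "0 \<le> v q" for q using clamp_to_mono[OF st] by (simp add: v_def)
      have "(\<Sum>i\<le>N. u i s t) \<le> (\<Sum>i\<le>N. \<Sum>d<m. v (i + d))"
      proof (rule sum_mono)
        fix i assume "i \<in> {..N}"
        then have "u i s t = v (i + (r i - i))" "r i - i < m"
          using r[of i] by (auto simp: u_def v_def a_def b_def)
        then show "u i s t \<le> (\<Sum>d<m. v (i + d))"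
          using member_le_sum[of "r i - i" "{..<m}" "\<lambda>d. v (i + d)"] v0 by simp
      qed
      also have "\<dots> = (\<Sum>d<m. \<Sum>i\<le>N. v (i + d))" by (rule sum.swap)
      also have "\<dots> \<le> (\<Sum>d<m. t - s)"
      proof (rule sum_mono)
        fix d assume d: "d \<in> {..<m}"
        have z: "x (i + d) \<le> x (Suc i + d)" if "i < Suc N" for i
          using that d n by (intro le) (auto simp: N_def)
        have "(\<Sum>i<Suc N. v (i + d)) =
            (\<Sum>i<Suc N. clamp_to (x (i + d)) (x (Suc i + d)) t - x (i + d)) -
            (\<Sum>i<Suc N. clamp_to (x (i + d)) (x (Suc i + d)) s - x (i + d))"
          unfolding sum_subtractf[symmetric] by (intro sum.cong) (auto simp: v_def)
        also have "\<dots> = clamp_to (x (0 + d)) (x (Suc N + d)) t - clamp_to (x (0 + d)) (x (Suc N + d)) s"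
          using sum_clamp_to[of "Suc N" "\<lambda>i. x (i + d)" t, OF z] sum_clamp_to[of "Suc N" "\<lambda>i. x (i + d)" s, OF z]
          by simp
        also have "\<dots> \<le> t - s" by (rule clamp_to_diff_le[OF st])
        finally show "(\<Sum>i\<le>N. v (i + d)) \<le> t - s" by (simp only: lessThan_Suc_atMost)
      qed
      finally show ?thesis by simp
    qed
    define B where "B = (C0 * real m) powr p * real m powr (p - 1)"
    have B: "0 \<le> B" "B \<le> C powr p"
    proof -
      have "B \<le> (C0 * real m) powr p * real m powr p"
        unfolding B_def using m by (intro mult_left_mono powr_mono) auto
      also have "\<dots> = (C0 * real m * real m) powr p" using C0 by (simp add: powr_mult)
      also have "\<dots> \<le> C powr p" using p C0 by (intro powr_mono2) (auto simp: C_def)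
      finally show "B \<le> C powr p" .
    qed (simp add: B_def)
    \<comment> \<open>The p-th power of \<Delta> i is spread evenly over the chosen gap, so W plays
      the part of the integral of the p-th power of a bound for the derivative of order m.\<close>
    define W where "W t = B * (\<Sum>i\<le>N. \<bar>\<Delta> i\<bar> powr p * (clamp_to (a i) (b i) t - a i))" for t
    define K where "K = C powr p * (\<Sum>i\<le>N. h i * \<bar>\<Delta> i\<bar> powr p)"
    have "power_majorant p K W (D (m - 1))"
      unfolding power_majorant_def
    proof (intro conjI allI impI)
      fix t
      have cl: "0 \<le> clamp_to (a i) (b i) t - a i" "clamp_to (a i) (b i) t - a i \<le> h i" if "i \<le> N" for i
        using clamp_to_bounds[of "a i" "b i" t] ab[OF that] hab(2)[OF that] by auto
      show "0 \<le> W t"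
        unfolding W_def using B cl by (intro mult_nonneg_nonneg sum_nonneg) auto
      show "W t \<le> K"
        unfolding W_def K_def
      proof (rule mult_mono)
        show "(\<Sum>i\<le>N. \<bar>\<Delta> i\<bar> powr p * (clamp_to (a i) (b i) t - a i)) \<le> (\<Sum>i\<le>N. h i * \<bar>\<Delta> i\<bar> powr p)"
          unfolding mult.commute[of _ "\<bar>_\<bar> powr p"] using cl by (intro sum_mono mult_left_mono) auto
        show "0 \<le> (\<Sum>i\<le>N. \<bar>\<Delta> i\<bar> powr p * (clamp_to (a i) (b i) t - a i))"
          using cl by (intro sum_nonneg mult_nonneg_nonneg) auto
      qed (use B in auto)
    next
      fix s t :: real assume st: "s < t"
      \<comment> \<open>The starting polynomial has degree at most m - 1, so it does not contribute
        to increments of the derivative of order m - 1.\<close>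
      have "poly ((pderiv ^^ (m - 1)) P) t = poly ((pderiv ^^ (m - 1)) P) s"
        unfolding poly_higher_pderiv_degree[OF P(1)] ..
      then have "D (m - 1) t - D (m - 1) s = (\<Sum>i\<le>N. \<Delta> i * h i * (G i (m - 1) t - G i (m - 1) s))"
        by (simp add: D_def right_diff_distrib sum_subtractf)
      then have "\<bar>D (m - 1) t - D (m - 1) s\<bar> \<le> (\<Sum>i\<le>N. \<bar>\<Delta> i * h i * (G i (m - 1) t - G i (m - 1) s)\<bar>)"
        by simp
      also have "\<dots> \<le> (\<Sum>i\<le>N. C0 * real m * (\<bar>\<Delta> i\<bar> * u i s t))"
      proof (rule sum_mono)
        fix i assume "i \<in> {..N}"
        then have i: "i \<le> N" by simp
        have h0: "0 \<le> h i" using ab[OF i] hab(2)[OF i] by linarith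
        have "h i * \<bar>G i (m - 1) t - G i (m - 1) s\<bar> \<le> h i * (C0 / (b i - a i) * u i s t)"
          using Glip[OF i, of t s] u0[of s t i] st h0 by (intro mult_left_mono) (auto simp: u_def)
        also have "\<dots> = h i / (b i - a i) * (C0 * u i s t)" by simp
        also have "\<dots> \<le> real m * (C0 * u i s t)"
          using hab(1)[OF i] ab[OF i] C0 u0[of s t i] st
          by (intro mult_right_mono) (auto simp: divide_le_eq)
        finally have "\<bar>\<Delta> i\<bar> * (h i * \<bar>G i (m - 1) t - G i (m - 1) s\<bar>) \<le> \<bar>\<Delta> i\<bar> * (real m * (C0 * u i s t))"
          by (intro mult_left_mono) auto
        then show "\<bar>\<Delta> i * h i * (G i (m - 1) t - G i (m - 1) s)\<bar> \<le> C0 * real m * (\<bar>\<Delta> i\<bar> * u i s t)"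
          using h0 by (simp add: abs_mult mult_ac)
      qed
      also have "\<dots> = C0 * real m * (\<Sum>i\<le>N. \<bar>\<Delta> i\<bar> * u i s t)" by (simp add: sum_distrib_left)
      finally have "\<bar>D (m - 1) t - D (m - 1) s\<bar> powr p \<le> (C0 * real m * (\<Sum>i\<le>N. \<bar>\<Delta> i\<bar> * u i s t)) powr p"
        using p by (intro powr_mono2) auto
      also have "\<dots> = (C0 * real m) powr p * (\<Sum>i\<le>N. \<bar>\<Delta> i\<bar> * u i s t) powr p"
        by (rule powr_mult)
      also have "\<dots> \<le> (C0 * real m) powr p * ((real m * (t - s)) powr (p - 1) * (\<Sum>i\<le>N. \<bar>\<Delta> i\<bar> powr p * u i s t))"
        using p st m u0 usum[of s t] by (intro mult_left_mono weighted_power_mean_le) auto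
      also have "\<dots> = (t - s) powr (p - 1) * (B * (\<Sum>i\<le>N. \<bar>\<Delta> i\<bar> powr p * u i s t))"
        using st by (simp add: B_def powr_mult)
      also have "B * (\<Sum>i\<le>N. \<bar>\<Delta> i\<bar> powr p * u i s t) = W t - W s"
        unfolding W_def right_diff_distrib[symmetric] sum_subtractf[symmetric] u_def by simp
      finally show "\<bar>D (m - 1) t - D (m - 1) s\<bar> powr p \<le> (t - s) powr (p - 1) * (W t - W s)" .
    qed
    then show "\<exists>D W. (\<forall>k<m - 1. \<forall>t. (D k has_real_derivative D (Suc k) t) (at t)) \<and>
        power_majorant p (C powr p *
           (\<Sum>i=0..n - m. (x (i + m) - x i) * \<bar>divided_difference m f (x ` {i..i + m})\<bar> powr p))
          W (D (m - 1)) \<and>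
        (\<forall>i\<le>n. D 0 (x i) = f (x i))"
      using der interp unfolding K_def h_def \<Delta>_def N_def atLeast0AtMost
      by (intro exI[of _ D] exI[of _ W] conjI allI impI)
  qed
qed

section \<open>Compactness\<close>

text \<open>The derivatives are independent functions tied together by the condition, so that their
  values can serve as separate coordinates of a product space.\<close>

definition derivative_chain ::
    "nat \<Rightarrow> real \<Rightarrow> real \<Rightarrow> (nat \<Rightarrow> real \<Rightarrow> real) \<Rightarrow> (real \<Rightarrow> real) \<Rightarrow> bool" where
  "derivative_chain n p K D W \<longleftrightarrow>
     (\<forall>k<n. \<forall>t. (D k has_real_derivative D (Suc k) t) (at t)) \<and> power_majorant p K W (D n)"

section \<open>Uniform estimates for derivative chains\<close>

lemma power_majorant_Hoelder:
  assumes maj: "power_majorant p K W G" and p: "p > 1"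
  shows "\<bar>G t - G s\<bar> \<le> K powr (1 / p) * \<bar>t - s\<bar> powr (1 - 1 / p)"
proof -
  have *: "\<bar>G t - G s\<bar> \<le> K powr (1 / p) * (t - s) powr (1 - 1 / p)" if st: "s < t" for s t
  proof -
    have "W t - W s \<le> K" "0 \<le> K"
      using power_majorant_bounds[OF maj, of s] power_majorant_bounds[OF maj, of t] by linarith+
    then have "\<bar>G t - G s\<bar> powr p \<le> (t - s) powr (p - 1) * K"
      using power_majorant_increment[OF maj st] mult_left_mono[of "W t - W s" K "(t - s) powr (p - 1)"] by simp
    then have "(\<bar>G t - G s\<bar> powr p) powr (1 / p) \<le> ((t - s) powr (p - 1) * K) powr (1 / p)"
      using p by (intro powr_mono2) auto
    moreover have "(p - 1) * (1 / p) = 1 - 1 / p" using p by (simp add: field_simps)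
    ultimately show ?thesis using p \<open>0 \<le> K\<close> by (simp add: powr_powr powr_mult mult.commute)
  qed
  consider "s < t" | "s = t" | "t < s" by linarith
  then show ?thesis
  proof cases
    case 1 then show ?thesis using *[of s t] by simp
  next
    case 2 then show ?thesis by simp
  next
    case 3 then show ?thesis using *[of t s] by (simp add: abs_minus_commute)
  qed
qed

text \<open>Divided differences of f at the n + 1 nodes fix the value of every D k at some point of
  the ball. Going down from k = n, where the Hoelder estimate applies, a bound for D (k + 1) then
  bounds D k.\<close>

lemma derivative_chain_bounded:
  assumes p: "p > 1" and x: "strict_mono_on {0..n} x" and k: "k \<le> n"
    and R: "\<And>i. i \<le> n \<Longrightarrow> \<bar>x i\<bar> \<le> R"
  shows "\<exists>M. \<forall>D W. derivative_chain n p K D W \<longrightarrow> (\<forall>i\<le>n. D 0 (x i) = f (x i)) \<longrightarrow>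
    (\<forall>t. \<bar>t\<bar> \<le> R \<longrightarrow> \<bar>D k t\<bar> \<le> M)"
proof -
  define c where "c k = fact k * divided_difference k f (x ` {0..k})" for k
  have mv: "\<exists>\<xi>. \<bar>\<xi>\<bar> \<le> R \<and> D k \<xi> = c k"
    if "derivative_chain n p K D W" "\<forall>i\<le>n. D 0 (x i) = f (x i)" "k \<le> n" for k D W
  proof -
    have "\<exists>\<xi>\<in>{x 0..x k}. D k \<xi> = fact k * divided_difference k f (x ` {0..k})"
      using that x by (intro divided_difference_mean_value)
        (auto simp: derivative_chain_def strict_mono_on_def)
    then obtain \<xi> where \<xi>: "x 0 \<le> \<xi>" "\<xi> \<le> x k" "D k \<xi> = c k" by (auto simp: c_def)
    have "\<bar>\<xi>\<bar> \<le> R" using \<xi> R[of 0] R[of k] that(3) by linarith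
    then show ?thesis using \<xi>(3) by blast
  qed
  show ?thesis
    using k
  proof (induction k rule: inc_induct)
    case base
    show ?case
    proof (intro exI[of _ "\<bar>c n\<bar> + K powr (1 / p) * (2 * R) powr (1 - 1 / p)"] allI impI)
      fix D W t assume D: "derivative_chain n p K D W" "\<forall>i\<le>n. D 0 (x i) = f (x i)" and t: "\<bar>t\<bar> \<le> R"
      obtain \<xi> where \<xi>: "\<bar>\<xi>\<bar> \<le> R" "D n \<xi> = c n" using mv[OF D] by blast
      have "\<bar>D n t - D n \<xi>\<bar> \<le> K powr (1 / p) * \<bar>t - \<xi>\<bar> powr (1 - 1 / p)"
        using D(1) p by (intro power_majorant_Hoelder) (auto simp: derivative_chain_def)
      also have "\<dots> \<le> K powr (1 / p) * (2 * R) powr (1 - 1 / p)"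
        using t \<xi>(1) p by (intro mult_left_mono powr_mono2) auto
      finally show "\<bar>D n t\<bar> \<le> \<bar>c n\<bar> + K powr (1 / p) * (2 * R) powr (1 - 1 / p)"
        using \<xi>(2) by linarith
    qed
  next
    case (step k)
    then obtain M where M: "\<And>D W t. derivative_chain n p K D W \<Longrightarrow> \<forall>i\<le>n. D 0 (x i) = f (x i) \<Longrightarrow>
        \<bar>t\<bar> \<le> R \<Longrightarrow> \<bar>D (Suc k) t\<bar> \<le> M" by blast
    show ?case
    proof (intro exI[of _ "\<bar>c k\<bar> + M * (2 * R)"] allI impI)
      fix D W t assume D: "derivative_chain n p K D W" "\<forall>i\<le>n. D 0 (x i) = f (x i)" and t: "\<bar>t\<bar> \<le> R"
      obtain \<xi> where \<xi>: "\<bar>\<xi>\<bar> \<le> R" "D k \<xi> = c k" using mv[OF D, of k] step by auto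
      have M0: "M \<ge> 0" using M[OF D t] by linarith
      have "norm (D k t - D k \<xi>) \<le> M * norm (t - \<xi>)"
      proof (rule field_differentiable_bound[of "{-R..R}"])
        show "(D k has_field_derivative D (Suc k) z) (at z within {-R..R})" for z
          using D(1) step(2) by (auto simp: derivative_chain_def intro: has_field_derivative_at_within)
        show "norm (D (Suc k) z) \<le> M" if "z \<in> {-R..R}" for z
          using M[OF D, of z] that by (auto simp: abs_le_iff)
      qed (use t \<xi> in \<open>auto simp: abs_le_iff\<close>)
      also have "\<dots> \<le> M * (2 * R)" using M0 t \<xi>(1) by (intro mult_left_mono) auto
      finally show "\<bar>D k t\<bar> \<le> \<bar>c k\<bar> + M * (2 * R)" using \<xi>(2) by simp
    qed
  qed
qed

text \<open>Differentiability is not preserved by pointwise limits; a Taylor estimate with M common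
  to all interpolating chains is. The modulus has a linear term for k + 1 < n and a Hoelder term for
  k + 1 = n.\<close>

lemma derivative_chain_local_bounds:
  assumes p: "p > 1" and x: "strict_mono_on {0..n} x"
    and R: "\<And>i. i \<le> n \<Longrightarrow> \<bar>x i\<bar> \<le> R"
  shows "\<exists>M. \<forall>D W. derivative_chain n p K D W \<longrightarrow> (\<forall>i\<le>n. D 0 (x i) = f (x i)) \<longrightarrow>
    (\<forall>k\<le>n. \<forall>t. \<bar>t\<bar> \<le> R \<longrightarrow> \<bar>D k t\<bar> \<le> M) \<and>
    (\<forall>k<n. \<forall>s t. \<bar>s\<bar> \<le> R \<longrightarrow> \<bar>t\<bar> \<le> R \<longrightarrow> \<bar>D k t - D k s - D (Suc k) s * (t - s)\<bar>
       \<le> M * (\<bar>t - s\<bar> + \<bar>t - s\<bar> powr (1 - 1 / p)) * \<bar>t - s\<bar>)"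
proof -
  have "\<exists>M. \<forall>k\<le>n. \<forall>D W. derivative_chain n p K D W \<longrightarrow> (\<forall>i\<le>n. D 0 (x i) = f (x i)) \<longrightarrow>
    (\<forall>t. \<bar>t\<bar> \<le> R \<longrightarrow> \<bar>D k t\<bar> \<le> M k)"
    using derivative_chain_bounded[OF p x _ R, of _ K f] by metis
  then obtain M where M: "\<And>k D W t. k \<le> n \<Longrightarrow> derivative_chain n p K D W \<Longrightarrow>
      (\<forall>i\<le>n. D 0 (x i) = f (x i)) \<Longrightarrow> \<bar>t\<bar> \<le> R \<Longrightarrow> \<bar>D k t\<bar> \<le> M k" by blast
  define L where "L = (\<Sum>k\<le>n. \<bar>M k\<bar>) + K powr (1 / p)"
  have MkL: "M k \<le> L" if "k \<le> n" for k
  proof -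
    have "\<bar>M k\<bar> \<le> (\<Sum>k\<le>n. \<bar>M k\<bar>)" using that by (intro member_le_sum) auto
    then show ?thesis using powr_ge_zero[of K "1 / p"] unfolding L_def by linarith
  qed
  have KL: "K powr (1 / p) \<le> L" "0 \<le> L" by (auto simp: L_def sum_nonneg)
  have bound: "\<bar>D k t\<bar> \<le> L"
    if "k \<le> n" "derivative_chain n p K D W" "\<forall>i\<le>n. D 0 (x i) = f (x i)" "\<bar>t\<bar> \<le> R" for D W k t
    using M[OF that] MkL[OF that(1)] by linarith
  show ?thesis
  proof (intro exI[of _ L] allI impI conjI)
    fix D W k t
    assume "derivative_chain n p K D W" "\<forall>i\<le>n. D 0 (x i) = f (x i)" "k \<le> n" "\<bar>t\<bar> \<le> R"
    then show "\<bar>D k t\<bar> \<le> L" using bound by blast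
  next
    fix D W assume D: "derivative_chain n p K D W" "\<forall>i\<le>n. D 0 (x i) = f (x i)"
    note bd = bound[OF _ D]
    fix k s t assume k: "k < n" and s: "\<bar>s\<bar> \<le> R" and t: "\<bar>t\<bar> \<le> R"
    define S where "S = {min s t..max s t}"
    define e where "e = \<bar>t - s\<bar> + \<bar>t - s\<bar> powr (1 - 1 / p)"
    have Sd: "\<bar>z - s\<bar> \<le> \<bar>t - s\<bar>" "\<bar>z\<bar> \<le> R" if "z \<in> S" for z using that s t by (auto simp: S_def)
    have der: "(D j has_real_derivative D (Suc j) z) (at z)" if "j < n" for j z
      using D(1) that by (simp add: derivative_chain_def)
    have close: "\<bar>D (Suc k) z - D (Suc k) s\<bar> \<le> L * e" if z: "z \<in> S" for z
    proof (cases "Suc k = n")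
      case True
      have "\<bar>D n z - D n s\<bar> \<le> K powr (1 / p) * \<bar>z - s\<bar> powr (1 - 1 / p)"
        using D(1) p by (intro power_majorant_Hoelder) (auto simp: derivative_chain_def)
      also have "\<dots> \<le> L * \<bar>t - s\<bar> powr (1 - 1 / p)"
        using KL Sd[OF z] p by (intro mult_mono powr_mono2) auto
      also have "\<dots> \<le> L * e" using KL by (intro mult_left_mono) (auto simp: e_def)
      finally show ?thesis using True by simp
    next
      case False
      have "norm (D (Suc k) z - D (Suc k) s) \<le> L * norm (z - s)"
      proof (rule field_differentiable_bound[of "{-R..R}"])
        show "(D (Suc k) has_field_derivative D (Suc (Suc k)) w) (at w within {-R..R})" for w
          using der[of "Suc k" w] k False by (auto intro: has_field_derivative_at_within)
        show "norm (D (Suc (Suc k)) w) \<le> L" if "w \<in> {-R..R}" for w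
          using bd[of "Suc (Suc k)" w] that k False by (auto simp: abs_le_iff)
      qed (use Sd[OF z] s in \<open>auto simp: abs_le_iff\<close>)
      also have "\<dots> \<le> L * e" using KL Sd[OF z] by (intro mult_left_mono) (auto simp: e_def intro: add_increasing2)
      finally show ?thesis by simp
    qed
    have "norm ((D k t - D (Suc k) s * t) - (D k s - D (Suc k) s * s)) \<le> (L * e) * norm (t - s)"
    proof (rule field_differentiable_bound[of S])
      show "((\<lambda>z. D k z - D (Suc k) s * z) has_field_derivative D (Suc k) z - D (Suc k) s) (at z within S)" for z
        by (rule derivative_eq_intros has_field_derivative_at_within[OF der[OF k]] refl | simp)+
      show "norm (D (Suc k) z - D (Suc k) s) \<le> L * e" if "z \<in> S" for z using close[OF that] by simp
    qed (auto simp: S_def)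
    then show "\<bar>D k t - D k s - D (Suc k) s * (t - s)\<bar>
       \<le> L * (\<bar>t - s\<bar> + \<bar>t - s\<bar> powr (1 - 1 / p)) * \<bar>t - s\<bar>"
      by (simp add: e_def algebra_simps)
  qed
qed

text \<open>The conditions on chains and the interpolation conditions are closed subsets of a
  compact box, and the hypothesis on finite subsets is the finite intersection property.\<close>

lemma derivative_chain_compactness:
  assumes p: "p > 1" and x: "strict_mono_on {0..n} x" "x ` {0..n} \<subseteq> E"
    and fin: "\<And>S. finite S \<Longrightarrow> S \<subseteq> E \<Longrightarrow> \<exists>D W. derivative_chain n p K D W \<and> (\<forall>y\<in>S. D 0 y = f y)"
  shows "\<exists>D W. derivative_chain n p K D W \<and> (\<forall>y\<in>E. D 0 y = f y)"
proof -
  define \<rho> where "\<rho> = (\<Sum>i\<le>n. \<bar>x i\<bar>)"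
  have \<rho>: "\<bar>x i\<bar> \<le> \<rho>" if "i \<le> n" for i
    unfolding \<rho>_def using that by (intro member_le_sum) auto
  have \<rho>0: "\<rho> \<ge> 0" by (simp add: \<rho>_def sum_nonneg)
  define e where "e d = d + d powr (1 - 1 / p)" for d :: real
  have "\<exists>M. \<forall>D W. derivative_chain n p K D W \<longrightarrow> (\<forall>i\<le>n. D 0 (x i) = f (x i)) \<longrightarrow>
    (\<forall>k\<le>n. \<forall>t. \<bar>t\<bar> \<le> \<rho> + \<bar>R\<bar> \<longrightarrow> \<bar>D k t\<bar> \<le> M) \<and>
    (\<forall>k<n. \<forall>s t. \<bar>s\<bar> \<le> \<rho> + \<bar>R\<bar> \<longrightarrow> \<bar>t\<bar> \<le> \<rho> + \<bar>R\<bar> \<longrightarrow> \<bar>D k t - D k s - D (Suc k) s * (t - s)\<bar>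
       \<le> M * (\<bar>t - s\<bar> + \<bar>t - s\<bar> powr (1 - 1 / p)) * \<bar>t - s\<bar>)" for R :: real
    using \<rho> by (intro derivative_chain_local_bounds p x) (simp add: add_increasing2)
  then obtain M where M: "\<And>R D W. derivative_chain n p K D W \<Longrightarrow> (\<forall>i\<le>n. D 0 (x i) = f (x i)) \<Longrightarrow>
    (\<forall>k\<le>n. \<forall>t. \<bar>t\<bar> \<le> \<rho> + \<bar>R\<bar> \<longrightarrow> \<bar>D k t\<bar> \<le> M R) \<and>
    (\<forall>k<n. \<forall>s t. \<bar>s\<bar> \<le> \<rho> + \<bar>R\<bar> \<longrightarrow> \<bar>t\<bar> \<le> \<rho> + \<bar>R\<bar> \<longrightarrow> \<bar>D k t - D k s - D (Suc k) s * (t - s)\<bar>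
       \<le> M R * e \<bar>t - s\<bar> * \<bar>t - s\<bar>)" unfolding e_def by metis
  \<comment> \<open>Coordinate (k, t) holds D k t for k \<le> n and W t for k = n + 1; further
    coordinates are idle. The absolute value of K is taken because nothing is known yet about its
    sign.\<close>
  define box where "box = PiE UNIV (\<lambda>(k, t). if k \<le> n then {- M t..M t} else {- \<bar>K\<bar>..\<bar>K\<bar>})"
  have "compactin (product_topology (\<lambda>_. euclidean) UNIV) box"
    unfolding box_def by (subst compactin_PiE) auto
  then have compact: "compact box" by (simp add: euclidean_product_topology)
  have coord: "continuous_on UNIV (\<lambda>z::nat \<times> real \<Rightarrow> real. z i)" for i
    by (rule continuous_on_product_coordinates)
  define C where "C = {z :: nat \<times> real \<Rightarrow> real.
      (\<forall>R k s t. k < n \<and> \<bar>s\<bar> \<le> \<rho> + \<bar>R\<bar> \<and> \<bar>t\<bar> \<le> \<rho> + \<bar>R\<bar> \<longrightarrow>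
          \<bar>z (k, t) - z (k, s) - z (Suc k, s) * (t - s)\<bar> \<le> M R * e \<bar>t - s\<bar> * \<bar>t - s\<bar>) \<and>
      (\<forall>t. 0 \<le> z (Suc n, t) \<and> z (Suc n, t) \<le> K) \<and>
      (\<forall>s t. s < t \<longrightarrow> \<bar>z (n, t) - z (n, s)\<bar> powr p \<le> (t - s) powr (p - 1) * (z (Suc n, t) - z (Suc n, s)))}"
  have closedC: "closed C"
    unfolding C_def
    by (intro closed_Collect_conj closed_Collect_all closed_Collect_imp closed_Collect_le
        continuous_intros continuous_on_powr' coord)
       (use p in auto)
  define H where "H y = {z :: nat \<times> real \<Rightarrow> real. z (0, y) = f y}" for y
  have closedH: "closed (H y)" for y
    unfolding H_def by (intro closed_Collect_eq coord continuous_on_const)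
  define \<F> where "\<F> = insert C (H ` E)"
  have "box \<inter> \<Inter>\<F> \<noteq> {}"
  proof (rule compact_imp_fip[OF compact])
    show "closed T" if "T \<in> \<F>" for T
      using that closedC closedH unfolding \<F>_def by blast
    fix \<F>' assume \<F>': "finite \<F>'" "\<F>' \<subseteq> \<F>"
    then have "finite (\<F>' - {C})" "\<F>' - {C} \<subseteq> H ` E"
      by (auto simp: \<F>_def)
    then obtain S where S: "S \<subseteq> E" "finite S" "\<F>' - {C} = H ` S"
      by (meson finite_subset_image)
    \<comment> \<open>The fixed nodes are adjoined to every finite set, since the bounds M hold only
      for chains that interpolate f there.\<close>
    have "finite (S \<union> x ` {0..n})" "S \<union> x ` {0..n} \<subseteq> E" using S(1,2) x(2) by auto
    from fin[OF this] obtain D W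
      where D: "derivative_chain n p K D W" "\<forall>y\<in>S \<union> x ` {0..n}. D 0 y = f y"
      by (elim exE conjE) (rule that)
    have maj: "power_majorant p K W (D n)" using D(1) by (simp add: derivative_chain_def)
    define z where "z = (\<lambda>(k, t). if k \<le> n then D k t else if k = Suc n then W t else 0)"
    have Dx: "\<forall>i\<le>n. D 0 (x i) = f (x i)" using D(2) by auto
    note MD = M[OF D(1) Dx]
    have zD: "z (k, t) = D k t" if "k \<le> n" for k t using that by (simp add: z_def)
    have zW: "z (Suc n, t) = W t" for t by (simp add: z_def)
    have "z \<in> C"
      unfolding C_def mem_Collect_eq zW
    proof (intro conjI allI impI)
      fix R k s t assume *: "k < n \<and> \<bar>s\<bar> \<le> \<rho> + \<bar>R\<bar> \<and> \<bar>t\<bar> \<le> \<rho> + \<bar>R\<bar>"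
      then have kn: "k \<le> n" "Suc k \<le> n" by auto
      show "\<bar>z (k, t) - z (k, s) - z (Suc k, s) * (t - s)\<bar> \<le> M R * e \<bar>t - s\<bar> * \<bar>t - s\<bar>"
        unfolding zD[OF kn(1)] zD[OF kn(2)]
        by (rule conjunct2[OF MD, rule_format]) (use * in auto)
    next
      fix s t :: real assume "s < t"
      then show "\<bar>z (n, t) - z (n, s)\<bar> powr p \<le> (t - s) powr (p - 1) * (W t - W s)"
        unfolding zD[OF order_refl] by (rule power_majorant_increment[OF maj])
    qed (use power_majorant_bounds[OF maj] in auto)
    moreover have "z \<in> box"
    proof -
      have "- M t \<le> D k t \<and> D k t \<le> M t" if "k \<le> n" for k t
      proof -
        have "\<bar>t\<bar> \<le> \<rho> + \<bar>t\<bar>" using \<rho>0 by simp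
        then have "\<bar>D k t\<bar> \<le> M t" by (rule conjunct1[OF MD, rule_format, OF that])
        then show ?thesis by (simp add: abs_le_iff)
      qed
      moreover have "- \<bar>K\<bar> \<le> W t \<and> W t \<le> \<bar>K\<bar>" for t
        using power_majorant_bounds[OF maj, of t] by linarith
      ultimately show ?thesis unfolding box_def z_def by auto
    qed
    moreover have "z \<in> T" if "T \<in> \<F>' - {C}" for T
      using that D(2) unfolding S(3) by (auto simp: z_def H_def)
    ultimately have "z \<in> box \<inter> \<Inter>\<F>'" by blast
    then show "box \<inter> \<Inter>\<F>' \<noteq> {}" by blast
  qed
  then obtain z where "z \<in> C" and zE: "\<And>y. y \<in> E \<Longrightarrow> z (0, y) = f y"
    unfolding \<F>_def H_def by auto
  then have taylor: "\<And>R k s t. k < n \<Longrightarrow> \<bar>s\<bar> \<le> \<rho> + \<bar>R\<bar> \<Longrightarrow> \<bar>t\<bar> \<le> \<rho> + \<bar>R\<bar> \<Longrightarrow>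
          \<bar>z (k, t) - z (k, s) - z (Suc k, s) * (t - s)\<bar> \<le> M R * e \<bar>t - s\<bar> * \<bar>t - s\<bar>"
    and maj: "power_majorant p K (\<lambda>t. z (Suc n, t)) (\<lambda>t. z (n, t))"
    unfolding C_def power_majorant_def by auto
  have "((\<lambda>t. z (k, t)) has_real_derivative z (Suc k, s)) (at s)" if k: "k < n" for k s
    unfolding has_field_derivative_iff
  proof (rule LIM_zero_cancel, rule Lim_null_comparison)
    define R where "R = \<bar>s\<bar> + 1"
    show "\<forall>\<^sub>F t in at s. norm ((z (k, t) - z (k, s)) / (t - s) - z (Suc k, s)) \<le> M R * e \<bar>t - s\<bar>"
      unfolding eventually_at
    proof (intro exI[of _ 1] conjI ballI impI)
      fix t assume t: "t \<noteq> s \<and> dist t s < 1"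
      have "\<bar>s\<bar> \<le> \<rho> + \<bar>R\<bar>" "\<bar>t\<bar> \<le> \<rho> + \<bar>R\<bar>"
        using t \<rho>0 by (auto simp: R_def dist_real_def)
      from taylor[OF k this]
      have "\<bar>z (k, t) - z (k, s) - z (Suc k, s) * (t - s)\<bar> / \<bar>t - s\<bar> \<le> M R * e \<bar>t - s\<bar>"
        using t by (simp add: divide_le_eq)
      moreover have "(z (k, t) - z (k, s)) / (t - s) - z (Suc k, s)
          = (z (k, t) - z (k, s) - z (Suc k, s) * (t - s)) / (t - s)"
        using t by (simp add: diff_divide_distrib)
      ultimately show "norm ((z (k, t) - z (k, s)) / (t - s) - z (Suc k, s)) \<le> M R * e \<bar>t - s\<bar>"
        by (simp add: abs_divide)
    qed simp
    have "((\<lambda>t. \<bar>t - s\<bar>) \<longlongrightarrow> \<bar>s - s\<bar>) (at s)" by (intro tendsto_intros)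
    then have lim: "((\<lambda>t. \<bar>t - s\<bar>) \<longlongrightarrow> 0) (at s)" by simp
    \<comment> \<open>The exponent 1 - 1 / p is positive, so the modulus tends to 0 and the divided
      Taylor estimate gives the derivative.\<close>
    have "((\<lambda>t. M R * e \<bar>t - s\<bar>) \<longlongrightarrow> M R * (0 + 0 powr (1 - 1 / p))) (at s)"
      unfolding e_def using p by (intro tendsto_mult tendsto_add tendsto_powr' tendsto_const lim) auto
    then show "((\<lambda>t. M R * e \<bar>t - s\<bar>) \<longlongrightarrow> 0) (at s)" by simp
  qed
  then have "derivative_chain n p K (\<lambda>k t. z (k, t)) (\<lambda>t. z (Suc n, t))"
    using maj by (simp add: derivative_chain_def)
  then show ?thesis using zE by blast
qed

section \<open>The trace theorem\<close>

lemma finite_set_enumeration: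
  fixes S :: "real set"
  assumes "finite S" "card S = Suc n"
  shows "\<exists>x. strict_mono_on {0..n} x \<and> x ` {0..n} = S"
proof -
  define xs where "xs = sorted_list_of_set S"
  have len: "length xs = Suc n" and set: "set xs = S"
    using assms by (auto simp: xs_def)
  have "sorted_wrt (<) xs" by (simp add: xs_def)
  then have "strict_mono_on {0..n} (\<lambda>i. xs ! i)"
    using len by (intro strict_mono_onI) (simp add: sorted_wrt_iff_nth_less)
  moreover have "(\<lambda>i. xs ! i) ` {0..n} = S"
    using len set by (auto simp: set_conv_nth less_Suc_eq_le)
  ultimately show ?thesis by blast
qed

lemma power_majorant_weaken: "power_majorant p K W G \<Longrightarrow> K \<le> K' \<Longrightarrow> power_majorant p K' W G"
  by (auto simp: power_majorant_def intro: order_trans)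

lemma derivative_chain_imp_Sobolev:
  assumes m: "m \<ge> 1" and p: "p > 1" and D: "derivative_chain (m - 1) p K D W"
  shows "D 0 \<in> homogeneous_Sobolev m p" "Sobolev_seminorm m p (D 0) \<le> K powr (1 / p)"
proof -
  have der: "(D k has_real_derivative D (Suc k) t) (at t)" if "k < m - 1" for k t
    using D that by (simp add: derivative_chain_def)
  have maj: "power_majorant p K W (D (m - 1))" using D by (simp add: derivative_chain_def)
  have Dk: "(deriv ^^ k) (D 0) = D k" if "k \<le> m - 1" for k
    using that
  proof (induction k)
    case (Suc k)
    then have "(deriv ^^ Suc k) (D 0) = deriv (D k)" by simp
    also have "\<dots> = D (Suc k)" using der[of k] Suc.prems by (intro ext DERIV_imp_deriv) auto
    finally show ?case .
  qed simp
  have Dm: "(deriv ^^ m) (D 0) = deriv (D (m - 1))"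
    using Dk[of "m - 1"] m by (cases m) auto
  note Lp = power_majorant_imp_Lp[OF maj p]
  have "(deriv ^^ k) (D 0) field_differentiable at t" if "k < m - 1" for k t
    using der[OF that] Dk[of k] that by (auto simp: field_differentiable_def)
  then show "D 0 \<in> homogeneous_Sobolev m p"
    unfolding homogeneous_Sobolev_def mem_Collect_eq Dm Dk[OF order_refl]
    using power_majorant_imp_abs_continuous[OF maj p] Lp(1) by blast
  show "Sobolev_seminorm m p (D 0) \<le> K powr (1 / p)"
    unfolding Sobolev_seminorm_def Lp_norm_def Dm
    using Lp(2) p by (intro powr_mono2) auto
qed

lemma Sobolev_imp_derivative_chain:
  assumes m: "m \<ge> 1" and p: "p > 1" and F: "F \<in> homogeneous_Sobolev m p"
  shows "\<exists>W. derivative_chain (m - 1) p (LINT x|lebesgue. \<bar>(deriv ^^ m) F x\<bar> powr p) (\<lambda>k. (deriv ^^ k) F) W"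
proof -
  have m1: "(deriv ^^ m) F = deriv ((deriv ^^ (m - 1)) F)" using m by (cases m) auto
  have "locally_abs_continuous ((deriv ^^ (m - 1)) F)" "Lp_function p ((deriv ^^ m) F)"
    using F unfolding homogeneous_Sobolev_def by blast+
  then obtain W where "power_majorant p (LINT x|lebesgue. \<bar>(deriv ^^ m) F x\<bar> powr p) W ((deriv ^^ (m - 1)) F)"
    unfolding m1 using Lp_imp_power_majorant[OF _ _ p] by blast
  then show ?thesis
    using F by (auto simp: derivative_chain_def homogeneous_Sobolev_def field_differentiable_derivI)
qed

lemma variation_functional_le_seminorm:
  assumes m: "m \<ge> 1" and p: "p > 1" and F: "F \<in> Sobolev_extensions m p E f"
  shows "variation_functional m p E f \<le> ennreal (real m * Sobolev_seminorm m p F)"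
proof -
  have FS: "F \<in> homogeneous_Sobolev m p" "\<And>x. x \<in> E \<Longrightarrow> F x = f x"
    using F by (auto simp: Sobolev_extensions_def)
  obtain W where D: "derivative_chain (m - 1) p (LINT x|lebesgue. \<bar>(deriv ^^ m) F x\<bar> powr p) (\<lambda>k. (deriv ^^ k) F) W"
    using Sobolev_imp_derivative_chain[OF m p FS(1)] by blast
  show ?thesis
    unfolding Sobolev_seminorm_def Lp_norm_def
    by (rule variation_functional_le[where D = "\<lambda>k. (deriv ^^ k) F" and W = W, OF m _ _ p])
       (use D FS(2) in \<open>auto simp: derivative_chain_def\<close>)
qed

lemma extension_of_finite_variation:
  assumes m: "m \<ge> 1"
  shows "\<exists>C\<ge>1. \<forall>p E f. 1 < p \<longrightarrow> (infinite E \<or> m + 1 \<le> card E) \<longrightarrow> variation_functional m p E f < \<infinity> \<longrightarrow>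
    (\<exists>F\<in>Sobolev_extensions m p E f. ennreal (Sobolev_seminorm m p F) \<le> ennreal C * variation_functional m p E f)"
proof -
  obtain C where C: "C \<ge> 1" and interp: "\<forall>p n x f. p > 1 \<longrightarrow> m \<le> n \<longrightarrow> strict_mono_on {0..n} x \<longrightarrow>
      (\<exists>D W. (\<forall>k<m - 1. \<forall>t. (D k has_real_derivative D (Suc k) t) (at t)) \<and>
        power_majorant p (C powr p *
           (\<Sum>i=0..n - m. (x (i + m) - x i) * \<bar>divided_difference m f (x ` {i..i + m})\<bar> powr p))
          W (D (m - 1)) \<and>
        (\<forall>i\<le>n. D 0 (x i) = f (x i)))"
    using finite_interpolation[OF m] by (elim exE conjE) (rule that)
  show ?thesis
  proof (intro exI[of _ C] conjI allI impI C)
    fix p :: real and E :: "real set" and f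
    assume p: "1 < p" and E: "infinite E \<or> m + 1 \<le> card E"
      and fin: "variation_functional m p E f < \<infinity>"
    define L where "L = enn2real (variation_functional m p E f)"
    have L: "variation_functional m p E f = ennreal L" "L \<ge> 0"
      using fin by (auto simp: L_def)
    \<comment> \<open>One bound for all finite subsets of E: the p-th power of the seminorm to be
      reached.\<close>
    define K where "K = (C * L) powr p"
    have bound: "C powr p * (\<Sum>i=0..n - m. (x (i + m) - x i) * \<bar>divided_difference m f (x ` {i..i + m})\<bar> powr p) \<le> K"
      if x: "m \<le> n" "strict_mono_on {0..n} x" "x ` {0..n} \<subseteq> E" for n x
    proof -
      define s where "s = (\<Sum>i=0..n - m. (x (i + m) - x i) * \<bar>divided_difference m f (x ` {i..i + m})\<bar> powr p)"
      have s0: "s \<ge> 0"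
        unfolding s_def
      proof (intro sum_nonneg mult_nonneg_nonneg)
        fix i assume "i \<in> {0..n - m}"
        then have "i + m \<in> {0..n}" using x(1) by auto
        then show "0 \<le> x (i + m) - x i" using strict_mono_on_leD[OF x(2), of i "i + m"] by auto
      qed auto
      have "(n, x) \<in> increasing_sequences m E" using x by (simp add: increasing_sequences_def)
      then have "ennreal (s powr (1 / p)) \<le> ennreal L"
        unfolding L(1)[symmetric] variation_functional_def s_def by (rule SUP_upper2) simp
      then have "s powr (1 / p) \<le> L" using L by simp
      then have "(s powr (1 / p)) powr p \<le> L powr p" using p by (intro powr_mono2) auto
      then have "s \<le> L powr p" using p s0 by (simp add: powr_powr)
      then have "C powr p * s \<le> C powr p * L powr p" by (intro mult_left_mono) auto
      then show ?thesis using C L by (simp add: K_def s_def powr_mult)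
    qed
    have "\<exists>B\<subseteq>E. finite B \<and> card B = Suc m"
    proof (cases "finite E")
      case True
      then have "Suc m \<le> card E" using E by simp
      then obtain B where "B \<subseteq> E" "card B = Suc m" "finite B" by (rule obtain_subset_with_card_n)
      then show ?thesis by blast
    next
      case False
      then show ?thesis using infinite_arbitrarily_large[of E "Suc m"] by blast
    qed
    \<comment> \<open>Adding these m + 1 points to a finite set guarantees n \<ge> m, so that the
      supremum applies; m of them are the fixed nodes of the compactness argument.\<close>
    then obtain B where B: "B \<subseteq> E" "finite B" "card B = Suc m" by blast
    obtain x0 where x0: "strict_mono_on {0..m} x0" "x0 ` {0..m} = B"
      using finite_set_enumeration[OF B(2,3)] by blast
    have "\<exists>D W. derivative_chain (m - 1) p K D W \<and> (\<forall>y\<in>E. D 0 y = f y)"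
    proof (rule derivative_chain_compactness[OF p])
      show "strict_mono_on {0..m - 1} x0"
        by (intro strict_mono_onI strict_mono_onD[OF x0(1)]) auto
      have "x0 ` {0..m - 1} \<subseteq> x0 ` {0..m}" by (intro image_mono) auto
      then show "x0 ` {0..m - 1} \<subseteq> E" using x0(2) B(1) by blast
      fix S assume S: "finite S" "S \<subseteq> E"
      define n where "n = card (S \<union> B) - 1"
      have "card B \<le> card (S \<union> B)" using S B by (intro card_mono) auto
      then have n: "card (S \<union> B) = Suc n" "m \<le> n" using B(3) by (auto simp: n_def)
      have "finite (S \<union> B)" using S B by simp
      from finite_set_enumeration[OF this n(1)]
      obtain x where x: "strict_mono_on {0..n} x" "x ` {0..n} = S \<union> B" by blast
      from interp[rule_format, OF p n(2) x(1), of f]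
      obtain D W where D: "\<forall>k<m - 1. \<forall>t. (D k has_real_derivative D (Suc k) t) (at t)"
        "power_majorant p (C powr p *
           (\<Sum>i=0..n - m. (x (i + m) - x i) * \<bar>divided_difference m f (x ` {i..i + m})\<bar> powr p))
          W (D (m - 1))" "\<forall>i\<le>n. D 0 (x i) = f (x i)"
        by (elim exE conjE) (rule that)
      have "power_majorant p K W (D (m - 1))"
        by (rule power_majorant_weaken[OF D(2) bound[OF n(2) x(1)]]) (use x(2) S B in auto)
      moreover have "D 0 y = f y" if "y \<in> S" for y
      proof -
        have "y \<in> x ` {0..n}" using that x(2) by blast
        then show ?thesis using D(3) by auto
      qed
      ultimately show "\<exists>D W. derivative_chain (m - 1) p K D W \<and> (\<forall>y\<in>S. D 0 y = f y)"
        using D(1) unfolding derivative_chain_def by blast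
    qed
    then obtain D W where D: "derivative_chain (m - 1) p K D W" "\<forall>y\<in>E. D 0 y = f y" by blast
    have "D 0 \<in> Sobolev_extensions m p E f"
      using derivative_chain_imp_Sobolev(1)[OF m p D(1)] D(2) by (simp add: Sobolev_extensions_def)
    moreover have "K powr (1 / p) = C * L" using C L p by (simp add: K_def powr_powr)
    then have "ennreal (Sobolev_seminorm m p (D 0)) \<le> ennreal (C * L)"
      using derivative_chain_imp_Sobolev(2)[OF m p D(1)] by (simp add: ennreal_leI)
    then have "ennreal (Sobolev_seminorm m p (D 0)) \<le> ennreal C * variation_functional m p E f"
      unfolding L(1) using C L(2) by (simp add: ennreal_mult)
    ultimately show "\<exists>F\<in>Sobolev_extensions m p E f.
        ennreal (Sobolev_seminorm m p F) \<le> ennreal C * variation_functional m p E f" by blast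
  qed
qed

theorem theorem1p7:
  fixes m :: nat
  assumes "m \<ge> 1"
  shows "\<exists>C::real. C \<ge> 1 \<and>
    (\<forall>(p::real) (E::real set) (f::real \<Rightarrow> real).
       1 < p \<longrightarrow> closed E \<longrightarrow> (infinite E \<or> m + 1 \<le> card E) \<longrightarrow>
         ((\<exists>F\<in>homogeneous_Sobolev m p. \<forall>x\<in>E. F x = f x) \<longleftrightarrow> variation_functional m p E f < \<infinity>) \<and>
         trace_seminorm m p E f \<le> ennreal C * variation_functional m p E f \<and>
         variation_functional m p E f \<le> ennreal C * trace_seminorm m p E f)"
proof -
  obtain C0 :: real where C0: "C0 \<ge> 1" and ext: "\<forall>p E f. 1 < p \<longrightarrow> (infinite E \<or> m + 1 \<le> card E) \<longrightarrow>
    variation_functional m p E f < \<infinity> \<longrightarrow>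
    (\<exists>F\<in>Sobolev_extensions m p E f. ennreal (Sobolev_seminorm m p F) \<le> ennreal C0 * variation_functional m p E f)"
    using extension_of_finite_variation[OF assms] by (elim exE conjE) (rule that)
  \<comment> \<open>C0 comes from the extension, m from the bound on the variation
    functional.\<close>
  define C where "C = max C0 (real m)"
  have C: "C \<ge> 1" "C0 \<le> C" "real m \<le> C" using C0 by (auto simp: C_def)
  show ?thesis
  proof (intro exI[of _ C] conjI allI impI C(1))
    fix p :: real and E :: "real set" and f :: "real \<Rightarrow> real"
    assume p: "1 < p" and E: "infinite E \<or> m + 1 \<le> card E"
    let ?V = "variation_functional m p E f"
    have ex: "\<exists>F\<in>Sobolev_extensions m p E f. ennreal (Sobolev_seminorm m p F) \<le> ennreal C0 * ?V"
      if "?V < \<infinity>"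
      using ext p E that by blast
    have le: "?V \<le> ennreal C * ennreal (Sobolev_seminorm m p F)" if F: "F \<in> Sobolev_extensions m p E f" for F
    proof -
      have "0 \<le> Sobolev_seminorm m p F" by (simp add: Sobolev_seminorm_def Lp_norm_def)
      then have "ennreal (real m * Sobolev_seminorm m p F) \<le> ennreal (C * Sobolev_seminorm m p F)"
        using C by (intro ennreal_leI mult_right_mono) auto
      then show ?thesis
        using variation_functional_le_seminorm[OF assms p F] C \<open>0 \<le> Sobolev_seminorm m p F\<close>
        by (simp add: ennreal_mult)
    qed
    show "(\<exists>F\<in>homogeneous_Sobolev m p. \<forall>x\<in>E. F x = f x) \<longleftrightarrow> ?V < \<infinity>"
    proof
      assume "\<exists>F\<in>homogeneous_Sobolev m p. \<forall>x\<in>E. F x = f x"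
      then obtain F where "F \<in> Sobolev_extensions m p E f" by (auto simp: Sobolev_extensions_def)
      from le[OF this] show "?V < \<infinity>"
        by (rule le_less_trans) (simp add: ennreal_mult_less_top)
    next
      assume "?V < \<infinity>"
      from ex[OF this] show "\<exists>F\<in>homogeneous_Sobolev m p. \<forall>x\<in>E. F x = f x"
        by (auto simp: Sobolev_extensions_def)
    qed
    show "trace_seminorm m p E f \<le> ennreal C * ?V"
    proof (cases "?V < \<infinity>")
      case True
      then obtain F where F: "F \<in> Sobolev_extensions m p E f"
          "ennreal (Sobolev_seminorm m p F) \<le> ennreal C0 * ?V" using ex by blast
      have "trace_seminorm m p E f \<le> ennreal (Sobolev_seminorm m p F)"
        unfolding trace_seminorm_def by (rule INF_lower[OF F(1)])
      also note F(2)
      also have "ennreal C0 * ?V \<le> ennreal C * ?V"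
        using C(2) by (intro mult_right_mono ennreal_leI) auto
      finally show ?thesis .
    next
      case False
      then have "?V = \<infinity>" by (simp add: less_top[symmetric])
      then have "ennreal C * ?V = \<infinity>" using C(1) by (simp add: ennreal_mult_top)
      then show ?thesis by simp
    qed
    \<comment> \<open>Dividing by C first makes the left side a lower bound of the infimum, which
      also covers the case of no extension.\<close>
    have "?V / ennreal C \<le> trace_seminorm m p E f"
      unfolding trace_seminorm_def
    proof (rule INF_greatest)
      fix F assume "F \<in> Sobolev_extensions m p E f"
      from le[OF this] show "?V / ennreal C \<le> ennreal (Sobolev_seminorm m p F)"
        using C(1) by (intro divide_le_posI_ennreal) (auto simp: mult.commute)
    qed
    then have "ennreal C * (?V / ennreal C) \<le> ennreal C * trace_seminorm m p E f"
      by (rule mult_left_mono) simp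
    moreover have "ennreal C * (?V / ennreal C) = ?V"
      using C(1) by (simp add: ennreal_times_divide mult.commute[of _ ?V] mult_divide_eq_ennreal)
    ultimately show "?V \<le> ennreal C * trace_seminorm m p E f" by simp
  qed
qed

end
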